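(* Let $a\ge b\ge 5$ and $n>a+b$ be integers, and let $m\in[a]$, $t\in[b]$ with $m\ge a-b+3$ and $t\ge 3$. Take $A_1,A_2\in\binom{[2,n]}{a}$ with $A_1\cap A_2=[2,m+1]$ and $B_1,B_2\in\binom{[2,n]}{b}$ with $B_1\cap B_2=[2,t+1]$, and define $$\mathcal{A}^*:=\Big\{H\in\tbinom{[n]}{a}:1\in H,\ H\cap B_1\ne\emptyset,\ H\cap B_2\ne\emptyset\Big\}\cup\{A_1,A_2\},$$ $$\mathcal{B}^*:=\Big\{H\in\tbinom{[n]}{b}:1\in H,\ H\cap A_1\ne\emptyset,\ H\cap A_2\ne\emptyset\Big\}\cup\{B_1,B_2\}.$$ Let $\mathcal{A}\subset\binom{[n]}{a}$ and $\mathcal{B}\subset\binom{[n]}{b}$ be cross-intersecting families such that $|\bigcap_{A\in\mathcal{A}_\gamma}A|\le m$ and $|\bigcap_{B\in\mathcal{B}_\gamma}B|\le t$. If $|\mathcal{A}|\ge|\mathcal{A}^*|$ and $|\mathcal{B}|\ge|\mathcal{B}^*|$, then $|\mathcal{A}|=|\mathcal{A}^*|$ and $|\mathcal{B}|=|\mathcal{B}^*|$.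
   Context: $[n]=\{1,\dots,n\}$, $[p,q]=\{p,p+1,\dots,q\}$; $\binom{X}{k}$ is the family of all $k$-subsets of $X$. Families $\mathcal{F},\mathcal{G}$ are cross-intersecting if $F\cap G\ne\emptyset$ for all $F\in\mathcal{F}$, $G\in\mathcal{G}$. For a family $\mathcal{F}$ fix an element $x$ of maximum degree (i.e. contained in the largest number of members of $\mathcal{F}$; chosen arbitrarily if there are several); the diversity part is $\mathcal{F}_\gamma=\{F\in\mathcal{F}:x\notin F\}$. The intersection of an empty family of subsets of $[n]$ is $[n]$. *)

theory Defs
  imports "HOL-Library.Ramsey"
begin

definition cross_intersecting :: "'a set set \<Rightarrow> 'a set set \<Rightarrow> bool" where
  "cross_intersecting \<F> \<G> \<longleftrightarrow> (\<forall>F\<in>\<F>. \<forall>G\<in>\<G>. F \<inter> G \<noteq> {})"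

definition family_degree :: "'a set set \<Rightarrow> 'a \<Rightarrow> nat" where
  "family_degree \<F> x = card {F \<in> \<F>. x \<in> F}"

text \<open>The set \<open>X\<close> is the ground set of \<open>\<F>\<close>. Several elements may have maximum degree, so
  this is a predicate on \<open>x\<close> rather than a chosen element, and the diversity part below takes
  \<open>x\<close> as a parameter.\<close>

definition max_degree_element :: "'a set \<Rightarrow> 'a set set \<Rightarrow> 'a \<Rightarrow> bool" where
  "max_degree_element X \<F> x \<longleftrightarrow> x \<in> X \<and> (\<forall>y\<in>X. family_degree \<F> y \<le> family_degree \<F> x)"

definition diversity_part :: "'a set set \<Rightarrow> 'a \<Rightarrow> 'a set set" where
  "diversity_part \<F> x = {F \<in> \<F>. x \<notin> F}"

text \<open>Intersecting with the ground set only matters for the empty family, whose intersection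
  is \<open>X\<close> rather than \<^term>\<open>UNIV\<close>.\<close>

definition family_Inter :: "'a set \<Rightarrow> 'a set set \<Rightarrow> 'a set" where
  "family_Inter X \<F> = X \<inter> \<Inter>\<F>"

text \<open>\<open>\<A>\<^sup>*\<close> is \<open>star_family n a A\<^sub>1 A\<^sub>2 B\<^sub>1 B\<^sub>2\<close> and \<open>\<B>\<^sup>*\<close> is \<open>star_family n b B\<^sub>1 B\<^sub>2 A\<^sub>1 A\<^sub>2\<close>.\<close>

definition star_family ::
    "nat \<Rightarrow> nat \<Rightarrow> nat set \<Rightarrow> nat set \<Rightarrow> nat set \<Rightarrow> nat set \<Rightarrow> nat set set" where
  "star_family n k P\<^sub>1 P\<^sub>2 Q\<^sub>1 Q\<^sub>2 =
     {H \<in> [{1..n}]\<^bsup>k\<^esup>. 1 \<in> H \<and> H \<inter> Q\<^sub>1 \<noteq> {} \<and> H \<inter> Q\<^sub>2 \<noteq> {}} \<union> {P\<^sub>1, P\<^sub>2}"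

end

theory Submission
  imports Defs Complex_Main
begin

text \<open>Set compressions turn a cross-intersecting pair into a pair of lexicographic initial segments,
  which yields the Kruskal--Katona bounds. Compressing a pair that is as large as
  \<open>(\<A>\<^sup>*, \<B>\<^sup>*)\<close> step by step ends with a pair concentrated on one element, and by a gap in the
  possible numbers of sets avoiding an element no single step can create such concentration. So
  the original pair is concentrated on one element \<open>z\<close>, which is then the only element of maximum
  degree in both families.

  Let \<open>k\<close> and \<open>l\<close> be the numbers of members of \<open>\<A>\<close> and \<open>\<B>\<close> that avoid \<open>z\<close>. Since these members have
  few elements in common, they exclude many sets through \<open>z\<close> from the other family: compared with
  the extremal pair, each additional member of \<open>\<A>\<close> avoiding \<open>z\<close> costs \<open>\<B>\<close> on average at least
  \<open>F / E\<close> sets, and vice versa with \<open>E / F\<close>. If the families exceed the extremal sizes by \<open>\<alpha>\<close> and \<open>\<beta>\<close>,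
  and \<open>k', l'\<close> are the excesses of \<open>k\<close> and \<open>l\<close>, then \<open>E \<beta> + F k' \<le> E l'\<close> and \<open>F \<alpha> + E l' \<le> F k'\<close>,
  so \<open>\<alpha> = \<beta> = 0\<close>.\<close>

section \<open>Counting\<close>

text \<open>Compressions do not preserve the bounds on the common intersections, so the search for
  \<open>z\<close> uses sizes only. The intersections enter in a second run of compressions, on the
  members avoiding \<open>z\<close>: one compression enlarges a common intersection by at most one
  element, so the run can stop once three elements are common, and \<open>3 \<le> m\<close>,
  \<open>3 \<le> t\<close> keep the bound intact. Three common elements are what the value of
  \<open>E\<close> rests on. The gap reaches from C(n-4, a-3) to C(n-3, a-2), the numbers of a-sets
  that avoid \<open>z\<close> and contain three, respectively two, fixed elements. Its width C(n-4,
  a-2) bounds the number of sets moved by an exchange of at least two elements; exchanges of single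
  elements need an argument about two candidate centers. The conditions on \<open>m\<close> and
  \<open>t\<close> give \<open>a - m \<le> b - 3\<close> and \<open>b - t \<le> b - 3\<close>, and
  \<open>5 \<le> b\<close> gives \<open>2 \<le> b - 3\<close>; the comparison of the extremal sizes
  with the two-out-of-three families rests on this. \<open>E\<close> = C(n-3-b, a-3) and
  \<open>F\<close> = C(n-3-a, b-3) change places when \<open>a\<close> and \<open>b\<close> do, so
  the two exchange rates are reciprocal.\<close>

lemma nsetsD:
  assumes "H \<in> [S]\<^bsup>k\<^esup>"
  shows "H \<subseteq> S" "finite H" "card H = k"
  using assms by (auto simp: nsets_def)

lemma nsets_containing_avoiding_image:
  assumes "finite S" "T \<subseteq> S" "T \<inter> Z = {}" "card T \<le> k"
  shows "{H \<in> [S]\<^bsup>k\<^esup>. T \<subseteq> H \<and> H \<inter> Z = {}} = (\<lambda>H. H \<union> T) ` ([S - T - Z]\<^bsup>(k - card T)\<^esup>)"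
proof -
  have fT: "finite T" using assms finite_subset by blast
  show ?thesis
  proof (intro set_eqI iffI)
    fix H assume "H \<in> {H \<in> [S]\<^bsup>k\<^esup>. T \<subseteq> H \<and> H \<inter> Z = {}}"
    then have H: "H \<subseteq> S" "finite H" "card H = k" "T \<subseteq> H" "H \<inter> Z = {}"
      by (auto simp: nsets_def)
    have "H - T \<in> [S - T - Z]\<^bsup>(k - card T)\<^esup>"
      using H fT by (auto simp: nsets_def card_Diff_subset)
    moreover have "H = (H - T) \<union> T" using H by blast
    ultimately show "H \<in> (\<lambda>H. H \<union> T) ` ([S - T - Z]\<^bsup>(k - card T)\<^esup>)" by blast
  next
    fix H assume "H \<in> (\<lambda>H. H \<union> T) ` ([S - T - Z]\<^bsup>(k - card T)\<^esup>)"
    then obtain G where G: "G \<subseteq> S - T - Z" "finite G" "card G = k - card T" "H = G \<union> T"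
      by (auto simp: nsets_def)
    have "card H = k" using G fT assms by (subst G(4), subst card_Un_disjoint) auto
    then show "H \<in> {H \<in> [S]\<^bsup>k\<^esup>. T \<subseteq> H \<and> H \<inter> Z = {}}"
      using G fT assms by (auto simp: nsets_def)
  qed
qed

lemma inj_on_Un_right: "(\<And>H. H \<in> \<F> \<Longrightarrow> H \<inter> T = {}) \<Longrightarrow> inj_on (\<lambda>H. H \<union> T) \<F>"
  unfolding inj_on_def by (metis Diff_cancel Un_Diff Un_Diff_Int)

lemma card_nsets_containing_avoiding:
  assumes "finite S" "T \<subseteq> S" "Z \<subseteq> S" "T \<inter> Z = {}" "card T \<le> k"
  shows "card {H \<in> [S]\<^bsup>k\<^esup>. T \<subseteq> H \<and> H \<inter> Z = {}} = (card S - card T - card Z) choose (k - card T)"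
proof -
  have "inj_on (\<lambda>H. H \<union> T) ([S - T - Z]\<^bsup>(k - card T)\<^esup>)"
    by (rule inj_on_Un_right) (auto simp: nsets_def)
  then have "card {H \<in> [S]\<^bsup>k\<^esup>. T \<subseteq> H \<and> H \<inter> Z = {}} = card ([S - T - Z]\<^bsup>(k - card T)\<^esup>)"
    using nsets_containing_avoiding_image[OF assms(1,2,4,5)] by (simp add: card_image)
  also have "\<dots> = card (S - T - Z) choose (k - card T)" using assms by simp
  also have "card (S - T - Z) = card S - card T - card Z"
  proof -
    have "finite T" "finite Z" using assms by (auto intro: finite_subset)
    moreover have "Z \<subseteq> S - T" using assms by auto
    ultimately show ?thesis using assms by (simp add: card_Diff_subset)
  qed
  finally show ?thesis .
qed

lemma card_nsets_containing:
  assumes "finite S" "T \<subseteq> S" "card T \<le> k"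
  shows "card {H \<in> [S]\<^bsup>k\<^esup>. T \<subseteq> H} = (card S - card T) choose (k - card T)"
  using card_nsets_containing_avoiding[of S T "{}" k] assms by simp

lemma card_nsets_avoiding:
  assumes "finite S" "Z \<subseteq> S"
  shows "card {H \<in> [S]\<^bsup>k\<^esup>. H \<inter> Z = {}} = (card S - card Z) choose k"
  using card_nsets_containing_avoiding[of S "{}" Z k] assms by simp

lemma double_count:
  assumes "finite X" "finite Y"
  shows "(\<Sum>x\<in>X. card {y \<in> Y. R x y}) = (\<Sum>y\<in>Y. card {x \<in> X. R x y})"
proof -
  have "(\<Sum>x\<in>X. card {y \<in> Y. R x y}) = (\<Sum>x\<in>X. \<Sum>y\<in>Y. if R x y then 1 else 0)"
    using assms by (intro sum.cong refl) (simp add: sum.If_cases Int_def)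
  also have "\<dots> = (\<Sum>y\<in>Y. \<Sum>x\<in>X. if R x y then 1 else 0)" by (rule sum.swap)
  also have "\<dots> = (\<Sum>y\<in>Y. card {x \<in> X. R x y})"
    using assms by (intro sum.cong refl) (simp add: sum.If_cases Int_def)
  finally show ?thesis .
qed

text \<open>The disjointness graph between the \<open>p\<close>-subsets and the \<open>q\<close>-subsets of \<open>W\<close> is biregular, and
  a cross-intersecting pair is an independent set of it.\<close>

lemma cross_intersecting_biregular:
  assumes "finite W" "\<X> \<subseteq> [W]\<^bsup>p\<^esup>" "\<Y> \<subseteq> [W]\<^bsup>q\<^esup>" "cross_intersecting \<X> \<Y>" "p + q \<le> card W"
  shows "card \<X> * (card W choose q) + card \<Y> * (card W choose p)
    \<le> (card W choose p) * (card W choose q)"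
proof -
  define w where "w = card W"
  have fin: "finite \<X>" "finite \<Y>" "finite ([W]\<^bsup>p\<^esup>)" "finite ([W]\<^bsup>q\<^esup>)"
    using assms(1) finite_subset[OF assms(2)] finite_subset[OF assms(3)]
    by (simp_all add: finite_imp_finite_nsets)
  have dX: "card {G \<in> [W]\<^bsup>q\<^esup>. F \<inter> G = {}} = (w - p) choose q" if "F \<in> [W]\<^bsup>p\<^esup>" for F
    using card_nsets_avoiding[OF assms(1), of F q] nsetsD[OF that] by (simp add: w_def Int_commute)
  have dY: "card {F \<in> [W]\<^bsup>p\<^esup>. F \<inter> G = {}} = (w - q) choose p" if "G \<in> [W]\<^bsup>q\<^esup>" for G
    using card_nsets_avoiding[OF assms(1), of G p] nsetsD[OF that] by (simp add: w_def)
  have total: "(w choose p) * ((w - p) choose q) = (w choose q) * ((w - q) choose p)"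
    using double_count[OF fin(3,4), of "\<lambda>F G. F \<inter> G = {}"] dX dY
    by (simp add: w_def)
  have sub: "(card \<X>) * ((w - p) choose q) \<le> (\<Sum>G\<in>[W]\<^bsup>q\<^esup> - \<Y>. card {F \<in> \<X>. F \<inter> G = {}})"
  proof -
    have "(card \<X>) * ((w - p) choose q) = (\<Sum>F\<in>\<X>. card {G \<in> [W]\<^bsup>q\<^esup>. F \<inter> G = {}})"
      using dX assms(2) by (subst sum.cong[OF refl, of _ _ "\<lambda>_. (w - p) choose q"]) auto
    also have "\<dots> = (\<Sum>F\<in>\<X>. card {G \<in> [W]\<^bsup>q\<^esup> - \<Y>. F \<inter> G = {}})"
      using assms(4) unfolding cross_intersecting_def
      by (intro sum.cong refl arg_cong[where f = card]) blast
    also have "\<dots> = (\<Sum>G\<in>[W]\<^bsup>q\<^esup> - \<Y>. card {F \<in> \<X>. F \<inter> G = {}})"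
      by (rule double_count) (use fin in auto)
    finally show ?thesis by simp
  qed
  also have "\<dots> \<le> (\<Sum>G\<in>[W]\<^bsup>q\<^esup> - \<Y>. (w - q) choose p)"
  proof (rule sum_mono)
    fix G assume "G \<in> [W]\<^bsup>q\<^esup> - \<Y>"
    then have "card {F \<in> [W]\<^bsup>p\<^esup>. F \<inter> G = {}} = (w - q) choose p" using dY by blast
    moreover have "card {F \<in> \<X>. F \<inter> G = {}} \<le> card {F \<in> [W]\<^bsup>p\<^esup>. F \<inter> G = {}}"
      using assms(2) fin by (intro card_mono) auto
    ultimately show "card {F \<in> \<X>. F \<inter> G = {}} \<le> (w - q) choose p" by simp
  qed
  also have "\<dots> = ((w choose q) - card \<Y>) * ((w - q) choose p)"
    using fin assms by (simp add: card_Diff_subset w_def)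
  finally have main: "card \<X> * ((w - p) choose q) \<le> ((w choose q) - card \<Y>) * ((w - q) choose p)" .
  have Yle: "card \<Y> \<le> w choose q"
    using card_mono[OF fin(4) assms(3)] by (simp add: w_def)
  have pos: "(w - p) choose q > 0" using assms(5) by (simp add: w_def)
  have "card \<X> * (w choose q) * ((w - p) choose q)
      \<le> (w choose q) * (((w choose q) - card \<Y>) * ((w - q) choose p))"
    using mult_le_mono2[OF main, of "w choose q"] by (simp add: ac_simps)
  also have "\<dots> = ((w choose q) - card \<Y>) * (w choose p) * ((w - p) choose q)"
    using total by (simp add: ac_simps)
  finally have "card \<X> * (w choose q) \<le> ((w choose q) - card \<Y>) * (w choose p)"
    using pos by simp
  moreover obtain d where "w choose q = card \<Y> + d" using Yle le_Suc_ex by blast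
  ultimately show ?thesis unfolding w_def[symmetric] by (simp add: algebra_simps)
qed

section \<open>Compressions\<close>

text \<open>As \<open>U\<close> and \<open>V\<close> are disjoint, \<open>Min U < Min V\<close> says
  that replacing \<open>V\<close> by \<open>U\<close> makes a set lexicographically earlier.\<close>

definition exchange_pair :: "nat set \<Rightarrow> nat set \<Rightarrow> nat set \<Rightarrow> bool" where
  "exchange_pair S U V \<longleftrightarrow> U \<subseteq> S \<and> V \<subseteq> S \<and> finite U \<and> finite V \<and> U \<noteq> {} \<and> U \<inter> V = {} \<and>
     card U = card V \<and> Min U < Min V"

definition exchange :: "nat set \<Rightarrow> nat set \<Rightarrow> nat set set \<Rightarrow> nat set \<Rightarrow> nat set" where
  "exchange U V \<F> H =
     (if V \<subseteq> H \<and> U \<inter> H = {} \<and> (H - V) \<union> U \<notin> \<F> then (H - V) \<union> U else H)"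

abbreviation compress :: "nat set \<Rightarrow> nat set \<Rightarrow> nat set set \<Rightarrow> nat set set" where
  "compress U V \<F> \<equiv> exchange U V \<F> ` \<F>"

definition compressed :: "nat set \<Rightarrow> nat set \<Rightarrow> nat set set \<Rightarrow> bool" where
  "compressed U V \<F> \<longleftrightarrow> (\<forall>H\<in>\<F>. V \<subseteq> H \<and> U \<inter> H = {} \<longrightarrow> (H - V) \<union> U \<in> \<F>)"

lemma inj_on_exchange: "inj_on (exchange U V \<F>) \<F>"
proof (rule inj_onI)
  fix F G assume FG: "F \<in> \<F>" "G \<in> \<F>" "exchange U V \<F> F = exchange U V \<F> G"
  have "F = G" if "V \<subseteq> F" "U \<inter> F = {}" "V \<subseteq> G" "U \<inter> G = {}" "(F - V) \<union> U = (G - V) \<union> U"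
    using that by blast
  then show "F = G" using FG unfolding exchange_def by (auto split: if_splits)
qed

lemma card_compress: "card (compress U V \<F>) = card \<F>"
  by (rule card_image) (rule inj_on_exchange)

lemma exchange_in_nsets:
  assumes "exchange_pair S U V" "H \<in> [S]\<^bsup>k\<^esup>"
  shows "exchange U V \<F> H \<in> [S]\<^bsup>k\<^esup>"
proof -
  have "(H - V) \<union> U \<in> [S]\<^bsup>k\<^esup>" if "V \<subseteq> H" "U \<inter> H = {}"
  proof -
    have H: "H \<subseteq> S" "finite H" "card H = k" using nsetsD[OF assms(2)] by auto
    have UV: "U \<subseteq> S" "finite U" "finite V" "card U = card V"
      using assms(1) by (auto simp: exchange_pair_def)
    have "card ((H - V) \<union> U) = card (H - V) + card U"
      using that H UV by (intro card_Un_disjoint) auto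
    also have "\<dots> = k" using H UV that card_mono[OF H(2) that(1)] by (simp add: card_Diff_subset)
    finally show ?thesis using H UV by (auto simp: nsets_def)
  qed
  then show ?thesis using assms(2) by (auto simp: exchange_def)
qed

lemma compress_subset_nsets:
  "exchange_pair S U V \<Longrightarrow> \<F> \<subseteq> [S]\<^bsup>k\<^esup> \<Longrightarrow> compress U V \<F> \<subseteq> [S]\<^bsup>k\<^esup>"
  using exchange_in_nsets by blast

text \<open>If only a part \<open>W\<close> of \<open>V\<close> lies in a member \<open>G\<close>, then \<open>W\<close> can be exchanged against a subset of
  \<open>U\<close> of the same size, and this smaller exchange is already available.\<close>

lemma exchanged_meets_unexchanged:
  assumes UV: "exchange_pair S U V"
    and st: "\<And>U' V'. exchange_pair S U' V' \<Longrightarrow> card U' < card U \<Longrightarrow> compressed U' V' \<G>"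
    and cross: "cross_intersecting \<F> \<G>"
    and F: "F \<in> \<F>" "V \<subseteq> F" "U \<inter> F = {}"
    and G: "G \<in> \<G>" "V \<subseteq> G \<and> U \<inter> G = {} \<longrightarrow> (G - V) \<union> U \<in> \<G>"
  shows "((F - V) \<union> U) \<inter> G \<noteq> {}"
proof
  assume disj: "((F - V) \<union> U) \<inter> G = {}"
  have cr: "F \<inter> G' \<noteq> {}" if "G' \<in> \<G>" for G'
    using cross F that by (auto simp: cross_intersecting_def)
  show False
  proof (cases "V \<subseteq> G")
    case True
    then have "(G - V) \<union> U \<in> \<G>" using G disj by auto
    then show False using cr disj F by blast
  next
    case False
    define W where "W = V \<inter> G"
    have W: "W \<noteq> {}" "W \<subseteq> V" "W \<noteq> V" using cr[OF G(1)] disj False by (auto simp: W_def)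
    have fin: "finite V" "finite U" "finite W" "U \<noteq> {}" "card U = card V" "U \<inter> V = {}"
      "Min U < Min V" "U \<subseteq> S" "V \<subseteq> S"
      using UV W by (auto simp: exchange_pair_def finite_subset)
    have cW: "card W < card V" "card W > 0" using W fin
        by (auto simp: psubset_card_mono card_gt_0_iff)
    \<comment> \<open>\<open>U'\<close> has to contain \<open>Min U\<close>, so that its minimum
      stays below that of \<open>W\<close>; its other \<open>card W - 1\<close> elements are
      arbitrary.\<close>
    have "card W - 1 \<le> card (U - {Min U})" using cW fin by simp
    then obtain U0 where U0: "U0 \<subseteq> U - {Min U}" "card U0 = card W - 1"
      by (meson obtain_subset_with_card_n)
    define U' where "U' = insert (Min U) U0"
    have fU0: "finite U0" "Min U \<notin> U0" using U0(1) fin(2) by (auto intro: finite_subset)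
    have U': "U' \<subseteq> U" "card U' = card W" "U' \<noteq> {}" "finite U'" "Min U \<in> U'"
      using U0 fU0 cW fin by (auto simp: U'_def)
    have "Min U' = Min U" using U' fin
      by (intro Min_eqI) auto
    moreover have "Min V \<le> Min W" using W fin by (intro Min_antimono) auto
    ultimately have "exchange_pair S U' W"
      using U' W fin unfolding exchange_pair_def by (auto simp: disjoint_iff)
    moreover have "card U' < card U" using U' cW fin by simp
    ultimately have "compressed U' W \<G>" by (rule st)
    moreover have "W \<subseteq> G" "U' \<inter> G = {}" using disj U' by (auto simp: W_def)
    ultimately have "(G - W) \<union> U' \<in> \<G>" using G(1) by (simp add: compressed_def)
    then have "F \<inter> ((G - W) \<union> U') \<noteq> {}" by (rule cr)
    then show False using disj F U' by (auto simp: W_def)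
  qed
qed

text \<open>Two moved sets share \<open>U\<close>. If only one of them moves, the reason why the
  other stays is exactly the hypothesis that \<open>exchanged_meets_unexchanged\<close> asks
  for.\<close>

lemma cross_intersecting_compress:
  assumes UV: "exchange_pair S U V"
    and st: "\<And>U' V'. exchange_pair S U' V' \<Longrightarrow> card U' < card U \<Longrightarrow>
               compressed U' V' \<F> \<and> compressed U' V' \<G>"
    and cross: "cross_intersecting \<F> \<G>"
  shows "cross_intersecting (compress U V \<F>) (compress U V \<G>)"
  unfolding cross_intersecting_def
proof (intro ballI)
  fix F' G' assume "F' \<in> compress U V \<F>" "G' \<in> compress U V \<G>"
  then obtain F G where F: "F \<in> \<F>" "F' = exchange U V \<F> F" and G: "G \<in> \<G>" "G' = exchange U V \<G> G"
    by blast
  let ?mF = "V \<subseteq> F \<and> U \<inter> F = {} \<and> (F - V) \<union> U \<notin> \<F>"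
  let ?mG = "V \<subseteq> G \<and> U \<inter> G = {} \<and> (G - V) \<union> U \<notin> \<G>"
  have ne: "U \<noteq> {}" using UV by (simp add: exchange_pair_def)
  have cross': "cross_intersecting \<G> \<F>" using cross by (auto simp: cross_intersecting_def)
  consider "?mF" "?mG" | "?mF" "\<not> ?mG" | "\<not> ?mF" "?mG" | "\<not> ?mF" "\<not> ?mG" by blast
  then show "F' \<inter> G' \<noteq> {}"
  proof cases
    case 1
    then show ?thesis using F G ne by (auto simp: exchange_def)
  next
    case 2
    then have "F' = (F - V) \<union> U" "G' = G" using F G unfolding exchange_def by (metis, metis)
    then show ?thesis using exchanged_meets_unexchanged[OF UV _ cross F(1) _ _ G(1)] st 2 by blast
  next
    case 3
    then have "G' = (G - V) \<union> U" "F' = F" using F G unfolding exchange_def by (metis, metis)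
    then show ?thesis using exchanged_meets_unexchanged[OF UV _ cross' G(1) _ _ F(1)] st 3 by blast
  next
    case 4
    then have "G' = G" "F' = F" using F G unfolding exchange_def by (metis, metis)
    then show ?thesis using F G cross by (simp add: cross_intersecting_def)
  qed
qed

text \<open>Termination measure: the complement of each member is read as a binary number in which
  smaller elements have higher place value, so lexicographically earlier sets weigh less.\<close>

definition lex_weight :: "nat set \<Rightarrow> nat set set \<Rightarrow> nat" where
  "lex_weight S \<F> = (\<Sum>H\<in>\<F>. \<Sum>x\<in>S - H. 2 ^ (Max S - x))"

lemma sum_powers_less:
  fixes K v :: nat
  assumes "finite V" "\<And>x. x \<in> V \<Longrightarrow> u < x \<and> x \<le> K"
  shows "(\<Sum>x\<in>V. 2 ^ (K - x)) < (2::nat) ^ (K - u)"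
proof (cases "u < K")
  case True
  have "(\<Sum>x\<in>V. 2 ^ (K - x)) = (\<Sum>i\<in>(\<lambda>x. K - x) ` V. (2::nat) ^ i)"
  proof (subst sum.reindex)
    show "inj_on (\<lambda>x. K - x) V" using assms(2) by (intro inj_onI) (metis diff_diff_cancel)
  qed simp
  also have "\<dots> \<le> (\<Sum>i<K - u. 2 ^ i)"
    using assms by (intro sum_mono2) fastforce+
  also have "\<dots> < 2 ^ (K - u)" by (simp add: lessThan_atLeast0 sum_power2)
  finally show ?thesis .
next
  case False
  then have "V = {}" using assms by force
  then show ?thesis by simp
qed

lemma exchange_weight_less:
  assumes "finite S" "exchange_pair S U V" "H \<subseteq> S" "V \<subseteq> H" "U \<inter> H = {}"
  shows "(\<Sum>x\<in>S - ((H - V) \<union> U). 2 ^ (Max S - x)) < (\<Sum>x\<in>S - H. (2::nat) ^ (Max S - x))"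
proof -
  let ?w = "\<lambda>x. (2::nat) ^ (Max S - x)"
  have UV: "U \<subseteq> S" "V \<subseteq> S" "finite U" "finite V" "U \<noteq> {}" "U \<inter> V = {}" "Min U < Min V"
    using assms(2) by (auto simp: exchange_pair_def)
  have "sum ?w V < ?w (Min U)"
  proof (rule sum_powers_less)
    fix x assume "x \<in> V"
    then have "Min V \<le> x" "x \<in> S" using UV by auto
    then show "Min U < x \<and> x \<le> Max S" using UV(7) assms(1) by simp
  qed (use UV in auto)
  also have "\<dots> \<le> sum ?w U" using UV by (intro member_le_sum) auto
  finally have lt: "sum ?w V < sum ?w U" .
  have "S - ((H - V) \<union> U) = (S - (H \<union> U)) \<union> V" using assms UV by blast
  then have "sum ?w (S - ((H - V) \<union> U)) = sum ?w (S - (H \<union> U)) + sum ?w V"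
    using assms UV by (subst sum.union_disjoint[symmetric]) auto
  moreover have "S - H = (S - (H \<union> U)) \<union> U" using assms UV by blast
  then have "sum ?w (S - H) = sum ?w (S - (H \<union> U)) + sum ?w U"
    using assms UV by (subst sum.union_disjoint[symmetric]) auto
  ultimately show ?thesis using lt by simp
qed

lemma lex_weight_compress:
  assumes "finite S" "exchange_pair S U V" "\<F> \<subseteq> [S]\<^bsup>k\<^esup>"
  shows "lex_weight S (compress U V \<F>) \<le> lex_weight S \<F>"
    and "\<not> compressed U V \<F> \<Longrightarrow> lex_weight S (compress U V \<F>) < lex_weight S \<F>"
proof -
  let ?w = "\<lambda>H. \<Sum>x\<in>S - H. (2::nat) ^ (Max S - x)"
  have fin: "finite \<F>" using assms by (meson finite_imp_finite_nsets finite_subset)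
  have eq: "lex_weight S (compress U V \<F>) = (\<Sum>H\<in>\<F>. ?w (exchange U V \<F> H))"
    unfolding lex_weight_def by (subst sum.reindex) (auto simp: inj_on_exchange)
  have sub: "H \<subseteq> S" if "H \<in> \<F>" for H using that assms(3) nsetsD(1) by blast
  have le: "?w (exchange U V \<F> H) \<le> ?w H" if "H \<in> \<F>" for H
    using exchange_weight_less[OF assms(1,2) sub[OF that]]
        by (auto simp: exchange_def intro: less_imp_le)
  show "lex_weight S (compress U V \<F>) \<le> lex_weight S \<F>"
    unfolding eq unfolding lex_weight_def by (intro sum_mono le)
  assume "\<not> compressed U V \<F>"
  then obtain H where H: "H \<in> \<F>" "V \<subseteq> H" "U \<inter> H = {}" "(H - V) \<union> U \<notin> \<F>"
    by (auto simp: compressed_def)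
  then have "?w (exchange U V \<F> H) < ?w H"
    using exchange_weight_less[OF assms(1,2) sub[OF H(1)]] by (simp add: exchange_def)
  then show "lex_weight S (compress U V \<F>) < lex_weight S \<F>"
    unfolding eq unfolding lex_weight_def using le H(1) fin by (intro sum_strict_mono_ex1) auto
qed

text \<open>Repeatedly performing a non-trivial compression of smallest possible size ends in a pair of
  families that no compression changes.\<close>

lemma compression_induct [consumes 4, case_names compressed step]:
  fixes \<F> \<G> :: "nat set set"
  assumes "finite S" "\<F> \<subseteq> [S]\<^bsup>p\<^esup>" "\<G> \<subseteq> [S]\<^bsup>q\<^esup>" "cross_intersecting \<F> \<G>"
    and base: "\<And>\<F> \<G>. \<F> \<subseteq> [S]\<^bsup>p\<^esup> \<Longrightarrow> \<G> \<subseteq> [S]\<^bsup>q\<^esup> \<Longrightarrow> cross_intersecting \<F> \<G> \<Longrightarrow>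
      (\<And>U V. exchange_pair S U V \<Longrightarrow> compressed U V \<F> \<and> compressed U V \<G>) \<Longrightarrow> P \<F> \<G>"
    and step: "\<And>\<F> \<G> U V. \<F> \<subseteq> [S]\<^bsup>p\<^esup> \<Longrightarrow> \<G> \<subseteq> [S]\<^bsup>q\<^esup> \<Longrightarrow> cross_intersecting \<F> \<G> \<Longrightarrow>
      exchange_pair S U V \<Longrightarrow>
      (\<And>U' V'. exchange_pair S U' V' \<Longrightarrow> card U' < card U \<Longrightarrow>
        compressed U' V' \<F> \<and> compressed U' V' \<G>) \<Longrightarrow>
      compress U V \<F> \<subseteq> [S]\<^bsup>p\<^esup> \<Longrightarrow> compress U V \<G> \<subseteq> [S]\<^bsup>q\<^esup> \<Longrightarrow>
      cross_intersecting (compress U V \<F>) (compress U V \<G>) \<Longrightarrow>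
      P (compress U V \<F>) (compress U V \<G>) \<Longrightarrow> P \<F> \<G>"
  shows "P \<F> \<G>"
  using assms(2-4)
proof (induction "lex_weight S \<F> + lex_weight S \<G>" arbitrary: \<F> \<G> rule: less_induct)
  case less
  show ?case
  proof (cases "\<forall>U V. exchange_pair S U V \<longrightarrow> compressed U V \<F> \<and> compressed U V \<G>")
    case True
    then show ?thesis using base less.prems by blast
  next
    case False
    define Q where "Q c \<longleftrightarrow> (\<exists>U V. exchange_pair S U V \<and> card U = c \<and>
      \<not> (compressed U V \<F> \<and> compressed U V \<G>))" for c
    have "\<exists>c. Q c" using False by (auto simp: Q_def)
    then obtain c where c: "Q c" "\<And>c'. c' < c \<Longrightarrow> \<not> Q c'" using exists_least_iff[of Q] by blast
    then obtain U V where UV: "exchange_pair S U V" "card U = c"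
      and ns: "\<not> (compressed U V \<F> \<and> compressed U V \<G>)" unfolding Q_def by blast
    have st: "compressed U' V' \<F> \<and> compressed U' V' \<G>"
      if "exchange_pair S U' V'" "card U' < card U" for U' V'
      using c(2)[of "card U'"] that UV(2) unfolding Q_def by blast
    have sub: "compress U V \<F> \<subseteq> [S]\<^bsup>p\<^esup>" "compress U V \<G> \<subseteq> [S]\<^bsup>q\<^esup>"
      using compress_subset_nsets[OF UV(1)] less.prems by auto
    have cr: "cross_intersecting (compress U V \<F>) (compress U V \<G>)"
      using cross_intersecting_compress[OF UV(1) st less.prems(3)] by blast
    have "lex_weight S (compress U V \<F>) + lex_weight S (compress U V \<G>)
        < lex_weight S \<F> + lex_weight S \<G>"
      using lex_weight_compress[OF assms(1) UV(1) less.prems(1)]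
        lex_weight_compress[OF assms(1) UV(1) less.prems(2)] ns by linarith
    then have "P (compress U V \<F>) (compress U V \<G>)" using less.hyps sub cr by blast
    then show ?thesis using step[OF less.prems UV(1) st sub cr] by blast
  qed
qed

text \<open>The sets \<open>G - F\<close> and \<open>F - G\<close> form an exchange pair that
  carries \<open>F\<close> to \<open>G\<close> in a single step.\<close>

lemma lex_smaller_in_compressed:
  assumes "\<F> \<subseteq> [S]\<^bsup>p\<^esup>" and st: "\<And>U V. exchange_pair S U V \<Longrightarrow> compressed U V \<F>"
    and "F \<in> \<F>" "G \<in> [S]\<^bsup>p\<^esup>" "G \<noteq> F" and less: "Min (G - F) < Min (F - G)"
  shows "G \<in> \<F>"
proof -
  note F = nsetsD[OF subsetD[OF assms(1,3)]] and G = nsetsD[OF assms(4)]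
  have c: "card (G - F) = card (F - G)"
    using F G card_le_sym_Diff[of F G] card_le_sym_Diff[of G F] by linarith
  have ne: "G - F \<noteq> {}" using assms(5) F G by (metis Diff_eq_empty_iff card_subset_eq)
  have "exchange_pair S (G - F) (F - G)"
    using F G c ne less unfolding exchange_pair_def by auto
  then have "(F - (F - G)) \<union> (G - F) \<in> \<F>"
    using st assms(3) by (auto simp: compressed_def)
  moreover have "(F - (F - G)) \<union> (G - F) = G" by blast
  ultimately show ?thesis by simp
qed

text \<open>A fully compressed family is an initial segment of the lexicographic order, and such segments
  form a chain.\<close>

lemma compressed_initial:
  assumes "finite S" "\<F> \<subseteq> [S]\<^bsup>p\<^esup>" and st: "\<And>U V. exchange_pair S U V \<Longrightarrow> compressed U V \<F>"
    and I: "I \<subseteq> S" "\<And>i j. i \<in> I \<Longrightarrow> j \<in> S - I \<Longrightarrow> i < j"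
  shows "(\<forall>F\<in>\<F>. I \<subseteq> F) \<or> {F \<in> [S]\<^bsup>p\<^esup>. I \<subseteq> F} \<subseteq> \<F>"
proof (rule disjCI)
  assume not: "\<not> {F \<in> [S]\<^bsup>p\<^esup>. I \<subseteq> F} \<subseteq> \<F>"
  then obtain G where G: "G \<in> [S]\<^bsup>p\<^esup>" "I \<subseteq> G" "G \<notin> \<F>" by blast
  show "\<forall>F\<in>\<F>. I \<subseteq> F"
  proof (rule ballI, rule ccontr)
    fix F assume F: "F \<in> \<F>" "\<not> I \<subseteq> F"
    have fs: "F \<in> [S]\<^bsup>p\<^esup>" using F assms(2) by blast
    have fin: "finite F" "finite G" "F \<subseteq> S" "G \<subseteq> S" "card F = card G"
        using nsetsD[OF fs] nsetsD[OF G(1)] by auto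
    obtain i where i: "i \<in> I" "i \<notin> F" using F by blast
    have "F - G \<noteq> {}" using fin F(2) G(2) by (metis Diff_eq_empty_iff card_subset_eq)
    then have "Min (F - G) \<in> F - G" using fin by (intro Min_in) auto
    then have "i < Min (F - G)" using i I G(2) fin by blast
    moreover have "Min (G - F) \<le> i" using i G(2) fin by (intro Min_le) auto
    ultimately have "G \<in> \<F>" using lex_smaller_in_compressed[OF assms(2) st F(1) G(1)] F G by auto
    then show False using G by blast
  qed
qed

section \<open>Piecewise linear Kruskal--Katona bounds\<close>

lemma obtain_initial_segment:
  fixes S :: "nat set"
  assumes "finite S" "s \<le> card S"
  obtains I where "I \<subseteq> S" "card I = s" "\<And>i j. i \<in> I \<Longrightarrow> j \<in> S - I \<Longrightarrow> i < j"
  using assms(2)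
proof (induction s arbitrary: thesis)
  case 0
  then show ?case by (meson card.empty empty_iff empty_subsetI)
next
  case (Suc s)
  obtain I where I: "I \<subseteq> S" "card I = s" "\<And>i j. i \<in> I \<Longrightarrow> j \<in> S - I \<Longrightarrow> i < j"
    by (rule Suc.IH) (use Suc.prems(2) in auto)
  have fin: "finite I" "finite (S - I)" using finite_subset[OF I(1)] assms(1) by auto
  have ne: "S - I \<noteq> {}"
  proof
    assume "S - I = {}"
    then have "S = I" using I(1) by blast
    then show False using I(2) Suc.prems(2) by simp
  qed
  have m: "Min (S - I) \<in> S - I" using fin ne by (intro Min_in)
  show ?case
  proof (rule Suc.prems(1)[of "insert (Min (S - I)) I"])
    show "insert (Min (S - I)) I \<subseteq> S" using m I by blast
    show "card (insert (Min (S - I)) I) = Suc s" using m I fin by simp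
    fix i j assume ij: "i \<in> insert (Min (S - I)) I" "j \<in> S - insert (Min (S - I)) I"
    have "Min (S - I) \<le> j" using ij fin by simp
    then show "i < j" using ij I(3) by (cases "i = Min (S - I)") auto
  qed
qed

lemma card_subset_avoiding_or_meeting:
  assumes "finite S" "\<Y> \<subseteq> [S]\<^bsup>q\<^esup>" "I \<subseteq> S"
  shows "card \<Y> + ((card S - card I) choose q) \<le> card {Y \<in> \<Y>. Y \<inter> I = {}} + (card S choose q)"
proof -
  let ?M = "{Y \<in> [S]\<^bsup>q\<^esup>. Y \<inter> I \<noteq> {}}" and ?A = "{Y \<in> [S]\<^bsup>q\<^esup>. Y \<inter> I = {}}"
  have fin: "finite ([S]\<^bsup>q\<^esup>)" "finite \<Y>"
    using assms(1) finite_subset[OF assms(2)] by (simp_all add: finite_imp_finite_nsets)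
  have "card \<Y> \<le> card ({Y \<in> \<Y>. Y \<inter> I = {}} \<union> ?M)" using fin assms by (intro card_mono) auto
  also have "\<dots> \<le> card {Y \<in> \<Y>. Y \<inter> I = {}} + card ?M" by (rule card_Un_le)
  finally have "card \<Y> \<le> card {Y \<in> \<Y>. Y \<inter> I = {}} + card ?M" .
  moreover have "card ?M + card ?A = card ([S]\<^bsup>q\<^esup>)"
  proof -
    have "[S]\<^bsup>q\<^esup> = ?M \<union> ?A" by blast
    then show ?thesis using fin by (subst card_Un_disjoint[symmetric]) auto
  qed
  moreover have "card ?A = (card S - card I) choose q" using assms by (intro card_nsets_avoiding)
  ultimately show ?thesis by simp
qed

lemma Diff_image_in_nsets:
  assumes "\<X> \<subseteq> [S]\<^bsup>p\<^esup>" "finite I" "\<And>X. X \<in> \<X> \<Longrightarrow> I \<subseteq> X \<and> X - I \<subseteq> W"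
  shows "(\<lambda>X. X - I) ` \<X> \<subseteq> [W]\<^bsup>(p - card I)\<^esup>" "card ((\<lambda>X. X - I) ` \<X>) = card \<X>"
proof -
  show "(\<lambda>X. X - I) ` \<X> \<subseteq> [W]\<^bsup>(p - card I)\<^esup>"
    using assms nsetsD by (fastforce simp: nsets_def card_Diff_subset)
  have "inj_on (\<lambda>X. X - I) \<X>" using assms(3) by (intro inj_onI) blast
  then show "card ((\<lambda>X. X - I) ` \<X>) = card \<X>" by (rule card_image)
qed

text \<open>Members of \<Y> meeting \<open>I\<close> are only counted trivially. Those avoiding
  \<open>I\<close> must meet every \<open>X - I\<close>, so
  \<open>cross_intersecting_biregular\<close> applies to them on \<open>S - I\<close>.\<close>

lemma cross_intersecting_containing:
  assumes "finite S" "\<X> \<subseteq> [S]\<^bsup>p\<^esup>" "\<Y> \<subseteq> [S]\<^bsup>q\<^esup>" "cross_intersecting \<X> \<Y>"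
    and "p + q \<le> card S" "I \<subseteq> S" "card I \<le> p" "\<And>X. X \<in> \<X> \<Longrightarrow> I \<subseteq> X"
  shows "card \<Y> * ((card S - card I) choose (p - card I)) + card \<X> * ((card S - card I) choose q)
    \<le> (card S choose q) * ((card S - card I) choose (p - card I))"
proof -
  have fI: "finite I" using assms finite_subset by blast
  define Y1 where "Y1 = {Y \<in> \<Y>. Y \<inter> I = {}}"
  have cW: "card (S - I) = card S - card I" using assms fI by (simp add: card_Diff_subset)
  have "I \<subseteq> X \<and> X - I \<subseteq> S - I" if "X \<in> \<X>" for X
    using assms(8)[OF that] nsetsD(1)[OF subsetD[OF assms(2) that]] by blast
  note X1 = Diff_image_in_nsets[OF assms(2) fI this]
  have Y1: "Y1 \<subseteq> [S - I]\<^bsup>q\<^esup>" using assms(3) unfolding Y1_def nsets_def by blast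
  have cr: "cross_intersecting ((\<lambda>X. X - I) ` \<X>) Y1"
    using assms(4) unfolding cross_intersecting_def Y1_def by blast
  have "card \<X> * ((card S - card I) choose q) + card Y1 * ((card S - card I) choose (p - card I))
      \<le> ((card S - card I) choose (p - card I)) * ((card S - card I) choose q)"
    using cross_intersecting_biregular[OF _ X1(1) Y1 cr] assms X1(2) by (simp add: cW)
  moreover have "card \<Y> + ((card S - card I) choose q) \<le> card Y1 + (card S choose q)"
    using card_subset_avoiding_or_meeting[OF assms(1,3,6)] by (simp add: Y1_def)
  then have "(card \<Y> + ((card S - card I) choose q)) * ((card S - card I) choose (p - card I))
     \<le> (card Y1 + (card S choose q)) * ((card S - card I) choose (p - card I))"
    by (rule mult_le_mono1)
  ultimately show ?thesis by (simp add: algebra_simps)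
qed

text \<open>A member of \<Y> avoiding \<open>I\<close> must contain \<open>i\<close>: otherwise
  \<open>p + q \<le> card S\<close> leaves room for a set through \<open>insert i I\<close> disjoint
  from it, and all such sets lie in \<X>. Hence the biregular bound can be applied on
  \<open>S - insert i I\<close>, to the members of \<X> missing \<open>i\<close> and the members of
  \<Y> avoiding \<open>I\<close>.\<close>

lemma cross_intersecting_between:
  assumes "finite S" "\<X> \<subseteq> [S]\<^bsup>p\<^esup>" "\<Y> \<subseteq> [S]\<^bsup>q\<^esup>" "cross_intersecting \<X> \<Y>"
    and "p + q \<le> card S" "I \<subseteq> S" "card I < p" "0 < q" "\<And>X. X \<in> \<X> \<Longrightarrow> I \<subseteq> X"
    and i: "i \<in> S - I" "{X \<in> [S]\<^bsup>p\<^esup>. insert i I \<subseteq> X} \<subseteq> \<X>"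
    and w: "w = card S - card I - 1"
  shows "card \<X> * (w choose (q - 1)) + card \<Y> * (w choose (p - card I))
      + (w choose q) * (w choose (p - card I))
    \<le> (card S choose q) * (w choose (p - card I)) + (w choose (p - card I - 1)) * (w choose (q - 1))"
proof -
  have fI: "finite I" using assms finite_subset by blast
  define W where "W = S - insert i I"
  have cI: "card (insert i I) = Suc (card I)" using fI i by simp
  have cW: "card W = w"
    unfolding W_def w using assms(1,6) i fI by (subst card_Diff_subset) auto
  have fW: "finite W" using assms by (simp add: W_def)
  define X1 where "X1 = {X \<in> \<X>. i \<notin> X}"
  define Y1 where "Y1 = {Y \<in> \<Y>. Y \<inter> I = {}}"
  have X1: "(\<lambda>X. X - I) ` X1 \<subseteq> [W]\<^bsup>(p - card I)\<^esup>" "card ((\<lambda>X. X - I) ` X1) = card X1"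
  proof -
    have "X1 \<subseteq> [S]\<^bsup>p\<^esup>" using assms(2) by (auto simp: X1_def)
    moreover have "\<And>X. X \<in> X1 \<Longrightarrow> I \<subseteq> X \<and> X - I \<subseteq> W"
      using assms(2,9) nsetsD(1) unfolding X1_def W_def by blast
    ultimately show "(\<lambda>X. X - I) ` X1 \<subseteq> [W]\<^bsup>(p - card I)\<^esup>" "card ((\<lambda>X. X - I) ` X1) = card X1"
      using Diff_image_in_nsets fI by metis+
  qed
  have iY: "i \<in> Y" if Y: "Y \<in> Y1" for Y
  proof (rule ccontr)
    assume "i \<notin> Y"
    have YS: "Y \<in> [S]\<^bsup>q\<^esup>" "Y \<inter> I = {}" "Y \<in> \<Y>" using Y assms(3) by (auto simp: Y1_def)
    have "Y \<subseteq> W" using nsetsD[OF YS(1)] YS(2) \<open>i \<notin> Y\<close> by (auto simp: W_def)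
    then have "card (W - Y) = w - q" using nsetsD[OF YS(1)] cW by (simp add: card_Diff_subset)
    then have "p - card I - 1 \<le> card (W - Y)" using assms(5,7) w by simp
    then obtain Z where Z: "Z \<subseteq> W - Y" "card Z = p - card I - 1" by (meson obtain_subset_with_card_n)
    have fZ: "finite Z" using Z fW finite_subset by blast
    have "card (insert i I \<union> Z) = p"
      using Z cI fI fZ assms(7) by (subst card_Un_disjoint) (auto simp: W_def)
    then have "insert i I \<union> Z \<in> \<X>"
      using i Z assms(6) fI fZ by (intro subsetD[OF i(2)]) (auto simp: nsets_def W_def)
    then have "(insert i I \<union> Z) \<inter> Y \<noteq> {}" using assms(4) YS unfolding cross_intersecting_def by blast
    then show False using YS \<open>i \<notin> Y\<close> Z by blast
  qed
  have Y1: "(\<lambda>Y. Y - {i}) ` Y1 \<subseteq> [W]\<^bsup>(q - 1)\<^esup>" "card ((\<lambda>Y. Y - {i}) ` Y1) = card Y1"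
  proof -
    have "Y1 \<subseteq> [S]\<^bsup>q\<^esup>" using assms(3) by (auto simp: Y1_def)
    moreover have "\<And>Y. Y \<in> Y1 \<Longrightarrow> {i} \<subseteq> Y \<and> Y - {i} \<subseteq> W"
      using assms(3) nsetsD(1) iY unfolding Y1_def W_def by blast
    ultimately show "(\<lambda>Y. Y - {i}) ` Y1 \<subseteq> [W]\<^bsup>(q - 1)\<^esup>" "card ((\<lambda>Y. Y - {i}) ` Y1) = card Y1"
      using Diff_image_in_nsets[of Y1 S q "{i}" W] by auto
  qed
  have cr: "cross_intersecting ((\<lambda>X. X - I) ` X1) ((\<lambda>Y. Y - {i}) ` Y1)"
    using assms(4) unfolding cross_intersecting_def Y1_def X1_def by blast
  have main: "card X1 * (w choose (q - 1)) + card Y1 * (w choose (p - card I))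
      \<le> (w choose (p - card I)) * (w choose (q - 1))"
    using cross_intersecting_biregular[OF fW X1(1) Y1(1) cr] assms(5,7,8) X1(2) Y1(2) cW w by simp
  have "card \<X> = card X1 + (w choose (p - card I - 1))"
  proof -
    have finX: "finite \<X>" using assms(1,2) by (meson finite_imp_finite_nsets finite_subset)
    have "\<X> - X1 = {X \<in> [S]\<^bsup>p\<^esup>. insert i I \<subseteq> X}"
      using i(2) assms(2,9) unfolding X1_def by blast
    then have "card (\<X> - X1) = (w choose (p - card I - 1))"
      using card_nsets_containing[OF assms(1), of "insert i I" p] i assms(6,7) cI w by simp
    moreover have "card \<X> = card X1 + card (\<X> - X1)"
      using finX by (simp add: X1_def card_Diff_subset card_mono)
    ultimately show ?thesis by simp
  qed
  moreover have "card \<Y> + ((card S - card I) choose q) \<le> card Y1 + (card S choose q)"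
    using card_subset_avoiding_or_meeting[OF assms(1,3,6)] by (simp add: Y1_def)
  moreover have "(card S - card I) choose q = (w choose q) + (w choose (q - 1))"
  proof -
    have "card S - card I = Suc w" using w assms(5,7) by simp
    then show ?thesis using assms(8) by (cases q) auto
  qed
  ultimately have "card \<X> = card X1 + (w choose (p - card I - 1))"
     "card \<Y> + (w choose q) + (w choose (q - 1)) \<le> card Y1 + (card S choose q)" by simp_all
  then have "(card \<Y> + (w choose q) + (w choose (q - 1))) * (w choose (p - card I))
     \<le> (card Y1 + (card S choose q)) * (w choose (p - card I))"
    using mult_le_mono1 by blast
  then show ?thesis using main \<open>card \<X> = card X1 + (w choose (p - card I - 1))\<close>
    by (simp add: algebra_simps)
qed

text \<open>Initial segments form a chain, so \<F> lies inside the family of all sets through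
  \<open>I\<close> or contains it; in the second case the size condition forces equality.\<close>

lemma compressed_containing:
  assumes "finite S" "\<F> \<subseteq> [S]\<^bsup>p\<^esup>" "\<And>U V. exchange_pair S U V \<Longrightarrow> compressed U V \<F>"
    and "I \<subseteq> S" "\<And>i j. i \<in> I \<Longrightarrow> j \<in> S - I \<Longrightarrow> i < j" "card I \<le> p"
    and "card \<F> \<le> (card S - card I) choose (p - card I)" "F \<in> \<F>"
  shows "I \<subseteq> F"
proof -
  have "(\<forall>F\<in>\<F>. I \<subseteq> F) \<or> {F \<in> [S]\<^bsup>p\<^esup>. I \<subseteq> F} \<subseteq> \<F>"
    using compressed_initial[OF assms(1-5)] by blast
  moreover have "\<F> = {F \<in> [S]\<^bsup>p\<^esup>. I \<subseteq> F}" if "{F \<in> [S]\<^bsup>p\<^esup>. I \<subseteq> F} \<subseteq> \<F>"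
    using that assms(7) card_nsets_containing[OF assms(1,4,6)]
      card_seteq[OF finite_subset[OF assms(2) finite_imp_finite_nsets[OF assms(1)]] that] by simp
  ultimately show ?thesis using assms(8) by blast
qed

text \<open>The next two lemmas are the Kruskal--Katona theorem in the form of piecewise linear bounds
  with nodes at the sizes of the families of all sets containing \<open>s\<close> fixed elements.\<close>

lemma cross_intersecting_linear_bound:
  fixes \<X> \<Y> :: "nat set set"
  assumes "finite S" "\<X> \<subseteq> [S]\<^bsup>p\<^esup>" "\<Y> \<subseteq> [S]\<^bsup>q\<^esup>" "cross_intersecting \<X> \<Y>"
    and "p + q \<le> card S" "s \<le> p" "card \<X> \<le> (card S - s) choose (p - s)"
  shows "card \<Y> * ((card S - s) choose (p - s)) + card \<X> * ((card S - s) choose q)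
    \<le> (card S choose q) * ((card S - s) choose (p - s))"
  using assms(1-4) assms(7)
proof (induction rule: compression_induct)
  case (compressed \<X> \<Y>)
  obtain I where I: "I \<subseteq> S" "card I = s" "\<And>i j. i \<in> I \<Longrightarrow> j \<in> S - I \<Longrightarrow> i < j"
    using obtain_initial_segment[OF assms(1), of s] assms(5,6) by auto
  have st: "\<And>U V. exchange_pair S U V \<Longrightarrow> compressed U V \<X>" using compressed(4) by blast
  have "I \<subseteq> X" if "X \<in> \<X>" for X
    using compressed_containing[OF assms(1) compressed(1) st I(1,3)] I(2) assms(6) compressed(5) that
    by blast
  then show ?case
    using cross_intersecting_containing[OF assms(1) compressed(1-3) assms(5) I(1)] I(2) assms(6)
        by simp
next
  case (step \<X> \<Y> U V)
  then show ?case by (simp only: card_compress)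
qed

lemma cross_intersecting_chord_bound:
  fixes \<X> \<Y> :: "nat set set"
  assumes "finite S" "\<X> \<subseteq> [S]\<^bsup>p\<^esup>" "\<Y> \<subseteq> [S]\<^bsup>q\<^esup>" "cross_intersecting \<X> \<Y>"
    and "p + q \<le> card S" "s < p" "0 < q" "card \<X> \<le> (card S - s) choose (p - s)"
    and w: "w = card S - s - 1" and "w choose (p - s - 1) \<le> card \<X>"
  shows "card \<X> * (w choose (q - 1)) + card \<Y> * (w choose (p - s)) + (w choose q) * (w choose (p - s))
    \<le> (card S choose q) * (w choose (p - s)) + (w choose (p - s - 1)) * (w choose (q - 1))"
  using assms(1-4) assms(8,10)
proof (induction rule: compression_induct)
  case (compressed \<X> \<Y>)
  obtain J where J: "J \<subseteq> S" "card J = Suc s" "\<And>i j. i \<in> J \<Longrightarrow> j \<in> S - J \<Longrightarrow> i < j"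
    using obtain_initial_segment[OF assms(1), of "Suc s"] assms(5,6) by auto
  have fJ: "finite J" "J \<noteq> {}" using J assms(1) finite_subset by fastforce+
  \<comment> \<open>The longer segment \<open>J\<close> comes first and loses its largest element.
    Then \<open>I\<close> is the segment of length \<open>s\<close>, and \<X> lies between the
    families of all sets through \<open>J\<close> and through \<open>I\<close>.\<close>
  define i where "i = Max J"
  define I where "I = J - {i}"
  have i: "i \<in> J" using fJ by (simp add: i_def)
  have I: "I \<subseteq> S" "card I = s" "insert i I = J" "i \<in> S - I" using i J fJ by (auto simp: I_def)
  have ini: "u < v" if "u \<in> I" "v \<in> S - I" for u v
  proof (cases "v = i")
    case True
    have "u \<le> i" using that fJ unfolding i_def I_def by simp
    then show ?thesis using True that by (auto simp: I_def)
  next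
    case False
    then show ?thesis using J(3)[of u v] that by (auto simp: I_def)
  qed
  have st: "\<And>U V. exchange_pair S U V \<Longrightarrow> compressed U V \<X>" using compressed(4) by blast
  have sub: "I \<subseteq> X" if "X \<in> \<X>" for X
    using compressed_containing[OF assms(1) compressed(1) st I(1) ini] I(2) assms(6) compressed(5) that
    by simp
  have "{X \<in> [S]\<^bsup>p\<^esup>. J \<subseteq> X} \<subseteq> \<X>"
  proof -
    have "(\<forall>F\<in>\<X>. J \<subseteq> F) \<or> {F \<in> [S]\<^bsup>p\<^esup>. J \<subseteq> F} \<subseteq> \<X>"
      using compressed_initial[OF assms(1) compressed(1) st J(1,3)] by blast
    moreover have "\<X> = {F \<in> [S]\<^bsup>p\<^esup>. J \<subseteq> F}" if "\<forall>F\<in>\<X>. J \<subseteq> F"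
    proof (rule card_seteq)
      show "finite {F \<in> [S]\<^bsup>p\<^esup>. J \<subseteq> F}" using assms(1) by (simp add: finite_imp_finite_nsets)
      show "\<X> \<subseteq> {F \<in> [S]\<^bsup>p\<^esup>. J \<subseteq> F}" using that compressed(1) by blast
      show "card {F \<in> [S]\<^bsup>p\<^esup>. J \<subseteq> F} \<le> card \<X>"
        using card_nsets_containing[OF assms(1) J(1), of p] J(2) assms(6) compressed(6) w by simp
    qed
    ultimately show ?thesis by blast
  qed
  then show ?case
    using cross_intersecting_between[OF assms(1) compressed(1-3) assms(5) I(1) _ assms(7) sub I(4)]
      I(2,3) assms(6) w by simp
next
  case (step \<X> \<Y> U V)
  then show ?case by (simp only: card_compress)
qed

section \<open>Inequalities between binomial coefficients\<close>

lemma binomial_left_mono: "m \<le> n \<Longrightarrow> m choose k \<le> n choose k"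
proof (induction n rule: dec_induct)
  case (step n)
  have "n choose k \<le> Suc n choose k" by (cases k) auto
  then show ?case using step.IH by linarith
qed simp

lemma binomial_drop_two:
  assumes "2 \<le> m" "k \<le> m"
  shows "real m * (real m - 1) * real ((m - 2) choose k)
    = (real m - real k) * (real m - real k - 1) * real (m choose k)"
proof (cases "k = m")
  case False
  then have k: "k \<le> m - 1" using assms by simp
  have e2: "real m * real ((m - 1) choose k) = (real m - real k) * real (m choose k)"
    using arg_cong[OF binomial_absorb_comp[of m k], of real] assms by (simp add: of_nat_diff)
  have "real (m - 1) * real ((m - 2) choose k) = real (m - 1 - k) * real ((m - 1) choose k)"
    using arg_cong[OF binomial_absorb_comp[of "m - 1" k], of real] by (simp add: numeral_2_eq_2)
  then have e1: "(real m - 1) * real ((m - 2) choose k) =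
      (real m - real k - 1) * real ((m - 1) choose k)"
    using k assms by (simp add: of_nat_diff)
  have "real m * (real m - 1) * real ((m - 2) choose k)
      = (real m - real k - 1) * (real m * real ((m - 1) choose k))"
    using e1 by (simp add: mult.assoc mult.left_commute)
  then show ?thesis unfolding e2 by (simp add: ac_simps)
qed (use assms in simp)

text \<open>The expression \<open>2 * (w choose s) - ((w - 2) choose s)\<close> counts the s-subsets
  of a set of \<open>w + 2\<close> elements that miss one of two disjoint pairs. All three binomials
  are multiples of \<open>w choose s\<close>, which leaves a polynomial inequality.\<close>

lemma hit_both_base:
  assumes "1 \<le> s" "s < w"
  shows "real w * (real w - 1) * (2 * real (w choose s) - real ((w - 2) choose s))
    \<le> (real w * (real w - 1) - real s * (real s - 1)) * real ((w + 2) choose s)"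
proof -
  define y where "y = real (w choose s)"
  define z where "z = real ((w - 2) choose s)"
  define x where "x = real ((w + 2) choose s)"
  \<comment> \<open>In terms of \<open>f\<close> and \<open>u\<close>, both nonnegative, the
    difference of the two sides of \<open>poly\<close> has only positive coefficients.\<close>
  define f where "f = real w - real s - 1"
  define u where "u = real s - 1"
  have fu: "f \<ge> 0" "u \<ge> 0" "real w = f + u + 2" "real s = u + 1" using assms
      by (auto simp: f_def u_def)
  have a1: "real w * (real w - 1) * z = (real w - real s) * (real w - real s - 1) * y"
    using binomial_drop_two[of w s] assms by (simp add: y_def z_def)
  define D where "D = (real w + 2 - real s) * (real w + 1 - real s)"
  have a2: "D * x = (real w + 2) * (real w + 1) * y"
    using binomial_drop_two[of "w + 2" s] assms by (simp add: y_def x_def D_def add.commute)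
  have y0: "y \<ge> 0" by (simp add: y_def)
  define L where "L = 2 * real w * (real w - 1) - (real w - real s) * (real w - real s - 1)"
  define R where "R = real w * (real w - 1) - real s * (real s - 1)"
  have poly: "L * D \<le> R * ((real w + 2) * (real w + 1))"
  proof -
    have "R * ((real w + 2) * (real w + 1)) - L * D = 2 * u + 4 * (u * u) + 2 * (u * u * u)
        + 9 * (f * u)
        + 11 * (f * u * u) + 2 * (f * u * u * u) + 3 * (f * f * u) + 3 * (f * f * u * u)"
      unfolding L_def R_def D_def fu(3,4) by (simp add: algebra_simps)
    also have "\<dots> \<ge> 0" using fu(1,2) by simp
    finally show ?thesis by simp
  qed
  have D0: "D > 0" unfolding D_def fu(3,4) using fu(1,2) by (intro mult_pos_pos) auto
  have "real w * (real w - 1) * (2 * y - z) = L * y"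
    using a1 unfolding L_def by (simp add: algebra_simps)
  then have "D * (real w * (real w - 1) * (2 * y - z)) = L * D * y" by simp
  also have "\<dots> \<le> R * ((real w + 2) * (real w + 1)) * y" using poly y0 by (rule mult_right_mono)
  also have "\<dots> = D * (R * x)" using a2 by simp
  finally show ?thesis using D0 unfolding y_def x_def z_def R_def by simp
qed

text \<open>Up to a factor this says that a random \<open>s\<close>-subset of a set of \<open>w + g\<close> elements meets two
  given disjoint \<open>g\<close>-sets with probability at least \<open>s (s - 1) / (w (w - 1))\<close>.\<close>

lemma hit_both:
  assumes "1 \<le> s" "s < w" "2 \<le> g"
  shows "real w * (real w - 1) * (2 * real (w choose s) - real ((w - g) choose s))
    \<le> (real w * (real w - 1) - real s * (real s - 1)) * real ((w + g) choose s)"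
  using assms(3)
proof (induction g rule: dec_induct)
  case base
  show ?case using hit_both_base[OF assms(1,2)] .
next
  case (step g)
  define M where "M = real w * (real w - 1)"
  define K where "K = M - real s * (real s - 1)"
  have K: "K = (real w - real s) * (real w + real s - 1)" by (simp add: K_def M_def algebra_simps)
  have p1: "real ((w + Suc g) choose s) = real ((w + g) choose s) + real ((w + g) choose (s - 1))"
    using assms(1) by (cases s) auto
  have p2: "real ((w - g) choose s) \<le> real ((w - Suc g) choose s) + real ((w - 2) choose (s - 1))"
  proof (cases "g < w")
    case True
    then have "w - g = Suc (w - Suc g)" by simp
    then have "(w - g) choose s = ((w - Suc g) choose s) + ((w - Suc g) choose (s - 1))"
      using assms(1) by (cases s) auto
    moreover have "(w - Suc g) choose (s - 1) \<le> (w - 2) choose (s - 1)"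
      using step.hyps(1) by (intro binomial_left_mono) linarith
    ultimately show ?thesis by simp
  next
    case False
    then show ?thesis using assms(1) by simp
  qed
  \<comment> \<open>Raising \<open>g\<close> by one adds at most
    \<open>(w - 2) choose (s - 1)\<close> to the count on the left and exactly
    \<open>(w + g) choose (s - 1)\<close> to the binomial on the right, so comparing these two
    carries the induction.\<close>
  have "M * real ((w - 2) choose (s - 1))
      = (real w - real s + 1) * (real w - real s) * real (w choose (s - 1))"
    using binomial_drop_two[of w "s - 1"] assms by (simp add: M_def of_nat_diff algebra_simps)
  also have "\<dots> \<le> K * real (w choose (s - 1))"
    unfolding K using assms by (intro mult_right_mono, subst mult.commute, intro mult_left_mono) auto
  also have "\<dots> \<le> K * real ((w + g) choose (s - 1))"
  proof (rule mult_left_mono)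
    show "real (w choose (s - 1)) \<le> real ((w + g) choose (s - 1))" by (simp add: binomial_left_mono)
    show "0 \<le> K" unfolding K using assms by simp
  qed
  finally have inc: "M * real ((w - 2) choose (s - 1)) \<le> K * real ((w + g) choose (s - 1))" .
  have "M \<ge> 0" using assms by (simp add: M_def)
  then have "M * (2 * real (w choose s) - real ((w - Suc g) choose s))
      \<le> M * (2 * real (w choose s) - real ((w - g) choose s) + real ((w - 2) choose (s - 1)))"
    using p2 by (intro mult_left_mono) auto
  also have "\<dots> \<le> K * real ((w + g) choose s) + K * real ((w + g) choose (s - 1))"
  proof -
    have "M * (2 * real (w choose s) - real ((w - g) choose s)) \<le> K * real ((w + g) choose s)"
      using step.IH unfolding K_def M_def .
    then show ?thesis using inc unfolding distrib_left by linarith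
  qed
  also have "\<dots> = K * real ((w + Suc g) choose s)" unfolding p1 by (simp add: algebra_simps)
  finally show ?case by (simp add: M_def K_def)
qed

lemma binomial_ratio_real:
  "(real v - real k) * real (v choose k) = (real k + 1) * real (v choose Suc k)"
proof (cases "k \<le> v")
  case True
  have "(v - k) * (v choose k) = Suc k * (v choose Suc k)"
    by (metis binomial_absorb_comp binomial_absorption)
  from arg_cong[OF this, of real] show ?thesis using True by (simp add: of_nat_diff algebra_simps)
qed (simp add: binomial_eq_0)

text \<open>The weights below are the binomial coefficients \<open>c j = C(n - 4, a - j)\<close> and
  \<open>e j = C(n - 4, b - j)\<close>; \<open>p\<close> and \<open>q\<close> will be the amounts by which the sizes of the two extremal
  families exceed the sizes of the families of all sets that contain at least two of three given
  elements.\<close>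

locale weights =
  fixes c1 c2 c3 e1 e2 e3 p q :: real
  assumes c_pos: "0 < c1" "0 < c2" "0 < c3" and e_pos: "0 < e1" "0 < e2" "0 < e3"
    and slope1: "c3 * e2 \<le> e1 * c2" and slope2: "e3 * c2 \<le> c1 * e2"
    and log_concave: "c1 * c3 \<le> c2 * c2" "e1 * e3 \<le> e2 * e2"
    and excess1: "0 < p * e1 + q * c3" and excess2: "0 < q * c1 + p * e3"
    and p_bounds: "-c3 < p" "p < c1 - c3" and q_bounds: "-e3 < q" "q < e1 - e3"
begin

text \<open>After division the three excess conditions state that \<open>p * v + q\<close> is
  positive at \<open>v = e3 / c1\<close>, \<open>e2 / c2\<close> and \<open>e1 / c3\<close>. By
  \<open>slope2\<close> and \<open>slope1\<close> the second point lies between the other two, so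
  positivity there follows from linearity.\<close>

lemma excess: "0 < p * e2 + q * c2"
proof -
  consider "0 \<le> p" "0 \<le> q" | "0 \<le> p" "q < 0" | "p < 0" "0 < q"
    using excess1 c_pos e_pos
    by (smt (verit) mult_nonneg_nonneg mult_nonpos_nonneg mult_pos_pos mult_neg_pos)
  then show ?thesis
  proof cases
    case 1
    moreover have "p \<noteq> 0 \<or> q \<noteq> 0" using excess1 by auto
    ultimately show ?thesis using c_pos e_pos
      by (metis add_nonneg_pos add_pos_nonneg less_eq_real_def mult_nonneg_nonneg mult_pos_pos)
  next
    case 2
    have "c1 * (p * e2 + q * c2) = p * (c1 * e2) + q * c1 * c2" by (simp add: algebra_simps)
    also have "\<dots> \<ge> p * (e3 * c2) + q * c1 * c2" using 2 slope2 by (simp add: mult_left_mono)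
    also have "p * (e3 * c2) + q * c1 * c2 = c2 * (q * c1 + p * e3)" by (simp add: algebra_simps)
    finally show ?thesis using excess2 c_pos by (metis less_le_trans mult_pos_pos zero_less_mult_pos)
  next
    case 3
    have "e1 * (p * e2 + q * c2) = q * (e1 * c2) + p * e1 * e2" by (simp add: algebra_simps)
    also have "\<dots> \<ge> q * (c3 * e2) + p * e1 * e2" using 3 slope1 by (simp add: mult_left_mono)
    also have "q * (c3 * e2) + p * e1 * e2 = e2 * (p * e1 + q * c3)" by (simp add: algebra_simps)
    finally show ?thesis using excess1 e_pos by (metis less_le_trans mult_pos_pos zero_less_mult_pos)
  qed
qed

lemma swap: "weights e1 e2 e3 c1 c2 c3 q p"
  using c_pos e_pos slope1 slope2 log_concave excess1 excess2 p_bounds q_bounds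
  by unfold_locales (auto simp: algebra_simps)

text \<open>This is the gap. If \<open>c3 < k\<close> or \<open>e3 < l\<close>, a combination of the
  bound on \<open>q\<close> and the bound on \<open>p\<close> valid in that region contradicts
  \<open>excess\<close>, \<open>excess1\<close> or \<open>excess2\<close>. What remains is the
  region \<open>k \<le> c3\<close>, \<open>l \<le> e3\<close>.\<close>

lemma small_pair:
  assumes "0 \<le> k" "0 \<le> l" "k \<le> c3 + c2" "l \<le> e3 + e2"
    and linA: "k \<le> c3 \<Longrightarrow> q * c3 \<le> (l - e3) * c3 + e1 * (c3 - k)"
    and chordA: "c3 \<le> k \<Longrightarrow> k \<le> c3 + c2 \<Longrightarrow> q * c2 \<le> (l - e3) * c2 - (k - c3) * e2"
    and linB: "l \<le> e3 \<Longrightarrow> p * e3 \<le> (k - c3) * e3 + c1 * (e3 - l)"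
    and chordB: "e3 \<le> l \<Longrightarrow> l \<le> e3 + e2 \<Longrightarrow> p * e2 \<le> (k - c3) * e2 - (l - e3) * c2"
  shows "k \<le> c3" "l \<le> e3" "k < c3 + p" "l < e3 + q" "k \<le> c2" "l \<le> e2"
proof -
  have not1: False if "c3 < k" "e3 < l"
    using chordA chordB that assms(3,4) excess by simp
  have not2: False if "k \<le> c3" "e3 < l"
  proof -
    define x y where "x = c3 - k" and "y = l - e3"
    have xy: "0 \<le> x" "0 < y" using that by (auto simp: x_def y_def)
    have A: "q * c3 \<le> y * c3 + e1 * x" using linA that by (simp add: x_def y_def)
    have B: "p * e2 \<le> - x * e2 - y * c2" using chordB that assms(4) by (simp add: x_def y_def)
    have "e2 * (p * e1 + q * c3) \<le> e1 * (- x * e2 - y * c2) + e2 * (y * c3 + e1 * x)"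
      using mult_left_mono[OF A, of e2] mult_left_mono[OF B, of e1] e_pos by (simp add: algebra_simps)
    also have "\<dots> = y * (c3 * e2 - e1 * c2)" by (simp add: algebra_simps)
    also have "\<dots> \<le> 0" using xy slope1 by (simp add: mult_nonneg_nonpos)
    finally show False using excess1 e_pos by (simp add: mult_le_0_iff)
  qed
  have not3: False if "c3 < k" "l \<le> e3"
  proof -
    define x y where "x = e3 - l" and "y = k - c3"
    have xy: "0 \<le> x" "0 < y" using that by (auto simp: x_def y_def)
    have A: "p * e3 \<le> y * e3 + c1 * x" using linB that by (simp add: x_def y_def)
    have B: "q * c2 \<le> - x * c2 - y * e2" using chordA that assms(3) by (simp add: x_def y_def)
    have "c2 * (q * c1 + p * e3) \<le> c1 * (- x * c2 - y * e2) + c2 * (y * e3 + c1 * x)"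
      using mult_left_mono[OF A, of c2] mult_left_mono[OF B, of c1] c_pos by (simp add: algebra_simps)
    also have "\<dots> = y * (e3 * c2 - c1 * e2)" by (simp add: algebra_simps)
    also have "\<dots> \<le> 0" using xy slope2 by (simp add: mult_nonneg_nonpos)
    finally show False using excess2 c_pos by (simp add: mult_le_0_iff)
  qed
  show k: "k \<le> c3" using not1 not3 by force
  show l: "l \<le> e3" using not1 not2 by force
  have "q * c3 \<le> e1 * (c3 - k)"
    using linA[OF k] l c_pos by (smt (verit) mult_nonpos_nonneg)
  then have "0 < e1 * (p + c3 - k)" using excess1 by (simp add: algebra_simps)
  then show kp: "k < c3 + p" using e_pos by (simp add: zero_less_mult_iff)
  have "p * e3 \<le> c1 * (e3 - l)"
    using linB[OF l] k e_pos by (smt (verit) mult_nonpos_nonneg)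
  then have "0 < c1 * (q + e3 - l)" using excess2 by (simp add: algebra_simps)
  then show lq: "l < e3 + q" using c_pos by (simp add: zero_less_mult_iff)
  \<comment> \<open>One factor is at most \<open>c3\<close>, the other is below
    \<open>c3 + p < c1\<close>; log-concavity turns the product into \<open>c2 * c2\<close>.\<close>
  have "k * k \<le> c1 * c3" using k kp p_bounds assms(1) by (intro mult_mono) auto
  then have "k * k \<le> c2 * c2" using log_concave by simp
  then show "k \<le> c2" using c_pos assms(1)
      by (metis abs_le_square_iff abs_of_nonneg less_imp_le power2_eq_square)
  have "l * l \<le> e1 * e3" using l lq q_bounds assms(2) by (intro mult_mono) auto
  then have "l * l \<le> e2 * e2" using log_concave by simp
  then show "l \<le> e2" using e_pos assms(2)
      by (metis abs_le_square_iff abs_of_nonneg less_imp_le power2_eq_square)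
qed

end

text \<open>Inserting the upper bounds on \<open>x'\<close> and \<open>y'\<close> into
  \<open>2 + Q + D\<close>, and then the lower bound on \<open>x + y\<close>, gives
  \<open>P * R + Q \<le> (2 - D) * (1 - R)\<close>, which is not positive. The next lemma ends the
  same way with \<open>y' - D\<close> in place of \<open>2 - D\<close>.\<close>

lemma two_small_links_contradiction:
  fixes x y x' y' P Q D R :: real
  assumes "1 \<le> R" "2 + P - D \<le> x + y" "2 + Q + D \<le> x' + y'"
    and "y' \<le> 2 - x * R" "x' \<le> 2 - y * R" "D \<le> 2" "0 < P * R + Q"
  shows False
proof -
  have "(2 + P - D) * R \<le> (x + y) * R" using assms by (intro mult_right_mono) auto
  moreover have "0 \<le> (2 - D) * (R - 1)" using assms by simp
  ultimately show False using assms by (simp add: algebra_simps)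
qed

lemma one_small_link_contradiction:
  fixes x y x' y' P Q D R :: real
  assumes "1 \<le> R" "2 + P - D \<le> x + y" "2 + Q + D \<le> x' + y'"
    and "x + y' \<le> 2" "x' \<le> 2 - y * R" "D \<le> y'" "0 < P * R + Q"
  shows False
proof -
  have "(P - D + y') * R \<le> y * R" using assms by (intro mult_right_mono) auto
  moreover have "0 \<le> (y' - D) * (R - 1)" using assms by simp
  ultimately show False using assms by (simp add: algebra_simps)
qed

context weights
begin

text \<open>The three lines meet at \<open>(c3, e3 + 2 * e2)\<close> and
  \<open>(c3 + 2 * c2, e3)\<close>. For set families, \<open>c3\<close> and \<open>c3 + c2\<close>
  are the numbers of \<open>(a - 1)\<close>-subsets of an \<open>(n - 2)\<close>-set through two,
  respectively one, fixed elements, and \<open>(c3 + c2, e3 + e2)\<close> is the midpoint of the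
  middle line.\<close>

definition linked :: "real \<Rightarrow> real \<Rightarrow> bool" where
  "linked X Y \<longleftrightarrow> (X \<le> c3 \<longrightarrow> Y * c3 + X * e1 \<le> (e1 + 2 * e2 + e3) * c3) \<and>
     (Y \<le> e3 \<longrightarrow> X * e3 + Y * c1 \<le> (c1 + 2 * c2 + c3) * e3) \<and>
     (c3 \<le> X \<longrightarrow> e3 \<le> Y \<longrightarrow> (X - c3) * e2 + (Y - e3) * c2 \<le> 2 * c2 * e2)"

text \<open>With origin \<open>(c3, e3)\<close> and units \<open>c2\<close> and \<open>e2\<close>
  the middle line becomes \<open>x + y = 2\<close>, and the outer lines start at its end points
  \<open>(0, 2)\<close> and \<open>(2, 0)\<close>.\<close>

lemma linked_normalized:
  assumes "linked X Y" and x: "x = (X - c3) / c2" and y: "y = (Y - e3) / e2"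
  shows "x < 0 \<Longrightarrow> y \<le> 2 - x * (e1 * c2 / (c3 * e2))"
    and "y < 0 \<Longrightarrow> x \<le> 2 - y * (c1 * e2 / (e3 * c2))"
    and "0 \<le> x \<Longrightarrow> 0 \<le> y \<Longrightarrow> x + y \<le> 2"
proof -
  have X: "X = c3 + x * c2" and Y: "Y = e3 + y * e2" using x y c_pos e_pos by auto
  have l: "(X \<le> c3 \<longrightarrow> Y * c3 + X * e1 \<le> (e1 + 2 * e2 + e3) * c3)"
     "(Y \<le> e3 \<longrightarrow> X * e3 + Y * c1 \<le> (c1 + 2 * c2 + c3) * e3)"
     "(c3 \<le> X \<longrightarrow> e3 \<le> Y \<longrightarrow> (X - c3) * e2 + (Y - e3) * c2 \<le> 2 * c2 * e2)"
    using assms(1) unfolding linked_def by auto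
  show "y \<le> 2 - x * (e1 * c2 / (c3 * e2))" if "x < 0"
  proof -
    have "X \<le> c3" using that X c_pos by (simp add: mult_nonpos_nonneg)
    then have "y * (c3 * e2) \<le> 2 * (c3 * e2) - x * (e1 * c2)" using l(1) unfolding X Y
        by (simp add: algebra_simps)
    then show ?thesis using c_pos e_pos by (simp add: field_simps)
  qed
  show "x \<le> 2 - y * (c1 * e2 / (e3 * c2))" if "y < 0"
  proof -
    have "Y \<le> e3" using that Y e_pos by (simp add: mult_nonpos_nonneg)
    then have "x * (e3 * c2) \<le> 2 * (e3 * c2) - y * (c1 * e2)" using l(2) unfolding X Y
        by (simp add: algebra_simps)
    then show ?thesis using c_pos e_pos by (simp add: field_simps)
  qed
  show "x + y \<le> 2" if "0 \<le> x" "0 \<le> y"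
  proof -
    have "(x + y) * (c2 * e2) \<le> 2 * (c2 * e2)" using l(3) that c_pos e_pos unfolding X Y
        by (simp add: algebra_simps)
    then show ?thesis using c_pos e_pos by simp
  qed
qed

text \<open>\<open>X\<close>, \<open>Y\<close>, \<open>A0\<close> stand for the numbers of members of the first family that contain only \<open>i\<close>, only
  \<open>j\<close>, or neither of \<open>i\<close> and \<open>j\<close>, and \<open>X'\<close>, \<open>Y'\<close>, \<open>B0\<close> for those of the second family.\<close>

lemma good_before_shift:
  assumes sizeA: "e2 * (2 * c2 + 2 * c3 + p) + B0 * c2 \<le> e2 * (X + Y + A0)"
    and sizeB: "c2 * (2 * e2 + 2 * e3 + q) + A0 * e2 \<le> c2 * (X' + Y' + B0)"
    and A0: "0 \<le> A0" "A0 \<le> c2" and B0: "0 \<le> B0" "B0 \<le> e2"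
    and XY': "linked X Y'" and YX': "linked Y X'"
  shows "(Y + A0 \<le> c3 + c2 \<and> Y' + B0 \<le> e3 + e2) \<or> (X + A0 \<le> c3 + c2 \<and> X' + B0 \<le> e3 + e2)"
proof (rule ccontr)
  assume contra: "\<not> ?thesis"
  define x y x' y' where "x = (X - c3) / c2" and "y = (Y - c3) / c2"
    and "x' = (X' - e3) / e2" and "y' = (Y' - e3) / e2"
  define \<alpha> \<beta> P Q where "\<alpha> = A0 / c2" and "\<beta> = B0 / e2" and "P = p / c2" and "Q = q / e2"
  define R1 R2 where "R1 = e1 * c2 / (c3 * e2)" and "R2 = c1 * e2 / (e3 * c2)"
  have eqs: "X = c3 + x * c2" "Y = c3 + y * c2" "X' = e3 + x' * e2" "Y' = e3 + y' * e2"
    "A0 = \<alpha> * c2" "B0 = \<beta> * e2" "p = P * c2" "q = Q * e2"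
    using c_pos e_pos by (auto simp: x_def y_def x'_def y'_def \<alpha>_def \<beta>_def P_def Q_def)
  have ab: "0 \<le> \<alpha>" "\<alpha> \<le> 1" "0 \<le> \<beta>" "\<beta> \<le> 1" using A0 B0 c_pos e_pos by (auto simp: \<alpha>_def \<beta>_def)
  have R: "1 \<le> R1" "1 \<le> R2" using slope1 slope2 c_pos e_pos by (auto simp: R1_def R2_def field_simps)
  have N1: "0 < P * R1 + Q"
  proof -
    have "P * R1 + Q = (p * e1 + q * c3) / (c3 * e2)"
      using c_pos e_pos by (simp add: P_def Q_def R1_def field_simps)
    then show ?thesis using excess1 c_pos e_pos by simp
  qed
  have N2: "0 < Q * R2 + P"
  proof -
    have "Q * R2 + P = (q * c1 + p * e3) / (e3 * c2)"
      using c_pos e_pos by (simp add: P_def Q_def R2_def field_simps)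
    then show ?thesis using excess2 c_pos e_pos by simp
  qed
  have N3: "0 < P + Q"
  proof -
    have "P + Q = (p * e2 + q * c2) / (c2 * e2)"
      using c_pos e_pos by (simp add: P_def Q_def field_simps)
    then show ?thesis using excess c_pos e_pos by simp
  qed
  have sA: "2 + P - (\<alpha> - \<beta>) \<le> x + y"
  proof -
    have "(2 + P - (\<alpha> - \<beta>)) * (c2 * e2) \<le> (x + y) * (c2 * e2)" using sizeA unfolding eqs
        by (simp add: algebra_simps)
    then show ?thesis using c_pos e_pos by simp
  qed
  have sB: "2 + Q + (\<alpha> - \<beta>) \<le> x' + y'"
  proof -
    have "(2 + Q + (\<alpha> - \<beta>)) * (c2 * e2) \<le> (x' + y') * (c2 * e2)" using sizeB unfolding eqs
        by (simp add: algebra_simps)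
    then show ?thesis using c_pos e_pos by simp
  qed
  \<comment> \<open>The members avoiding \<open>i\<close> number \<open>Y + A0\<close> and
    \<open>Y' + B0\<close>, those avoiding \<open>j\<close> number \<open>X + A0\<close> and
    \<open>X' + B0\<close>. So \<open>ni\<close> and \<open>nj\<close> say that each of the two
    elements is bad for at least one family.\<close>
  have ni: "1 < y + \<alpha> \<or> 1 < y' + \<beta>"
  proof (rule ccontr)
    assume "\<not> ?thesis"
    then have "(y + \<alpha>) * c2 \<le> 1 * c2" "(y' + \<beta>) * e2 \<le> 1 * e2" using c_pos e_pos
        by (auto intro!: mult_right_mono)
    then show False using contra unfolding eqs by (simp add: algebra_simps)
  qed
  have nj: "1 < x + \<alpha> \<or> 1 < x' + \<beta>"
  proof (rule ccontr)
    assume "\<not> ?thesis"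
    then have "(x + \<alpha>) * c2 \<le> 1 * c2" "(x' + \<beta>) * e2 \<le> 1 * e2" using c_pos e_pos
        by (auto intro!: mult_right_mono)
    then show False using contra unfolding eqs by (simp add: algebra_simps)
  qed
  note l1 = linked_normalized[OF XY' x_def y'_def, folded R1_def R2_def]
  note l2 = linked_normalized[OF YX' y_def x'_def, folded R1_def R2_def]
  have sA': "2 + P + (\<beta> - \<alpha>) \<le> x + y" and sB': "2 + Q - (\<beta> - \<alpha>) \<le> x' + y'" using sA sB by auto
  \<comment> \<open>Split by signs, where \<open>(x, y')\<close> and \<open>(y, x')\<close> are the
    linked pairs. Two negative coordinates in one family fall to \<open>d1\<close> and
    \<open>d2\<close>, two belonging to the same one of \<open>i\<close>, \<open>j\<close> to
    \<open>b1\<close> and \<open>b2\<close>. A negative coordinate opposite a linked pair without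
    negative entries falls to \<open>e1\<close>, \<open>e5\<close>, \<open>e4\<close>,
    \<open>e2\<close>, and the case of no negative coordinate to \<open>N3\<close>.\<close>
  have d1: False if "x < 0" "y < 0"
    using two_small_links_contradiction[OF R(1) sA sB l1(1)[OF that(1)] l2(1)[OF that(2)] _ N1] ab
        by simp
  have d2: False if "y' < 0" "x' < 0"
    using two_small_links_contradiction[OF R(2), of Q "\<beta> - \<alpha>" y' x' P y x]
      sA' sB' l1(2)[OF that(1)] l2(2)[OF that(2)] N2 ab by (simp add: add.commute)
  have b1: False if "y < 0" "y' < 0" using ni that ab by linarith
  have b2: False if "x < 0" "x' < 0" using nj that ab by linarith
  have e1: False if "y < 0" "0 \<le> x" "0 \<le> y'"
    using one_small_link_contradiction[OF R(1) sA sB l1(3)[OF that(2,3)] l2(1)[OF that(1)] _ N1] ni that ab by linarith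
  have e5: False if "x < 0" "0 \<le> y" "0 \<le> x'"
    using one_small_link_contradiction[OF R(1), of P "\<alpha> - \<beta>" y x Q y' x']
      sA sB l2(3)[OF that(2,3)] l1(1)[OF that(1)] N1 nj that ab by linarith
  have e4: False if "y' < 0" "0 \<le> x'" "0 \<le> y"
    using one_small_link_contradiction[OF R(2), of Q "\<beta> - \<alpha>" x' y' P x y]
      sA' sB' l2(3)[OF that(3,2)] l1(2)[OF that(1)] N2 ni that ab by linarith
  have e2: False if "x' < 0" "0 \<le> y'" "0 \<le> x"
    using one_small_link_contradiction[OF R(2), of Q "\<beta> - \<alpha>" y' x' P y x]
      sA' sB' l1(3)[OF that(3,2)] l2(2)[OF that(1)] N2 nj that ab by linarith
  have f1: False if "0 \<le> x" "0 \<le> y'" "0 \<le> y" "0 \<le> x'"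
    using l1(3) l2(3) that sA sB N3 by linarith
  show False using d1 d2 b1 b2 e1 e2 e4 e5 f1 by linarith
qed

end

text \<open>The assumptions on \<open>dB\<close> and \<open>dA\<close> are instances of
  \<open>hit_both\<close>. They give \<open>p \<ge> w * c1 / y - c3 + 1\<close> and
  \<open>q \<ge> (e1 - e3) - (e1' - e3') + 1\<close>. After substitution the main terms cancel up to
  parts that are nonnegative by \<open>e3' \<le> e3\<close> and \<open>x \<le> y\<close>; the
  summands 1 make the inequalities strict.\<close>

lemma excess_core:
  fixes c1 c3 e1 e3 e1' e3' u w x y dA dB p q :: real
  assumes pos: "0 < c3" "0 < c1" "0 < e1" "0 < e3" "0 < u" "0 < w" "u < x" "w < y" "x \<le> y"
    and e: "u * e1 = y * e3" and e': "u * e1' = x * e3'" and c: "w * c1 = x * c3" and le: "e3' \<le> e3"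
    and dB: "y * dB \<le> (y - w) * c1" and dA: "x * dA \<le> (x - u) * e1'"
    and p: "c1 - c3 - dB + 1 \<le> p" and q: "e1 - e3 - dA + 1 \<le> q"
  shows "0 < p * e1 + q * c3" "0 < q * c1 + p * e3"
proof -
  have E1: "e1 = y / u * e3" and E1': "e1' = x / u * e3'" and C3: "c3 = w / x * c1"
    using e e' c pos by (auto simp: field_simps)
  have "dA \<le> (x - u) * e1' / x" using dA pos by (simp add: field_simps)
  also have "\<dots> = e1' - e3'" unfolding E1' using pos by (simp add: field_simps)
  finally have q': "e1 - e3 - (e1' - e3') + 1 \<le> q" using q by simp
  have "dB \<le> (y - w) * c1 / y" using dB pos by (simp add: field_simps)
  also have "\<dots> = c1 - w * c1 / y" using pos by (simp add: field_simps)
  finally have p': "w * c1 / y - c3 + 1 \<le> p" using p by simp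
  have "(w * c1 / y - c3 + 1) * e1 + (e1 - e3 - (e1' - e3') + 1) * c3
      = c3 * ((x / u - 1) * (e3 - e3')) + e1 + c3"
  proof -
    have "w * c1 / y * e1 = x / u * e3 * c3" unfolding c E1 using pos by (simp add: field_simps)
    then show ?thesis unfolding E1' by (simp add: algebra_simps diff_divide_distrib)
  qed
  moreover have "0 \<le> c3 * ((x / u - 1) * (e3 - e3'))" using pos le by (intro mult_nonneg_nonneg) auto
  moreover have "(w * c1 / y - c3 + 1) * e1 + (e1 - e3 - (e1' - e3') + 1) * c3 \<le> p * e1 + q * c3"
    using p' q' pos by (intro add_mono mult_right_mono) auto
  ultimately show "0 < p * e1 + q * c3" using pos by linarith
  have "(e1 - e3 - (e1' - e3') + 1) * c1 + (w * c1 / y - c3 + 1) * e3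
      = c1 * (e3 * (y / u - 1 + w / y - w / x) - e3' * (x / u - 1)) + c1 + e3"
    unfolding E1 E1' C3 using pos by (simp add: algebra_simps)
  moreover have "0 \<le> e3 * (y / u - 1 + w / y - w / x) - e3' * (x / u - 1)"
  proof -
    have "(y / u - 1 + w / y - w / x) - (x / u - 1) = (y - x) * (x * y - u * w) / (u * x * y)"
      using pos by (simp add: field_simps)
    also have "\<dots> \<ge> 0"
    proof -
      have "u * w \<le> x * y" using pos by (intro mult_mono) auto
      then show ?thesis using pos by simp
    qed
    finally have "x / u - 1 \<le> y / u - 1 + w / y - w / x" by simp
    moreover have "0 \<le> x / u - 1" using pos by simp
    ultimately have "e3' * (x / u - 1) \<le> e3 * (y / u - 1 + w / y - w / x)"
      using le pos by (smt (verit) mult_left_mono mult_right_mono)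
    then show ?thesis by simp
  qed
  then have "0 \<le> c1 * (e3 * (y / u - 1 + w / y - w / x) - e3' * (x / u - 1))" using pos by simp
  moreover have "(e1 - e3 - (e1' - e3') + 1) * c1 + (w * c1 / y - c3 + 1) * e3 \<le> q * c1 + p * e3"
    using p' q' pos by (intro add_mono mult_right_mono) auto
  ultimately show "0 < q * c1 + p * e3" using pos by linarith
qed

lemma binomial_ratio_steps:
  assumes "3 \<le> k" "4 \<le> n"
  shows "(real n - real k - 2) * real ((n - 4) choose (k - 2)) =
      (real k - 1) * real ((n - 4) choose (k - 1))"
    and "(real n - real k - 1) * real ((n - 4) choose (k - 3)) =
        (real k - 2) * real ((n - 4) choose (k - 2))"
    and "(real k - 1) * (real k - 2) * real ((n - 4) choose (k - 1))
      = (real n - 1 - real k) * (real n - 1 - real k - 1) * real ((n - 4) choose (k - 3))"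
proof -
  have "Suc (k - 2) = k - 1" "Suc (k - 3) = k - 2" using assms by auto
  then show 1: "(real n - real k - 2) * real ((n - 4) choose (k - 2)) =
      (real k - 1) * real ((n - 4) choose (k - 1))"
    and 2: "(real n - real k - 1) * real ((n - 4) choose (k - 3)) =
        (real k - 2) * real ((n - 4) choose (k - 2))"
    using binomial_ratio_real[of "n - 4" "k - 2"] binomial_ratio_real[of "n - 4" "k - 3"] assms
    by (auto simp: of_nat_diff algebra_simps)
  have "(real k - 1) * (real k - 2) * real ((n - 4) choose (k - 1))
      = (real k - 2) * ((real n - real k - 2) * real ((n - 4) choose (k - 2)))" unfolding 1 by simp
  also have "\<dots> = (real n - real k - 2) * ((real n - real k - 1) * real ((n - 4) choose (k - 3)))"
      unfolding 2 by simp
  finally show "(real k - 1) * (real k - 2) * real ((n - 4) choose (k - 1))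
      = (real n - 1 - real k) * (real n - 1 - real k - 1) * real ((n - 4) choose (k - 3))"
          by (simp add: algebra_simps)
qed

lemma weights_binomial:
  fixes a b n :: nat and dA dB kA kB :: real
  assumes ab: "b \<le> a" "5 \<le> b" "a + b < n"
    and dB: "dB \<le> 2 * real ((n - 1 - b) choose (a - 1)) - real ((n - 1 - b - (b - 3)) choose (a - 1))"
    and dA: "dA \<le> 2 * real ((n - 1 - a) choose (b - 1)) - real ((n - 1 - a - (b - 3)) choose (b - 1))"
    and k: "1 \<le> kA" "kA < dB" "1 \<le> kB" "kB < dA"
  defines "c \<equiv> \<lambda>j. real ((n - 4) choose (a - j))" and "e \<equiv> \<lambda>j. real ((n - 4) choose (b - j))"
  shows "weights (c 1) (c 2) (c 3) (e 1) (e 2) (e 3) (c 1 - c 3 - dB + kA) (e 1 - e 3 - dA + kB)"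
proof -
  define A B N where "A = real a" and "B = real b" and "N = real n"
  have r: "5 \<le> B" "B \<le> A" "A + B + 1 \<le> N" using ab by (auto simp: A_def B_def N_def)
  have cpos: "0 < c j" "0 < e j" if "j \<le> 3" for j using that ab by (auto simp: c_def e_def)
  have cr: "(N - A - 2) * c 2 = (A - 1) * c 1" "(N - A - 1) * c 3 = (A - 2) * c 2"
    "(A - 1) * (A - 2) * c 1 = (N - 1 - A) * (N - 1 - A - 1) * c 3"
    using binomial_ratio_steps[of a n] ab by (simp_all add: A_def N_def c_def)
  have er: "(N - B - 2) * e 2 = (B - 1) * e 1" "(N - B - 1) * e 3 = (B - 2) * e 2"
    "(B - 1) * (B - 2) * e 1 = (N - 1 - B) * (N - 1 - B - 1) * e 3"
    using binomial_ratio_steps[of b n] ab by (simp_all add: B_def N_def e_def)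
  \<comment> \<open>For \<open>dA\<close> the ground size in \<open>hit_both\<close> is
    \<open>n - 1 - a + (b - 3) = n - a + b - 4\<close> instead of \<open>n - 4\<close>, hence these
    variants of \<open>e 1\<close> and \<open>e 3\<close>.\<close>
  define e1' e3' where "e1' = real ((n - a + b - 4) choose (b - 1))" and "e3' = real ((n - a
      + b - 4) choose (b - 3))"
  have er': "(B - 1) * (B - 2) * e1' = (N - 1 - A) * (N - 1 - A - 1) * e3'"
    using binomial_ratio_steps(3)[of b "n - a + b"] ab
    by (simp add: B_def N_def A_def e1'_def e3'_def of_nat_diff algebra_simps)
  have le: "e3' \<le> e 3" unfolding e3'_def e_def using ab by (intro of_nat_mono binomial_left_mono) auto
  have H1: "(N - 1 - B) * (N - 1 - B - 1) * dB
      \<le> ((N - 1 - B) * (N - 1 - B - 1) - (A - 1) * (A - 2)) * c 1"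
  proof -
    have "(N - 1 - B) * (N - 1 - B - 1) * dB \<le> (N - 1 - B) * (N - 1 - B - 1) *
        (2 * real ((n - 1 - b) choose (a - 1)) - real ((n - 1 - b - (b - 3)) choose (a - 1)))"
      using dB r by (intro mult_left_mono mult_nonneg_nonneg) auto
    also have "\<dots> \<le> ((N - 1 - B) * (N - 1 - B - 1) - (A - 1) * (A - 2)) * c 1"
    proof -
      have eqs: "n - 1 - b + (b - 3) = n - 4" "real (n - 1 - b) = N - 1 - B" "real (a - 1) = A - 1"
        "A - 1 - 1 = A - 2" using ab by (auto simp: N_def B_def A_def of_nat_diff)
      have "1 \<le> a - 1" "a - 1 < n - 1 - b" "2 \<le> b - 3" using ab by auto
      from hit_both[OF this] show ?thesis unfolding eqs c_def .
    qed
    finally show ?thesis .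
  qed
  have H2: "(N - 1 - A) * (N - 1 - A - 1) * dA
      \<le> ((N - 1 - A) * (N - 1 - A - 1) - (B - 1) * (B - 2)) * e1'"
  proof -
    have "(N - 1 - A) * (N - 1 - A - 1) * dA \<le> (N - 1 - A) * (N - 1 - A - 1) *
        (2 * real ((n - 1 - a) choose (b - 1)) - real ((n - 1 - a - (b - 3)) choose (b - 1)))"
      using dA r by (intro mult_left_mono mult_nonneg_nonneg) auto
    also have "\<dots> \<le> ((N - 1 - A) * (N - 1 - A - 1) - (B - 1) * (B - 2)) * e1'"
    proof -
      have eqs: "n - 1 - a + (b - 3) = n - a + b - 4" "real (n - 1 - a) = N - 1 - A" "real (b - 1)
          = B - 1"
        "B - 1 - 1 = B - 2" using ab by (auto simp: N_def B_def A_def of_nat_diff)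
      have "1 \<le> b - 1" "b - 1 < n - 1 - a" "2 \<le> b - 3" using ab by auto
      from hit_both[OF this] show ?thesis unfolding eqs e1'_def .
    qed
    finally show ?thesis .
  qed
  define u w x y where "u = (B - 1) * (B - 2)" and "w = (A - 1) * (A - 2)"
    and "x = (N - 1 - A) * (N - 1 - A - 1)" and "y = (N - 1 - B) * (N - 1 - B - 1)"
  have up: "0 < u" "0 < w" using r by (auto simp: u_def w_def)
  have ux: "u < x" unfolding u_def x_def using r by (intro mult_strict_mono) auto
  have wy: "w < y" unfolding w_def y_def using r by (intro mult_strict_mono) auto
  have xy: "x \<le> y" unfolding x_def y_def using r by (intro mult_mono) auto
  note core = excess_core[OF cpos(1)[of 3] cpos(1)[of 1] cpos(2)[of 1] cpos(2)[of 3] up ux wy xy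
    er(3)[folded u_def y_def] er'[folded u_def x_def] cr(3)[folded w_def x_def] le
    H1[folded w_def y_def] H2[folded u_def x_def]]
  have dBc: "dB \<le> c 1"
  proof -
    have "y * dB \<le> y * c 1" using H1[folded w_def y_def] mult_pos_pos[OF up(2) cpos(1)[of 1]]
        by (simp add: algebra_simps)
    then show ?thesis using up wy by simp
  qed
  have dAe: "dA \<le> e 1"
  proof -
    have "0 \<le> u * e1'" using up(1) by (simp add: e1'_def)
    then have "x * dA \<le> x * e1'" using H2[folded u_def x_def] by (simp add: algebra_simps)
    then have "dA \<le> e1'" using up ux by simp
    also have "e1' \<le> e 1" unfolding e1'_def e_def using ab
        by (intro of_nat_mono binomial_left_mono) auto
    finally show ?thesis .
  qed
  have C2: "c 1 = (N - A - 2) / (A - 1) * c 2" "c 3 = (A - 2) / (N - A - 1) * c 2"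
    using cr r by (auto simp: field_simps)
  have E2: "e 1 = (N - B - 2) / (B - 1) * e 2" "e 3 = (B - 2) / (N - B - 1) * e 2"
    using er r by (auto simp: field_simps)
  have ce: "0 < c 2 * e 2" "0 < c 2 * c 2" "0 < e 2 * e 2" using cpos by auto
  show ?thesis
  proof (unfold_locales)
    show "0 < (c 1 - c 3 - dB + kA) * e 1 + (e 1 - e 3 - dA + kB) * c 3"
      "0 < (e 1 - e 3 - dA + kB) * c 1 + (c 1 - c 3 - dB + kA) * e 3"
      using core k by simp_all
    have "(A - 2) / (N - A - 1) * (c 2 * e 2) \<le> (N - B - 2) / (B - 1) * (c 2 * e 2)"
    proof (rule mult_right_mono)
      have "(A - 2) * (B - 1) \<le> (N - B - 2) * (N - A - 1)" using r by (intro mult_mono) auto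
      then show "(A - 2) / (N - A - 1) \<le> (N - B - 2) / (B - 1)" using r by (simp add: divide_simps)
    qed (use ce in simp)
    then show "c 3 * e 2 \<le> e 1 * c 2" unfolding C2(2) E2(1) by (simp add: algebra_simps)
    have "(B - 2) / (N - B - 1) * (c 2 * e 2) \<le> (N - A - 2) / (A - 1) * (c 2 * e 2)"
    proof (rule mult_right_mono)
      have "(B - 2) * (A - 1) \<le> (N - A - 2) * (N - B - 1)" using r by (intro mult_mono) auto
      then show "(B - 2) / (N - B - 1) \<le> (N - A - 2) / (A - 1)" using r by (simp add: divide_simps)
    qed (use ce in simp)
    then show "e 3 * c 2 \<le> c 1 * e 2" unfolding C2(1) E2(2) by (simp add: algebra_simps)
    have "(N - A - 2) / (A - 1) * ((A - 2) / (N - A - 1)) * (c 2 * c 2) \<le> 1 * (c 2 * c 2)"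
    proof (rule mult_right_mono)
      have "(N - A - 2) * (A - 2) \<le> (N - A - 1) * (A - 1)" using r by (intro mult_mono) auto
      then show "(N - A - 2) / (A - 1) * ((A - 2) / (N - A - 1)) \<le> 1" using r
          by (simp add: divide_simps mult.commute)
    qed (use ce in simp)
    then show "c 1 * c 3 \<le> c 2 * c 2" unfolding C2 by (simp only: ac_simps mult_1_left mult_1_right)
    have "(N - B - 2) / (B - 1) * ((B - 2) / (N - B - 1)) * (e 2 * e 2) \<le> 1 * (e 2 * e 2)"
    proof (rule mult_right_mono)
      have "(N - B - 2) * (B - 2) \<le> (N - B - 1) * (B - 1)" using r by (intro mult_mono) auto
      then show "(N - B - 2) / (B - 1) * ((B - 2) / (N - B - 1)) \<le> 1" using r
          by (simp add: divide_simps mult.commute)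
    qed (use ce in simp)
    then show "e 1 * e 3 \<le> e 2 * e 2" unfolding E2 by (simp only: ac_simps mult_1_left mult_1_right)
  qed (use cpos k dBc dAe in auto)
qed

section \<open>Centers of large cross-intersecting pairs\<close>

text \<open>The selected members of \<A> and \<B> can only meet outside
  \<open>T \<union> T'\<close>, so removing \<open>T\<close> and \<open>T'\<close> from them loses
  no intersection.\<close>

lemma cross_intersecting_links:
  assumes "\<A> \<subseteq> [G]\<^bsup>a\<^esup>" "\<B> \<subseteq> [G]\<^bsup>b\<^esup>" "cross_intersecting \<A> \<B>"
    and "finite T" "finite T'" "S = G - (T \<union> T')" "a' = a - card T" "b' = b - card T'"
    and "\<A>' = {H \<in> \<A>. T \<subseteq> H \<and> H \<inter> T' = {}}" "\<B>' = {H \<in> \<B>. T' \<subseteq> H \<and> H \<inter> T = {}}"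
  shows "\<exists>\<X> \<Y>. \<X> \<subseteq> [S]\<^bsup>a'\<^esup> \<and> \<Y> \<subseteq> [S]\<^bsup>b'\<^esup> \<and> cross_intersecting \<X> \<Y> \<and>
    card \<X> = card \<A>' \<and> card \<Y> = card \<B>'"
  unfolding assms(6-10)
proof (intro exI conjI)
  let ?A = "{H \<in> \<A>. T \<subseteq> H \<and> H \<inter> T' = {}}" and ?B = "{H \<in> \<B>. T' \<subseteq> H \<and> H \<inter> T = {}}"
  have A: "?A \<subseteq> [G]\<^bsup>a\<^esup>" and B: "?B \<subseteq> [G]\<^bsup>b\<^esup>" using assms(1,2) by auto
  have A': "T \<subseteq> H \<and> H - T \<subseteq> G - (T \<union> T')" if "H \<in> ?A" for H
    using that nsetsD(1)[OF subsetD[OF A that]] by blast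
  have B': "T' \<subseteq> H \<and> H - T' \<subseteq> G - (T \<union> T')" if "H \<in> ?B" for H
    using that nsetsD(1)[OF subsetD[OF B that]] by blast
  note imA = Diff_image_in_nsets[OF A assms(4) A'] and imB = Diff_image_in_nsets[OF B assms(5) B']
  show "(\<lambda>H. H - T) ` ?A \<subseteq> [G - (T \<union> T')]\<^bsup>(a - card T)\<^esup>" by (rule imA(1))
  show "(\<lambda>H. H - T') ` ?B \<subseteq> [G - (T \<union> T')]\<^bsup>(b - card T')\<^esup>" by (rule imB(1))
  show "card ((\<lambda>H. H - T) ` ?A) = card ?A" by (rule imA(2))
  show "card ((\<lambda>H. H - T') ` ?B) = card ?B" by (rule imB(2))
  have meet: "(F - T) \<inter> (H - T') \<noteq> {}" if "F \<in> ?A" "H \<in> ?B" for F H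
  proof -
    have "F \<inter> H \<noteq> {}" using that assms(3) by (simp add: cross_intersecting_def)
    then show ?thesis using that by blast
  qed
  show "cross_intersecting ((\<lambda>H. H - T) ` ?A) ((\<lambda>H. H - T') ` ?B)"
    unfolding cross_intersecting_def
  proof (intro ballI)
    fix F' H' assume "F' \<in> (\<lambda>H. H - T) ` ?A" "H' \<in> (\<lambda>H. H - T') ` ?B"
    then obtain F H where FH: "F \<in> ?A" "H \<in> ?B" "F' = F - T" "H' = H - T'" by (elim imageE)
    show "F' \<inter> H' \<noteq> {}" unfolding FH(3,4) by (rule meet[OF FH(1,2)])
  qed
qed

lemma cross_intersecting_commute: "cross_intersecting \<F> \<G> \<longleftrightarrow> cross_intersecting \<G> \<F>"
  unfolding cross_intersecting_def by blast

lemma card_split: "finite \<F> \<Longrightarrow> card {H \<in> \<F>. P H} + card {H \<in> \<F>. \<not> P H} = card \<F>"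
proof -
  assume f: "finite \<F>"
  have "\<F> = {H \<in> \<F>. P H} \<union> {H \<in> \<F>. \<not> P H}" by blast
  moreover have "card ({H \<in> \<F>. P H} \<union> {H \<in> \<F>. \<not> P H}) = card {H \<in> \<F>. P H} + card {H \<in> \<F>. \<not> P H}"
    using f by (intro card_Un_disjoint) auto
  ultimately show ?thesis by simp
qed

lemma pascal_steps:
  assumes "4 \<le> n" "4 \<le> k"
  shows "(n - 3) choose (k - 2) = ((n - 4) choose (k - 2)) + ((n - 4) choose (k - 3))"
    and "(n - 2) choose (k - 1) = ((n - 4) choose (k - 1)) + 2 * ((n - 4) choose (k - 2))
        + ((n - 4) choose (k - 3))"
    and "(n - 2) choose (k - 2) = ((n - 4) choose (k - 2)) + 2 * ((n - 4) choose (k - 3))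
        + ((n - 4) choose (k - 4))"
    and "(n - 1) choose (k - 1) = ((n - 4) choose (k - 1)) + 3 * ((n - 4) choose (k - 2))
      + 3 * ((n - 4) choose (k - 3)) + ((n - 4) choose (k - 4))"
proof -
  obtain v where v: "n = v + 4" using assms(1) by (metis add.commute le_Suc_ex)
  obtain j where j: "k = j + 4" using assms(2) by (metis add.commute le_Suc_ex)
  have s: "v + 4 - 3 = Suc v" "v + 4 - 2 = Suc (Suc v)" "v + 4 - 1 = Suc (Suc (Suc v))"
    "j + 4 - 1 = Suc (Suc (Suc j))" "j + 4 - 2 = Suc (Suc j)" "j + 4 - 3 = Suc j" by auto
  show "(n - 3) choose (k - 2) = ((n - 4) choose (k - 2)) + ((n - 4) choose (k - 3))"
    "(n - 2) choose (k - 1) = ((n - 4) choose (k - 1)) + 2 * ((n - 4) choose (k - 2))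
        + ((n - 4) choose (k - 3))"
    "(n - 2) choose (k - 2) = ((n - 4) choose (k - 2)) + 2 * ((n - 4) choose (k - 3))
        + ((n - 4) choose (k - 4))"
    "(n - 1) choose (k - 1) = ((n - 4) choose (k - 1)) + 3 * ((n - 4) choose (k - 2))
      + 3 * ((n - 4) choose (k - 3)) + ((n - 4) choose (k - 4))"
    unfolding v j s by simp_all
qed

abbreviation avoid_count :: "nat set set \<Rightarrow> nat \<Rightarrow> nat" where
  "avoid_count \<F> z \<equiv> card {H \<in> \<F>. z \<notin> H}"

locale large_pair =
  fixes a b n :: nat and p q :: real
  assumes size: "5 \<le> a" "5 \<le> b" "a + b < n"
    and weights: "weights (real ((n - 4) choose (a - 1))) (real ((n - 4) choose (a - 2)))
      (real ((n - 4) choose (a - 3))) (real ((n - 4) choose (b - 1))) (real ((n - 4) choose (b - 2)))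
      (real ((n - 4) choose (b - 3))) p q"
begin

abbreviation c :: "nat \<Rightarrow> real" where "c j \<equiv> real ((n - 4) choose (a - j))"
abbreviation e :: "nat \<Rightarrow> real" where "e j \<equiv> real ((n - 4) choose (b - j))"

sublocale weights "c 1" "c 2" "c 3" "e 1" "e 2" "e 3" p q
  using weights by simp

lemma large_pair_swap: "large_pair b a n q p"
  unfolding large_pair_def using swap size by (simp add: add.commute)

lemma pascal_a:
  "real ((n - 3) choose (a - 2)) = c 2 + c 3"
  "real ((n - 2) choose (a - 1)) = c 1 + 2 * c 2 + c 3"
  "real ((n - 2) choose (a - 2)) = c 2 + 2 * c 3 + c 4"
  "real ((n - 1) choose (a - 1)) = c 1 + 3 * c 2 + 3 * c 3 + c 4"
proof -
  have "4 \<le> n" "4 \<le> a" using size by auto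
  note * = pascal_steps[OF this]
  show "real ((n - 3) choose (a - 2)) = c 2 + c 3" unfolding * by simp
  show "real ((n - 2) choose (a - 1)) = c 1 + 2 * c 2 + c 3" unfolding * by simp
  show "real ((n - 2) choose (a - 2)) = c 2 + 2 * c 3 + c 4" unfolding * by simp
  show "real ((n - 1) choose (a - 1)) = c 1 + 3 * c 2 + 3 * c 3 + c 4" unfolding * by simp
qed

lemma pascal_b:
  "real ((n - 3) choose (b - 2)) = e 2 + e 3"
  "real ((n - 2) choose (b - 1)) = e 1 + 2 * e 2 + e 3"
  "real ((n - 2) choose (b - 2)) = e 2 + 2 * e 3 + e 4"
  "real ((n - 1) choose (b - 1)) = e 1 + 3 * e 2 + 3 * e 3 + e 4"
proof -
  have "4 \<le> n" "4 \<le> b" using size by auto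
  note * = pascal_steps[OF this]
  show "real ((n - 3) choose (b - 2)) = e 2 + e 3" unfolding * by simp
  show "real ((n - 2) choose (b - 1)) = e 1 + 2 * e 2 + e 3" unfolding * by simp
  show "real ((n - 2) choose (b - 2)) = e 2 + 2 * e 3 + e 4" unfolding * by simp
  show "real ((n - 1) choose (b - 1)) = e 1 + 3 * e 2 + 3 * e 3 + e 4" unfolding * by simp
qed

text \<open>For the values of \<open>p\<close> and \<open>q\<close> chosen in the end, the two
  thresholds are exactly the sizes of the extremal families.\<close>

definition large :: "nat set set \<Rightarrow> nat set set \<Rightarrow> bool" where
  "large \<A> \<B> \<longleftrightarrow> \<A> \<subseteq> [{1..n}]\<^bsup>a\<^esup> \<and> \<B> \<subseteq> [{1..n}]\<^bsup>b\<^esup> \<and> cross_intersecting \<A> \<B> \<and>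
     3 * c 2 + 4 * c 3 + c 4 + p \<le> real (card \<A>) \<and> 3 * e 2 + 4 * e 3 + e 4 + q \<le> real (card \<B>)"

lemma large_finite: "large \<A> \<B> \<Longrightarrow> finite \<A> \<and> finite \<B>"
  using finite_subset[OF _ finite_imp_finite_nsets[OF finite_atLeastAtMost]] unfolding large_def
      by blast

lemma large_swap:
  assumes "large \<A> \<B>"
  shows "large_pair.large b a n q p \<B> \<A>"
proof -
  have "cross_intersecting \<B> \<A>"
    using assms cross_intersecting_commute[of \<A> \<B>] by (simp only: large_def)
  then show ?thesis using assms unfolding large_def large_pair.large_def[OF large_pair_swap]
      by (elim conjE) (intro conjI)
qed

text \<open>The members of \<A> avoiding \<open>z\<close> and the traces of the members of \<B>
  through \<open>z\<close> cross-intersect on \<open>n - 1\<close> elements. The linear bound with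
  \<open>s = 3\<close> and the chord bound with \<open>s = 2\<close>, which meet at
  \<open>k = c 3\<close>, supply the hypotheses of \<open>small_pair\<close>.\<close>

lemma center_bounds:
  assumes "\<A> \<subseteq> [{1..n}]\<^bsup>a\<^esup>" "\<B> \<subseteq> [{1..n}]\<^bsup>b\<^esup>" "cross_intersecting \<A> \<B>"
    and "3 * e 2 + 4 * e 3 + e 4 + q \<le> real (card \<B>)" "z \<in> {1..n}"
  defines "k \<equiv> real (avoid_count \<A> z)" and "l \<equiv> real (avoid_count \<B> z)"
  shows "k \<le> c 3 \<Longrightarrow> q * c 3 \<le> (l - e 3) * c 3 + e 1 * (c 3 - k)"
    and "c 3 \<le> k \<Longrightarrow> k \<le> c 3 + c 2 \<Longrightarrow> q * c 2 \<le> (l - e 3) * c 2 - (k - c 3) * e 2"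
proof -
  let ?G = "{1..n}"
  note L = assms(1-4)
  have fB: "finite \<B>" using finite_subset[OF assms(2)] by (simp add: finite_imp_finite_nsets)
  obtain \<X> \<Y> where XY: "\<X> \<subseteq> [?G - {z}]\<^bsup>a\<^esup>" "\<Y> \<subseteq> [?G - {z}]\<^bsup>(b - 1)\<^esup>" "cross_intersecting \<X> \<Y>"
    "card \<X> = card {H \<in> \<A>. z \<notin> H}" "card \<Y> = card {H \<in> \<B>. z \<in> H}"
    using cross_intersecting_links[OF L(1-3), of "{}" "{z}" "?G - {z}" a "b - 1"
        "{H \<in> \<A>. z \<notin> H}" "{H \<in> \<B>. z \<in> H}"] by force
  have fS: "finite (?G - {z})" and cS: "card (?G - {z}) = n - 1" using assms(5) by simp_all
  have s3: "n - 1 - 3 = n - 4" by simp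
  have "card {H \<in> \<B>. z \<in> H} + card {H \<in> \<B>. z \<notin> H} = card \<B>"
    using card_split[OF fB] .
  then have Y: "3 * e 2 + 4 * e 3 + e 4 + q - l \<le> real (card \<Y>)" using L(4) XY(5) by (simp add: l_def)
  have kX: "real (card \<X>) = k" using XY(4) by (simp add: k_def)
  show "q * c 3 \<le> (l - e 3) * c 3 + e 1 * (c 3 - k)" if "k \<le> c 3"
  proof -
    have "card \<X> \<le> (n - 4) choose (a - 3)" using that kX by linarith
    then have h: "card \<Y> * ((n - 4) choose (a - 3)) + card \<X> * ((n - 4) choose (b - 1))
        \<le> ((n - 1) choose (b - 1)) * ((n - 4) choose (a - 3))"
      using cross_intersecting_linear_bound[OF fS XY(1-3), of 3, unfolded cS s3] size by simp
    note of_nat_mono[OF h, where ?'a = real, unfolded of_nat_add of_nat_mult kX pascal_b]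
    moreover have "(3 * e 2 + 4 * e 3 + e 4 + q - l) * c 3 \<le> real (card \<Y>) * c 3"
      using Y by (rule mult_right_mono) simp
    ultimately show ?thesis by (simp add: algebra_simps)
  qed
  show "q * c 2 \<le> (l - e 3) * c 2 - (k - c 3) * e 2" if "c 3 \<le> k" "k \<le> c 3 + c 2"
  proof -
    have "real (card \<X>) \<le> real ((n - 3) choose (a - 2))" using that kX pascal_a by simp
    then have h: "card \<X> \<le> (n - 1 - 2) choose (a - 2)" "(n - 4) choose (a - 2 - 1) \<le> card \<X>"
      using that kX by (simp_all add: numeral_3_eq_3 numeral_2_eq_2)
    have s: "b - 1 - 1 = b - 2" "a - 2 - 1 = a - 3" by simp_all
    have "n - 4 = n - 1 - 2 - 1" by simp
    then have h': "card \<X> * ((n - 4) choose (b - 1 - 1)) + card \<Y> * ((n - 4) choose (a - 2))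
        + ((n - 4) choose (b - 1)) * ((n - 4) choose (a - 2))
        \<le> ((n - 1) choose (b - 1)) * ((n - 4) choose (a - 2))
            + ((n - 4) choose (a - 2 - 1)) * ((n - 4) choose (b - 1 - 1))"
      using cross_intersecting_chord_bound[OF fS XY(1-3), of 2 "n - 4", unfolded cS] size h by simp
    note of_nat_mono[OF h', where ?'a = real, unfolded s of_nat_add of_nat_mult kX pascal_b]
    moreover have "(3 * e 2 + 4 * e 3 + e 4 + q - l) * c 2 \<le> real (card \<Y>) * c 2"
      using Y by (rule mult_right_mono) simp
    ultimately show ?thesis by (simp add: algebra_simps)
  qed
qed

text \<open>The thresholds are the upper ends of the gaps. Such a weak bound survives undoing a
  compression, and \<open>good_center_small\<close> then improves it to \<open>c 3\<close> and
  \<open>e 3\<close>.\<close>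

definition good_center :: "nat set set \<Rightarrow> nat set set \<Rightarrow> nat \<Rightarrow> bool" where
  "good_center \<A> \<B> z \<longleftrightarrow> z \<in> {1..n} \<and> real (avoid_count \<A> z) \<le> c 3 + c 2 \<and> real (avoid_count \<B> z)
      \<le> e 3 + e 2"

lemma good_center_small:
  assumes "large \<A> \<B>" "good_center \<A> \<B> z"
  defines "k \<equiv> real (avoid_count \<A> z)" and "l \<equiv> real (avoid_count \<B> z)"
  shows "k \<le> c 3" "l \<le> e 3" "k < c 3 + p" "l < e 3 + q" "k \<le> c 2" "l \<le> e 2"
proof -
  have z: "z \<in> {1..n}" "k \<le> c 3 + c 2" "l \<le> e 3 + e 2"
    using assms(2) by (auto simp: good_center_def k_def l_def)
  interpret sw: large_pair b a n q p by (rule large_pair_swap)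
  have L: "\<A> \<subseteq> [{1..n}]\<^bsup>a\<^esup>" "\<B> \<subseteq> [{1..n}]\<^bsup>b\<^esup>" "cross_intersecting \<A> \<B>"
    "3 * e 2 + 4 * e 3 + e 4 + q \<le> real (card \<B>)"
    using assms(1) unfolding large_def by blast+
  note cb = center_bounds[OF L z(1), folded k_def l_def]
  have L: "\<B> \<subseteq> [{1..n}]\<^bsup>b\<^esup>" "\<A> \<subseteq> [{1..n}]\<^bsup>a\<^esup>" "cross_intersecting \<B> \<A>"
    "3 * c 2 + 4 * c 3 + c 4 + p \<le> real (card \<A>)"
    using large_swap[OF assms(1)] unfolding sw.large_def by blast+
  note cb' = sw.center_bounds[OF L z(1), folded k_def l_def]
  have pos: "0 \<le> k" "0 \<le> l" by (simp_all add: k_def l_def)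
  note small = small_pair[OF pos z(2,3) cb(1) cb(2) cb'(1) cb'(2)]
  show "k \<le> c 3" by (rule small(1))
  show "l \<le> e 3" by (rule small(2))
  show "k < c 3 + p" by (rule small(3))
  show "l < e 3 + q" by (rule small(4))
  show "k \<le> c 2" by (rule small(5))
  show "l \<le> e 2" by (rule small(6))
qed

section \<open>Comparing two candidate centers\<close>

lemma linked_linear:
  fixes \<X> \<Y> :: "nat set set"
  assumes "finite S" "card S = n - 2" "\<X> \<subseteq> [S]\<^bsup>(a - 1)\<^esup>" "\<Y> \<subseteq> [S]\<^bsup>(b - 1)\<^esup>" "cross_intersecting \<X> \<Y>"
    and "real (card \<X>) \<le> c 3"
  shows "real (card \<Y>) * c 3 + real (card \<X>) * e 1 \<le> (e 1 + 2 * e 2 + e 3) * c 3"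
proof -
  have s: "a - 1 - 2 = a - 3" "n - 2 - 2 = n - 4" by simp_all
  have "card \<X> \<le> (n - 4) choose (a - 3)" using assms(6) by linarith
  then have h: "card \<Y> * ((n - 4) choose (a - 3)) + card \<X> * ((n - 4) choose (b - 1))
      \<le> ((n - 2) choose (b - 1)) * ((n - 4) choose (a - 3))"
    using cross_intersecting_linear_bound[OF assms(1,3-5), of 2, unfolded assms(2) s] size by simp
  show ?thesis using of_nat_mono[OF h, where ?'a = real, unfolded of_nat_add of_nat_mult pascal_b] .
qed

lemma linked_chord:
  fixes \<X> \<Y> :: "nat set set"
  assumes "finite S" "card S = n - 2" "\<X> \<subseteq> [S]\<^bsup>(a - 1)\<^esup>" "\<Y> \<subseteq> [S]\<^bsup>(b - 1)\<^esup>" "cross_intersecting \<X> \<Y>"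
    and "c 3 \<le> real (card \<X>)" "real (card \<X>) \<le> c 3 + c 2"
  shows "(real (card \<X>) - c 3) * e 2 + (real (card \<Y>) - e 3) * c 2 \<le> 2 * c 2 * e 2"
proof -
  have s: "a - 1 - 1 = a - 2" "n - 2 - 1 = n - 3" "b - 1 - 1 = b - 2" "a - 2 - 1 = a - 3"
      "n - 3 - 1 = n - 4" by simp_all
  have "real (card \<X>) \<le> real ((n - 3) choose (a - 2))" using assms(7) pascal_a by simp
  then have h: "card \<X> \<le> (n - 3) choose (a - 2)" "(n - 4) choose (a - 3) \<le> card \<X>" using assms(6)
      by simp_all
  have h': "card \<X> * ((n - 4) choose (b - 2)) + card \<Y> * ((n - 4) choose (a - 2))
      + ((n - 4) choose (b - 1)) * ((n - 4) choose (a - 2))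
      \<le> ((n - 2) choose (b - 1)) * ((n - 4) choose (a - 2))
          + ((n - 4) choose (a - 3)) * ((n - 4) choose (b - 2))"
    using cross_intersecting_chord_bound[OF assms(1,3-5), of 1
        "n - 4", unfolded assms(2) s] size h by simp
  show ?thesis using of_nat_mono[OF h', where ?'a = real, unfolded of_nat_add of_nat_mult pascal_b]
    by (simp add: algebra_simps)
qed

lemma linked_links:
  fixes \<X> \<Y> :: "nat set set"
  assumes "finite S" "card S = n - 2" "\<X> \<subseteq> [S]\<^bsup>(a - 1)\<^esup>" "\<Y> \<subseteq> [S]\<^bsup>(b - 1)\<^esup>" "cross_intersecting \<X> \<Y>"
  shows "linked (real (card \<X>)) (real (card \<Y>))"
proof -
  interpret sw: large_pair b a n q p by (rule large_pair_swap)
  have cr: "cross_intersecting \<Y> \<X>" using assms(5) cross_intersecting_commute by blast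
  have 3: "(real (card \<X>) - c 3) * e 2 + (real (card \<Y>) - e 3) * c 2 \<le> 2 * c 2 * e 2"
    if h: "c 3 \<le> real (card \<X>)" "e 3 \<le> real (card \<Y>)"
  proof (cases "real (card \<X>) \<le> c 3 + c 2")
    case True
    then show ?thesis by (rule linked_chord[OF assms h(1)])
  next
    case False
    \<comment> \<open>Cutting \<X> down to \<open>c 3 + c 2\<close> members shows that \<Y> has at
      most \<open>e 3 + e 2\<close>, and so the chord bound with exchanged roles applies to the
      original pair.\<close>
    then have "((n - 4) choose (a - 3)) + ((n - 4) choose (a - 2)) \<le> card \<X>"
      unfolding of_nat_add[symmetric] of_nat_le_iff by simp
    then obtain \<X>' where X': "\<X>' \<subseteq> \<X>" "card \<X>' = ((n - 4) choose (a - 3)) + ((n - 4) choose (a - 2))"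
      by (meson obtain_subset_with_card_n)
    have cX': "real (card \<X>') = c 3 + c 2" using X'(2) by simp
    have sub: "\<X>' \<subseteq> [S]\<^bsup>(a - 1)\<^esup>" using X'(1) assms(3) by (rule subset_trans)
    have cr': "cross_intersecting \<X>' \<Y>"
      using assms(5) X'(1) unfolding cross_intersecting_def by (simp add: subset_iff)
    have "c 2 * e 2 + (real (card \<Y>) - e 3) * c 2 \<le> 2 * c 2 * e 2"
      using linked_chord[OF assms(1,2) sub assms(4) cr'] unfolding cX' by simp
    then have "c 2 * (real (card \<Y>)) \<le> c 2 * (e 3 + e 2)" by (simp add: algebra_simps)
    then have "real (card \<Y>) \<le> e 3 + e 2" by (rule mult_left_le_imp_le) (use c_pos(2) in simp)
    from sw.linked_chord[OF assms(1,2,4,3) cr h(2) this] show ?thesis by (simp add: algebra_simps)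
  qed
  show ?thesis unfolding linked_def
    using 3 linked_linear[OF assms] sw.linked_linear[OF assms(1,2,4,3) cr] by (intro conjI impI)
qed

abbreviation (input) pat :: "nat set set \<Rightarrow> nat set \<Rightarrow> nat set \<Rightarrow> nat set set" where
  "pat \<F> T T' \<equiv> {H \<in> \<F>. T \<subseteq> H \<and> H \<inter> T' = {}}"

text \<open>Members of \<B> containing both \<open>i\<close> and \<open>j\<close> compete with the
  members of \<A> avoiding both. Bounding them by \<open>cross_intersecting_linear_bound\<close>
  with \<open>s = 2\<close> leaves the rest of the size of \<B> to the other three classes.\<close>

lemma pair_size:
  assumes "large \<A> \<B>" "i \<in> {1..n}" "j \<in> {1..n}" "i \<noteq> j" "real (card (pat \<A> {} {i,j})) \<le> c 2"
  shows "c 2 * (2 * e 2 + 2 * e 3 + q) + real (card (pat \<A> {} {i,j})) * e 2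
    \<le> c 2 * (real (card (pat \<B> {i} {j})) + real (card (pat \<B> {j} {i}))
        + real (card (pat \<B> {} {i,j})))"
proof -
  let ?G = "{1..n}"
  have L: "\<A> \<subseteq> [?G]\<^bsup>a\<^esup>" "\<B> \<subseteq> [?G]\<^bsup>b\<^esup>" "cross_intersecting \<A> \<B>"
    "3 * e 2 + 4 * e 3 + e 4 + q \<le> real (card \<B>)" using assms(1) by (auto simp: large_def)
  obtain \<X> \<Y> where XY: "\<X> \<subseteq> [?G - {i,j}]\<^bsup>a\<^esup>" "\<Y> \<subseteq> [?G - {i,j}]\<^bsup>(b - 2)\<^esup>" "cross_intersecting \<X> \<Y>"
    "card \<X> = card (pat \<A> {} {i,j})" "card \<Y> = card (pat \<B> {i,j} {})"
  proof -
    have eqs: "?G - {i,j} = ?G - ({} \<union> {i,j})" "a = a - card {}" "b - 2 = b - card {i,j}"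
      using assms(4) by simp_all
    have fin: "finite {i,j}" by simp
    from cross_intersecting_links[OF L(1-3) finite.emptyI fin eqs refl refl] show ?thesis
      by (elim exE conjE) (rule that)
  qed
  have cS: "card (?G - {i,j}) = n - 2" using assms(2-4) by (simp add: card_Diff_subset)
  have s: "n - 2 - 2 = n - 4" by simp
  have "card \<X> \<le> (n - 4) choose (a - 2)" using assms(5) XY(4) by linarith
  then have h: "card \<Y> * ((n - 4) choose (a - 2)) + card \<X> * ((n - 4) choose (b - 2))
      \<le> ((n - 2) choose (b - 2)) * ((n - 4) choose (a - 2))"
    using cross_intersecting_linear_bound[OF _ XY(1-3), of 2, unfolded cS s] size by simp
  note 1 = of_nat_mono[OF h, where ?'a = real, unfolded of_nat_add of_nat_mult pascal_b]
  define P1 P2 P3 P4 where "P1 = pat \<B> {i,j} {}" and "P2 = pat \<B> {i} {j}"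
    and "P3 = pat \<B> {j} {i}" and "P4 = pat \<B> {} {i,j}"
  have "\<B> = P1 \<union> (P2 \<union> (P3 \<union> P4))" unfolding P1_def P2_def P3_def P4_def by blast
  from arg_cong[OF this, of card] have "card \<B> \<le> card P1 + (card P2 + (card P3 + card P4))"
    using card_Un_le[of P1 "P2 \<union> (P3 \<union> P4)"] card_Un_le[of P2 "P3 \<union> P4"] card_Un_le[of P3 P4]
        by linarith
  then have "card \<B> \<le> card (pat \<B> {i,j} {}) + (card (pat \<B> {i} {j}) + (card (pat \<B> {j} {i})
      + card (pat \<B> {} {i,j})))"
    unfolding P1_def P2_def P3_def P4_def .
  from of_nat_mono[OF this, where ?'a = real, folded XY(5), unfolded of_nat_add] L(4)
  have "3 * e 2 + 4 * e 3 + e 4 + q \<le> real (card \<Y>) + (real (card (pat \<B> {i} {j}))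
      + real (card (pat \<B> {j} {i})) + real (card (pat \<B> {} {i,j})))"
    by linarith
  then have "c 2 * (3 * e 2 + 4 * e 3 + e 4 + q) \<le> c 2 * (real (card \<Y>) +
      (real (card (pat \<B> {i} {j})) + real (card (pat \<B> {j} {i})) + real (card (pat \<B> {} {i,j}))))"
    using c_pos(2) by (intro mult_left_mono) auto
  then show ?thesis using 1 XY(4) by (simp add: algebra_simps)
qed

text \<open>Members of one family containing only \<open>i\<close> and members of the other
  containing only \<open>j\<close> cross-intersect on the remaining \<open>n - 2\<close> elements,
  so their numbers are linked; together with \<open>pair_size\<close> for both families this is the
  situation of \<open>good_before_shift\<close>.\<close>

lemma good_center_of_pair:
  assumes "large \<A> \<B>" "i \<in> {1..n}" "j \<in> {1..n}" "i \<noteq> j"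
    and A0: "real (card (pat \<A> {} {i,j})) \<le> c 2" and B0: "real (card (pat \<B> {} {i,j})) \<le> e 2"
  shows "good_center \<A> \<B> i \<or> good_center \<A> \<B> j"
proof -
  interpret sw: large_pair b a n q p by (rule large_pair_swap)
  let ?G = "{1..n}"
  have L: "\<A> \<subseteq> [?G]\<^bsup>a\<^esup>" "\<B> \<subseteq> [?G]\<^bsup>b\<^esup>" "cross_intersecting \<A> \<B>" using assms(1)
      by (auto simp: large_def)
  have cS: "finite (?G - {i,j})" "card (?G - {i,j}) = n - 2" using assms(2-4)
      by (simp_all add: card_Diff_subset)
  have lk: "linked (real (card (pat \<A> {i'} {j'}))) (real (card (pat \<B> {j'} {i'})))"
    if "i' \<noteq> j'" "{i',j'} = {i,j}" for i' j'
  proof -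
    have eq: "?G - ({i'} \<union> {j'}) = ?G - {i,j}" using that(2) by blast
    obtain \<X> \<Y> where XY: "\<X> \<subseteq> [?G - {i,j}]\<^bsup>(a - 1)\<^esup>" "\<Y> \<subseteq> [?G - {i,j}]\<^bsup>(b - 1)\<^esup>"
        "cross_intersecting \<X> \<Y>"
      "card \<X> = card (pat \<A> {i'} {j'})" "card \<Y> = card (pat \<B> {j'} {i'})"
    proof -
      have eqs: "a - 1 = a - card {i'}" "b - 1 = b - card {j'}" by simp_all
      have fin: "finite {i'}" "finite {j'}" by simp_all
      from cross_intersecting_links[OF L fin eq[symmetric] eqs refl refl] show ?thesis
        by (elim exE conjE) (rule that)
    qed
    from linked_links[OF cS XY(1-3)] show ?thesis unfolding XY(4,5) .
  qed
  have ji: "{j,i} = {i,j}" by auto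
  have sB: "c 2 * (2 * e 2 + 2 * e 3 + q) + real (card (pat \<A> {} {i,j})) * e 2
    \<le> c 2 * (real (card (pat \<B> {i} {j})) + real (card (pat \<B> {j} {i}))
        + real (card (pat \<B> {} {i,j})))"
    by (rule pair_size[OF assms(1-4) A0])
  have sA: "e 2 * (2 * c 2 + 2 * c 3 + p) + real (card (pat \<B> {} {i,j})) * c 2
    \<le> e 2 * (real (card (pat \<A> {i} {j})) + real (card (pat \<A> {j} {i}))
        + real (card (pat \<A> {} {i,j})))"
    by (rule sw.pair_size[OF large_swap[OF assms(1)] assms(2-4) B0])
  have split: "avoid_count \<F> i' \<le> card (pat \<F> {j'} {i'}) + card (pat \<F> {} {i,j})"
    if "{i',j'} = {i,j}" for i' j' \<F>
  proof -
    have "{H \<in> \<F>. i' \<notin> H} = pat \<F> {j'} {i'} \<union> pat \<F> {} {i,j}"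
      unfolding that[symmetric] by blast
    then show ?thesis using card_Un_le[of "pat \<F> {j'} {i'}" "pat \<F> {} {i,j}"] by (simp only:)
  qed
  have alt: "(real (card (pat \<A> {j} {i})) + real (card (pat \<A> {} {i,j})) \<le> c 3 + c 2 \<and>
         real (card (pat \<B> {j} {i})) + real (card (pat \<B> {} {i,j})) \<le> e 3 + e 2) \<or>
        (real (card (pat \<A> {i} {j})) + real (card (pat \<A> {} {i,j})) \<le> c 3 + c 2 \<and>
         real (card (pat \<B> {i} {j})) + real (card (pat \<B> {} {i,j})) \<le> e 3 + e 2)"
    by (rule good_before_shift[OF sA sB of_nat_0_le_iff A0 of_nat_0_le_iff B0
          lk[OF assms(4) refl] lk[OF assms(4)[symmetric] ji]])
  have "real (avoid_count \<F> i) \<le> real (card (pat \<F> {j} {i})) + real (card (pat \<F> {} {i,j}))"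
    "real (avoid_count \<F> j) \<le> real (card (pat \<F> {i} {j})) + real (card (pat \<F> {} {i,j}))" for \<F>
    by (rule of_nat_mono[OF split[OF refl], where ?'a = real, unfolded of_nat_add],
        rule of_nat_mono[OF split[OF ji], where ?'a = real, unfolded of_nat_add])
  note ai = this(1)[of \<A>] this(1)[of \<B>] and aj = this(2)[of \<A>] this(2)[of \<B>]
  from alt show ?thesis
  proof (elim disjE conjE)
    assume "real (card (pat \<A> {j} {i})) + real (card (pat \<A> {} {i,j})) \<le> c 3 + c 2"
      "real (card (pat \<B> {j} {i})) + real (card (pat \<B> {} {i,j})) \<le> e 3 + e 2"
    from order.trans[OF ai(1) this(1)] order.trans[OF ai(2) this(2)] show ?thesis
      using assms(2) unfolding good_center_def by blast
  next
    assume "real (card (pat \<A> {i} {j})) + real (card (pat \<A> {} {i,j})) \<le> c 3 + c 2"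
      "real (card (pat \<B> {i} {j})) + real (card (pat \<B> {} {i,j})) \<le> e 3 + e 2"
    from order.trans[OF aj(1) this(1)] order.trans[OF aj(2) this(2)] show ?thesis
      using assms(3) unfolding good_center_def by blast
  qed
qed

end

section \<open>Tracing a center back through a compression\<close>

lemma avoid_count_eq_0:
  assumes "\<And>H. H \<in> \<F> \<Longrightarrow> z \<in> H"
  shows "avoid_count \<F> z = 0"
proof -
  have "{H \<in> \<F>. z \<notin> H} = {}" using assms by auto
  then show ?thesis by (simp only: card.empty)
qed

lemma avoid_count_compress:
  assumes "finite \<F>" "z \<notin> U"
  shows "avoid_count \<F> z \<le> avoid_count (compress U V \<F>) z"
proof (rule card_inj_on_le[of "exchange U V \<F>"])
  show "inj_on (exchange U V \<F>) {H \<in> \<F>. z \<notin> H}"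
    using inj_on_exchange by (rule inj_on_subset) blast
  show "exchange U V \<F> ` {H \<in> \<F>. z \<notin> H} \<subseteq> {H \<in> compress U V \<F>. z \<notin> H}"
    using assms(2) by (auto simp: exchange_def)
  show "finite {H \<in> compress U V \<F>. z \<notin> H}" using assms(1) by simp
qed

lemma avoid_count_compress_moved:
  assumes "finite \<F>"
  shows "avoid_count \<F> z \<le> avoid_count (compress U V \<F>) z + card {H \<in> \<F>. V \<subseteq> H \<and> U \<inter> H = {}}"
proof -
  have "{H \<in> \<F>. z \<notin> H} \<subseteq> {H \<in> compress U V \<F>. z \<notin> H} \<union> {H \<in> \<F>. V \<subseteq> H \<and> U \<inter> H = {}}"
  proof
    fix H assume H: "H \<in> {H \<in> \<F>. z \<notin> H}"
    show "H \<in> {H \<in> compress U V \<F>. z \<notin> H} \<union> {H \<in> \<F>. V \<subseteq> H \<and> U \<inter> H = {}}"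
    proof (cases "V \<subseteq> H \<and> U \<inter> H = {}")
      case False
      then have "exchange U V \<F> H = H" by (auto simp: exchange_def)
      then have "H \<in> compress U V \<F>" using H by (metis (no_types, lifting) image_eqI mem_Collect_eq)
      then show ?thesis using H by simp
    qed (use H in simp)
  qed
  then have "avoid_count \<F> z \<le> card ({H \<in> compress U V \<F>. z \<notin> H} \<union> {H \<in> \<F>. V \<subseteq> H \<and> U \<inter> H = {}})"
    using assms by (intro card_mono) auto
  then show ?thesis using card_Un_le le_trans by blast
qed

lemma card_exchangeable:
  assumes "finite S" "\<F> \<subseteq> [S]\<^bsup>k\<^esup>" "exchange_pair S U V" "2 \<le> card U" "2 \<le> k"
  shows "card {H \<in> \<F>. V \<subseteq> H \<and> U \<inter> H = {}} \<le> (card S - 4) choose (k - 2)"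
proof -
  have UV: "U \<subseteq> S" "V \<subseteq> S" "U \<inter> V = {}" "card U = card V" using assms(3)
      by (auto simp: exchange_pair_def)
  obtain U' where U': "U' \<subseteq> U" "card U' = 2" using assms(4) by (meson obtain_subset_with_card_n)
  obtain V' where V': "V' \<subseteq> V" "card V' = 2" using assms(4) UV(4) by (metis obtain_subset_with_card_n)
  have "{H \<in> \<F>. V \<subseteq> H \<and> U \<inter> H = {}} \<subseteq> {H \<in> [S]\<^bsup>k\<^esup>. V' \<subseteq> H \<and> H \<inter> U' = {}}"
    using assms(2) U' V' by blast
  then have "card {H \<in> \<F>. V \<subseteq> H \<and> U \<inter> H = {}} \<le> card {H \<in> [S]\<^bsup>k\<^esup>. V' \<subseteq> H \<and> H \<inter> U' = {}}"
    using assms(1) by (intro card_mono) (auto simp: finite_imp_finite_nsets)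
  also have "\<dots> = (card S - card V' - card U') choose (k - card V')"
    using U' V' UV assms by (intro card_nsets_containing_avoiding) auto
  finally show ?thesis using U' V' by simp
qed

context large_pair
begin

text \<open>Otherwise a subfamily with exactly \<open>c 3 + c 2\<close> members avoiding
  \<open>z\<close> lies at the end of the chord, where \<B> having no member off \<open>z\<close>
  forces \<open>q \<le> - e 3 - e 2\<close>, against \<open>- e 3 < q\<close>.\<close>

lemma center_of_concentrated:
  assumes "\<A> \<subseteq> [{1..n}]\<^bsup>a\<^esup>" "\<B> \<subseteq> [{1..n}]\<^bsup>b\<^esup>" "cross_intersecting \<A> \<B>"
    and "3 * e 2 + 4 * e 3 + e 4 + q \<le> real (card \<B>)" "z \<in> {1..n}" "\<And>H. H \<in> \<B> \<Longrightarrow> z \<in> H"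
  shows "real (avoid_count \<A> z) \<le> c 3 + c 2"
proof (rule ccontr)
  assume not: "\<not> ?thesis"
  have "((n - 4) choose (a - 3)) + ((n - 4) choose (a - 2)) \<le> avoid_count \<A> z"
    using not unfolding of_nat_add[symmetric] of_nat_le_iff by simp
  then obtain \<A>' where A': "\<A>' \<subseteq> {H \<in> \<A>. z \<notin> H}"
    "card \<A>' = ((n - 4) choose (a - 3)) + ((n - 4) choose (a - 2))"
        by (meson obtain_subset_with_card_n)
  have sub: "\<A>' \<subseteq> [{1..n}]\<^bsup>a\<^esup>" using A'(1) assms(1) by auto
  have cr: "cross_intersecting \<A>' \<B>" using A'(1) assms(3) unfolding cross_intersecting_def
      by (simp add: subset_iff)
  have "{H \<in> \<A>'. z \<notin> H} = \<A>'" using A'(1) by auto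
  then have cnt: "real (avoid_count \<A>' z) = c 3 + c 2" "real (avoid_count \<B> z) = 0"
    using A'(2) avoid_count_eq_0[OF assms(6)] by simp_all
  have "q * c 2 \<le> (0 - e 3) * c 2 - (c 3 + c 2 - c 3) * e 2"
    using center_bounds(2)[OF sub assms(2) cr assms(4,5)] unfolding cnt by simp
  then have "(q + e 3 + e 2) * c 2 \<le> 0" by (simp add: algebra_simps)
  then have "q + e 3 + e 2 \<le> 0" using c_pos(2) by (simp add: mult_le_0_iff)
  then show False using q_bounds e_pos by linarith
qed

text \<open>By the chain property \<A> contains all sets through 1, and since
  \<open>a + b < n\<close> one of them would be disjoint from a member of \<B> missing 1.\<close>

lemma concentrated_if_not_subset_star:
  assumes "\<A> \<subseteq> [{1..n}]\<^bsup>a\<^esup>" "\<B> \<subseteq> [{1..n}]\<^bsup>b\<^esup>" "cross_intersecting \<A> \<B>"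
    and st: "\<And>U V. exchange_pair {1..n} U V \<Longrightarrow> compressed U V \<A>"
    and "\<not> (\<forall>H\<in>\<A>. 1 \<in> H)" "F \<in> \<B>"
  shows "1 \<in> F"
proof (rule ccontr)
  assume F: "1 \<notin> F"
  have "(\<forall>H\<in>\<A>. {1} \<subseteq> H) \<or> {H \<in> [{1..n}]\<^bsup>a\<^esup>. {1} \<subseteq> H} \<subseteq> \<A>"
    using size by (intro compressed_initial[OF _ assms(1) st]) auto
  then have full: "{H \<in> [{1..n}]\<^bsup>a\<^esup>. 1 \<in> H} \<subseteq> \<A>" using assms(5) by auto
  note FS = nsetsD[OF subsetD[OF assms(2,6)]]
  have "card ({1..n} - insert 1 F) = n - (b + 1)"
    using FS F size by (subst card_Diff_subset) auto
  then have "a - 1 \<le> card ({1..n} - insert 1 F)" using size by simp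
  then obtain Z where Z: "Z \<subseteq> {1..n} - insert 1 F" "card Z = a - 1"
      by (meson obtain_subset_with_card_n)
  have fZ: "finite Z" using Z(1) by (rule finite_subset) simp
  have "card (insert 1 Z) = a" using Z fZ size by (subst card_insert_disjoint) auto
  then have "insert 1 Z \<in> \<A>" using Z(1) fZ size by (intro subsetD[OF full]) (auto simp: nsets_def)
  then have "insert 1 Z \<inter> F \<noteq> {}" using assms(3,6) unfolding cross_intersecting_def by blast
  then show False using Z(1) F by blast
qed

text \<open>If \<open>z \<notin> U\<close>, the compression does not lower the numbers of sets
  avoiding \<open>z\<close>. If \<open>U\<close> has at least two elements, at most
  \<open>c 2\<close> and \<open>e 2\<close> sets move, and the counts after the compression are at
  most \<open>c 3\<close> and \<open>e 3\<close>. If \<open>U = {z}\<close> and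
  \<open>V = {j}\<close>, sets avoiding both elements stay in place, so there are at most
  \<open>c 2\<close> and \<open>e 2\<close> of them, and \<open>z\<close> or \<open>j\<close> was a
  good center before.\<close>

lemma good_center_before_exchange:
  assumes L: "large \<A> \<B>" and UV: "exchange_pair {1..n} U V"
    and L': "large (compress U V \<A>) (compress U V \<B>)"
    and good: "good_center (compress U V \<A>) (compress U V \<B>) z"
  shows "\<exists>z. good_center \<A> \<B> z"
proof -
  have fin: "finite \<A>" "finite \<B>" using large_finite[OF L] by auto
  have sub: "\<A> \<subseteq> [{1..n}]\<^bsup>a\<^esup>" "\<B> \<subseteq> [{1..n}]\<^bsup>b\<^esup>" using L by (auto simp: large_def)
  have z: "z \<in> {1..n}" using good by (simp add: good_center_def)
  note small = good_center_small[OF L' good]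
  have fU: "finite U" "U \<noteq> {}" "card U = card V" "U \<subseteq> {1..n}" "V \<subseteq> {1..n}" "U \<inter> V = {}"
    using UV by (auto simp: exchange_pair_def)
  have "1 \<le> card U" using card_gt_0_iff[of U] fU(1,2) by linarith
  then consider "z \<notin> U" | "z \<in> U" "2 \<le> card U" | "z \<in> U" "card U = 1" by linarith
  then show ?thesis
  proof cases
    case 1
    have "real (avoid_count \<A> z) \<le> c 3 + c 2" "real (avoid_count \<B> z) \<le> e 3 + e 2"
      using of_nat_mono[OF avoid_count_compress[OF fin(1) 1, of V], where ?'a = real]
        of_nat_mono[OF avoid_count_compress[OF fin(2) 1, of V], where ?'a = real]
        good unfolding good_center_def by linarith+
    then show ?thesis using z unfolding good_center_def by blast
  next
    case 2
    have mA: "card {H \<in> \<A>. V \<subseteq> H \<and> U \<inter> H = {}} \<le> (n - 4) choose (a - 2)"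
      using card_exchangeable[OF _ sub(1) UV 2(2)] size by simp
    have mB: "card {H \<in> \<B>. V \<subseteq> H \<and> U \<inter> H = {}} \<le> (n - 4) choose (b - 2)"
      using card_exchangeable[OF _ sub(2) UV 2(2)] size by simp
    have "real (avoid_count \<A> z) \<le> c 3 + c 2" "real (avoid_count \<B> z) \<le> e 3 + e 2"
      using of_nat_mono[OF avoid_count_compress_moved[OF fin(1), of z U V], where ?'a
          = real, unfolded of_nat_add]
        of_nat_mono[OF avoid_count_compress_moved[OF fin(2), of z U V], where ?'a
            = real, unfolded of_nat_add]
        of_nat_mono[OF mA, where ?'a = real] of_nat_mono[OF mB, where ?'a = real] small(1,2)
            by linarith+
    then show ?thesis using z unfolding good_center_def by blast
  next
    case 3
    then have U: "U = {z}" using card_1_singletonE by blast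
    have "card V = 1" using 3 fU by simp
    then obtain j where V: "V = {j}" using card_1_singletonE by blast
    have j: "j \<in> {1..n}" "z \<noteq> j" using fU U V by auto
    have le: "card {H \<in> \<F>. {} \<subseteq> H \<and> H \<inter> {z,j} = {}} \<le> avoid_count (compress U V \<F>) z"
      if "finite \<F>" for \<F>
    proof (rule card_mono)
      show "finite {H \<in> compress U V \<F>. z \<notin> H}" using that by simp
      show "{H \<in> \<F>. {} \<subseteq> H \<and> H \<inter> {z,j} = {}} \<subseteq> {H \<in> compress U V \<F>. z \<notin> H}"
      proof
        fix H assume H: "H \<in> {H \<in> \<F>. {} \<subseteq> H \<and> H \<inter> {z,j} = {}}"
        then have "exchange U V \<F> H = H" by (auto simp: exchange_def V)
        then have "H \<in> compress U V \<F>" using H by (metis (no_types, lifting) image_eqI mem_Collect_eq)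
        then show "H \<in> {H \<in> compress U V \<F>. z \<notin> H}" using H by simp
      qed
    qed
    have "real (card {H \<in> \<A>. {} \<subseteq> H \<and> H \<inter> {z,j} = {}}) \<le> c 2"
      using of_nat_mono[OF le[OF fin(1)], where ?'a = real] small(5) by linarith
    moreover have "real (card {H \<in> \<B>. {} \<subseteq> H \<and> H \<inter> {z,j} = {}}) \<le> e 2"
      using of_nat_mono[OF le[OF fin(2)], where ?'a = real] small(6) by linarith
    ultimately show ?thesis using good_center_of_pair[OF L z j] by blast
  qed
qed

lemma large_compress:
  assumes "large \<A> \<B>" "compress U V \<A> \<subseteq> [{1..n}]\<^bsup>a\<^esup>" "compress U V \<B> \<subseteq> [{1..n}]\<^bsup>b\<^esup>"
    "cross_intersecting (compress U V \<A>) (compress U V \<B>)"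
  shows "large (compress U V \<A>) (compress U V \<B>)"
  using assms unfolding large_def card_compress by (elim conjE) (intro conjI)

lemma exists_good_center:
  assumes "large \<A> \<B>"
  shows "\<exists>z. good_center \<A> \<B> z"
proof -
  have fin: "finite {1..n}" by simp
  have L: "\<A> \<subseteq> [{1..n}]\<^bsup>a\<^esup>" "\<B> \<subseteq> [{1..n}]\<^bsup>b\<^esup>" "cross_intersecting \<A> \<B>"
    using assms unfolding large_def by blast+
  have "large \<A> \<B> \<longrightarrow> (\<exists>z. good_center \<A> \<B> z)"
    using fin L
  proof (induction rule: compression_induct)
    case (compressed \<A> \<B>)
    interpret sw: large_pair b a n q p by (rule large_pair_swap)
    show ?case
    proof
      assume L: "large \<A> \<B>"
      have big: "3 * c 2 + 4 * c 3 + c 4 + p \<le> real (card \<A>)" "3 * e 2 + 4 * e 3 + e 4 + q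
          \<le> real (card \<B>)"
        using L unfolding large_def by blast+
      have cr: "cross_intersecting \<B> \<A>" using compressed(3) cross_intersecting_commute by blast
      have one: "1 \<in> {1..n}" using size by simp
      have stA: "\<And>U V. exchange_pair {1..n} U V \<Longrightarrow> compressed U V \<A>"
        and stB: "\<And>U V. exchange_pair {1..n} U V \<Longrightarrow> compressed U V \<B>" using compressed(4) by auto
      consider "\<forall>H\<in>\<A>. 1 \<in> H" "\<forall>H\<in>\<B>. 1 \<in> H" | "\<not> (\<forall>H\<in>\<A>. 1 \<in> H)" | "\<not> (\<forall>H\<in>\<B>. 1 \<in> H)" by blast
      then have "good_center \<A> \<B> 1"
      proof cases
        case 1
        have "avoid_count \<A> 1 = 0" "avoid_count \<B> 1 = 0"
          using 1 by (intro avoid_count_eq_0; blast)+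
        then show ?thesis unfolding good_center_def using one by (simp del: One_nat_def)
      next
        case 2
        have star: "1 \<in> H" if "H \<in> \<B>" for H
          using concentrated_if_not_subset_star[OF compressed(1-3) stA 2 that] .
        have "avoid_count \<B> 1 = 0" by (rule avoid_count_eq_0[OF star])
        then show ?thesis
          using center_of_concentrated[OF compressed(1-3) big(2) one star] one
          unfolding good_center_def by (simp del: One_nat_def)
      next
        case 3
        have star: "1 \<in> H" if "H \<in> \<A>" for H
          using sw.concentrated_if_not_subset_star[OF compressed(2,1) cr stB 3 that] .
        have "avoid_count \<A> 1 = 0" by (rule avoid_count_eq_0[OF star])
        then show ?thesis
          using sw.center_of_concentrated[OF compressed(2,1) cr big(1) one star] one
          unfolding good_center_def by (simp del: One_nat_def)
      qed
      then show "\<exists>z. good_center \<A> \<B> z" ..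
    qed
  next
    case (step \<A> \<B> U V)
    show ?case
    proof
      assume L: "large \<A> \<B>"
      have L': "large (compress U V \<A>) (compress U V \<B>)" by (rule large_compress[OF L step(6-8)])
      then obtain z where "good_center (compress U V \<A>) (compress U V \<B>) z" using step(9) by blast
      then show "\<exists>z. good_center \<A> \<B> z" by (rule good_center_before_exchange[OF L step(4) L'])
    qed
  qed
  then show ?thesis using assms by blast
qed

text \<open>A member through another element \<open>x\<close> contains both \<open>x\<close> and
  \<open>z\<close> or avoids \<open>z\<close>, so \<open>x\<close> has degree at most C(n-2, a-2)
  plus the number of members avoiding \<open>z\<close>. That number is below \<open>c 3 + p\<close>
  and at most \<open>c 2\<close>, which makes the degree of \<open>z\<close> larger.\<close>

lemma max_degree_element_unique:
  assumes "large \<A> \<B>" "good_center \<A> \<B> z" "max_degree_element {1..n} \<A> x"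
  shows "x = z"
proof (rule ccontr)
  assume "x \<noteq> z"
  note small = good_center_small[OF assms(1,2)]
  have fin: "finite \<A>" using large_finite[OF assms(1)] by auto
  have sub: "\<A> \<subseteq> [{1..n}]\<^bsup>a\<^esup>" and big: "3 * c 2 + 4 * c 3 + c 4 + p \<le> real (card \<A>)"
    using assms(1) unfolding large_def by blast+
  have z: "z \<in> {1..n}" using assms(2) by (simp add: good_center_def)
  have x: "x \<in> {1..n}" "family_degree \<A> z \<le> family_degree \<A> x"
    using assms(3) z by (auto simp: max_degree_element_def)
  have dz: "family_degree \<A> z + avoid_count \<A> z = card \<A>"
    unfolding family_degree_def by (rule card_split[OF fin])
  have "{H \<in> \<A>. x \<in> H} \<subseteq> {H \<in> [{1..n}]\<^bsup>a\<^esup>. {x,z} \<subseteq> H} \<union> {H \<in> \<A>. z \<notin> H}" using sub by auto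
  then have "family_degree \<A> x \<le> card ({H \<in> [{1..n}]\<^bsup>a\<^esup>. {x,z} \<subseteq> H} \<union> {H \<in> \<A>. z \<notin> H})"
    unfolding family_degree_def using fin by (intro card_mono) (auto simp: finite_imp_finite_nsets)
  also have "\<dots> \<le> card {H \<in> [{1..n}]\<^bsup>a\<^esup>. {x,z} \<subseteq> H} + avoid_count \<A> z" by (rule card_Un_le)
  also have "card {H \<in> [{1..n}]\<^bsup>a\<^esup>. {x,z} \<subseteq> H} = (n - 2) choose (a - 2)"
    using card_nsets_containing[of "{1..n}" "{x,z}" a] x z \<open>x \<noteq> z\<close> size by (simp add: numeral_2_eq_2)
  finally have dx: "family_degree \<A> x \<le> ((n - 2) choose (a - 2)) + avoid_count \<A> z" .
  have "card \<A> \<le> ((n - 2) choose (a - 2)) + avoid_count \<A> z + avoid_count \<A> z" using dx dz x(2)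
      by linarith
  from of_nat_mono[OF this, where ?'a = real, unfolded of_nat_add pascal_a]
  show False using big small(1,3,5) c_pos by linarith
qed

end

section \<open>Shadows of families with a small common intersection\<close>

lemma binomial_increment_mono:
  assumes "x \<le> y" "1 \<le> r"
  shows "((y - 1) choose r) + (x choose r) \<le> (y choose r) + ((x - 1) choose r)"
proof (cases "x = 0")
  case False
  obtain x' where "x = Suc x'" using False by (cases x) auto
  moreover obtain y' where "y = Suc y'" using False assms(1) by (cases y) auto
  moreover obtain r' where "r = Suc r'" using assms(2) by (cases r) auto
  ultimately show ?thesis using binomial_left_mono[of x' y' r'] assms by simp
next
  case True
  then show ?thesis using assms binomial_left_mono[of "y - 1" y r] by simp
qed

text \<open>If \<open>D + d \<le> N\<close>, then
  \<open>(N choose r) + ((N - D - d) choose r)\<close> minus the first two summands counts the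
  r-subsets of an N-set that meet two disjoint sets of sizes \<open>D\<close> and \<open>d\<close>.
  Those through one fixed element of each already number \<open>(N - 2) choose (r - 2)\<close>. The
  induction also covers truncated subtraction.\<close>

lemma binomial_second_difference:
  assumes "1 \<le> D" "1 \<le> d" "2 \<le> N" "2 \<le> r"
  shows "((N - D) choose r) + ((N - d) choose r) + ((N - 2) choose (r - 2))
    \<le> (N choose r) + ((N - D - d) choose r)"
  using assms(2)
proof (induction d rule: dec_induct)
  case base
  obtain M s where M: "N = Suc (Suc M)" "r = Suc (Suc s)"
    using assms(3,4) by (metis add_2_eq_Suc le_Suc_ex)
  have "((N - D) choose r) \<le> ((N - D - 1) choose r) + (M choose Suc s)"
  proof (cases "D < N")
    case True
    then have "N - D = Suc (N - D - 1)" by simp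
    from arg_cong[OF this, of "\<lambda>x. x choose r"]
    have "((N - D) choose r) = ((N - D - 1) choose r) + ((N - D - 1) choose Suc s)"
      unfolding M(2) binomial_Suc_Suc by (simp only: add.commute)
    moreover have "(N - D - 1) choose Suc s \<le> M choose Suc s"
      using assms(1) M by (intro binomial_left_mono) simp
    ultimately show ?thesis by simp
  qed (use assms in simp)
  then show ?case unfolding M by simp
next
  case (step d)
  have "((N - d - 1) choose r) + ((N - D - d) choose r) \<le> ((N - d) choose r)
      + ((N - D - d - 1) choose r)"
    using assms by (intro binomial_increment_mono) auto
  then show ?case using step.IH by simp
qed

text \<open>This is the r-shadow of the family of complements \<open>S - X\<close>: the r-sets that
  every family cross-intersecting with \<X> has to omit.\<close>

definition disjoint_shadow :: "'a set \<Rightarrow> nat \<Rightarrow> 'a set set \<Rightarrow> 'a set set" where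
  "disjoint_shadow S r \<X> = {H \<in> [S]\<^bsup>r\<^esup>. \<exists>X\<in>\<X>. X \<inter> H = {}}"

lemma card_containing_outside:
  assumes "finite S" "A \<in> [S]\<^bsup>p\<^esup>" "T \<subseteq> S - A" "card T \<le> r"
  shows "card {H \<in> [S - A]\<^bsup>r\<^esup>. T \<subseteq> H} = (card S - p - card T) choose (r - card T)"
  using card_nsets_containing[of "S - A" T r] assms nsetsD[OF assms(2)]
      by (simp add: card_Diff_subset)

text \<open>The parameter \<open>\<H>\<close> is a family of \<open>r\<close>-sets disjoint from members of \<open>\<M>\<close>, obtained by adding the
  members of \<open>\<M>\<close> one at a time, each removing at least one element from the intersection.\<close>

definition separating_chain :: "'a set \<Rightarrow> nat \<Rightarrow> nat \<Rightarrow> 'a set set \<Rightarrow> 'a set set \<Rightarrow> bool" where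
  "separating_chain S p r \<M> \<H> \<longleftrightarrow>
     \<M> \<subseteq> [S]\<^bsup>p\<^esup> \<and> finite \<M> \<and> \<M> \<noteq> {} \<and> \<H> \<subseteq> disjoint_shadow S r \<M> \<and>
     (card \<M> = 1 \<longrightarrow> card (\<Inter>\<M>) = p) \<and> (card \<M> \<noteq> 1 \<longrightarrow> card (\<Inter>\<M>) < p) \<and>
     2 * ((card S - p) choose r) + (card \<M> - 2) * ((card S - p - 2) choose (r - 2))
       \<le> card \<H> + ((card S - p - (p - card (\<Inter>\<M>))) choose r) \<and>
     (\<forall>A\<in>[S]\<^bsup>p\<^esup>. A \<notin> \<M> \<longrightarrow>
        (card S - p - 2) choose (r - 2) \<le> card {H \<in> [S - A]\<^bsup>r\<^esup>. H \<notin> \<H>})"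

text \<open>An r-set through a common element of \<M> meets every member of \<M>, so it cannot
  belong to \<H>.\<close>

lemma separating_chain_outside:
  assumes "finite S" "\<H> \<subseteq> disjoint_shadow S r \<M>" "A \<in> [S]\<^bsup>p\<^esup>" "\<not> \<Inter>\<M> \<subseteq> A" "\<M> \<subseteq> [S]\<^bsup>p\<^esup>" "\<M> \<noteq> {}" "1 \<le> r"
  shows "(card S - p - 1) choose (r - 1) \<le> card {H \<in> [S - A]\<^bsup>r\<^esup>. H \<notin> \<H>}"
proof -
  obtain w where w: "w \<in> \<Inter>\<M>" "w \<notin> A" using assms(4) by blast
  obtain M where M: "M \<in> \<M>" using assms(6) by blast
  have "w \<in> S" using nsetsD(1)[OF subsetD[OF assms(5) M]] w M by blast
  have "{H \<in> [S - A]\<^bsup>r\<^esup>. {w} \<subseteq> H} \<subseteq> {H \<in> [S - A]\<^bsup>r\<^esup>. H \<notin> \<H>}"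
  proof
    fix H assume H: "H \<in> {H \<in> [S - A]\<^bsup>r\<^esup>. {w} \<subseteq> H}"
    have "H \<notin> disjoint_shadow S r \<M>" using H w(1) unfolding disjoint_shadow_def by blast
    then show "H \<in> {H \<in> [S - A]\<^bsup>r\<^esup>. H \<notin> \<H>}" using H assms(2) by blast
  qed
  then have "card {H \<in> [S - A]\<^bsup>r\<^esup>. {w} \<subseteq> H} \<le> card {H \<in> [S - A]\<^bsup>r\<^esup>. H \<notin> \<H>}"
    using assms(1) by (intro card_mono) (auto simp: finite_imp_finite_nsets)
  then show ?thesis
    using card_containing_outside[OF assms(1,3), of "{w}" r] w \<open>w \<in> S\<close> assms(7) by simp
qed

lemma binomial_drop_le:
  assumes "2 \<le> r" "2 \<le> N"
  shows "(N - 2) choose (r - 2) \<le> (N - 1) choose (r - 1)"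
proof -
  obtain M s where "N = Suc (Suc M)" "r = Suc (Suc s)"
    using assms by (metis add_2_eq_Suc le_Suc_ex)
  then show ?thesis by simp
qed

lemma separating_chain_single:
  assumes "finite S" "M \<in> [S]\<^bsup>p\<^esup>" "2 \<le> r" "p + 2 \<le> card S"
  shows "separating_chain S p r {M} {H \<in> [S]\<^bsup>r\<^esup>. H \<inter> M = {}}"
proof -
  have M: "M \<subseteq> S" "finite M" "card M = p" using nsetsD[OF assms(2)] by auto
  let ?H = "{H \<in> [S]\<^bsup>r\<^esup>. H \<inter> M = {}}"
  have sh: "?H \<subseteq> disjoint_shadow S r {M}" by (auto simp: disjoint_shadow_def)
  have cH: "card ?H = (card S - p) choose r"
      using card_nsets_avoiding[OF assms(1) M(1), of r] M(3) by simp
  have "(card S - p - 2) choose (r - 2) \<le> card {H \<in> [S - A]\<^bsup>r\<^esup>. H \<notin> ?H}" if A: "A \<in> [S]\<^bsup>p\<^esup>"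
      "A \<noteq> M" for A
  proof -
    have "\<not> M \<subseteq> A" using nsetsD[OF A(1)] M A(2) by (metis card_subset_eq)
    then have "(card S - p - 1) choose (r - 1) \<le> card {H \<in> [S - A]\<^bsup>r\<^esup>. H \<notin> ?H}"
      using assms by (intro separating_chain_outside[OF assms(1) sh A(1)]) auto
    then show ?thesis using binomial_drop_le[of r "card S - p"] assms(3,4) by linarith
  qed
  then show ?thesis using assms(2) M sh cH unfolding separating_chain_def by simp
qed

lemma separating_chain_insert:
  assumes ch: "separating_chain S p r \<M> \<H>" and "finite S" "M \<in> [S]\<^bsup>p\<^esup>" "\<not> \<Inter>\<M> \<subseteq> M" "2 \<le> r" "p + 2
      \<le> card S"
  shows "separating_chain S p r (insert M \<M>) (\<H> \<union> {H \<in> [S]\<^bsup>r\<^esup>. H \<inter> M = {} \<and> H \<inter> \<Inter>\<M> \<noteq> {}})"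
proof -
  define N where "N = card S - p"
  define J where "J = \<Inter>\<M>"
  define \<N> where "\<N> = {H \<in> [S]\<^bsup>r\<^esup>. H \<inter> M = {} \<and> H \<inter> J \<noteq> {}}"
  define F where "F = (N - 2) choose (r - 2)"
  have c: "\<M> \<subseteq> [S]\<^bsup>p\<^esup>" "finite \<M>" "\<M> \<noteq> {}" "\<H> \<subseteq> disjoint_shadow S r \<M>"
    "card \<M> = 1 \<Longrightarrow> card J = p" "card \<M> \<noteq> 1 \<Longrightarrow> card J < p"
    "2 * (N choose r) + (card \<M> - 2) * F \<le> card \<H> + ((N - (p - card J)) choose r)"
    "\<And>A. A \<in> [S]\<^bsup>p\<^esup> \<Longrightarrow> A \<notin> \<M> \<Longrightarrow> F \<le> card {H \<in> [S - A]\<^bsup>r\<^esup>. H \<notin> \<H>}"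
    using ch unfolding separating_chain_def N_def[symmetric] J_def[symmetric] F_def[symmetric]
        by blast+
  have M: "M \<subseteq> S" "finite M" "card M = p" using nsetsD[OF assms(3)] by auto
  obtain M0 where M0: "M0 \<in> \<M>" using c(3) by blast
  have J: "J \<subseteq> S" "finite J" "J \<subseteq> M0"
  proof -
    show "J \<subseteq> M0" using M0 by (auto simp: J_def)
    with nsetsD(1)[OF subsetD[OF c(1) M0]] show "J \<subseteq> S" by blast
    then show "finite J" using assms(2) by (rule finite_subset)
  qed
  define \<delta> where "\<delta> = card (J - M)"
  have d1: "1 \<le> \<delta>" using assms(4) J(2) unfolding \<delta>_def J_def[symmetric]
      by (simp add: Suc_le_eq card_gt_0_iff)
  have JM: "card (J \<inter> M) + \<delta> = card J"
    unfolding \<delta>_def using card_Diff_subset_Int[of J M] J(2) card_mono[of J "J \<inter> M"] by simp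
  have MnM: "M \<notin> \<M>" using assms(4) by blast
  have cM: "card (insert M \<M>) = Suc (card \<M>)" "1 \<le> card \<M>" using c(2,3) MnM
      by (auto simp: Suc_le_eq card_gt_0_iff)
  have Jp: "card J \<le> p" using c(5,6) by fastforce
  have hitJ: "H \<inter> J = {}" if H: "H \<in> \<H>" for H
  proof -
    obtain X where "X \<in> \<M>" "X \<inter> H = {}" using subsetD[OF c(4) H] unfolding disjoint_shadow_def
        by blast
    then show ?thesis unfolding J_def by blast
  qed
  have finr: "finite ([S]\<^bsup>r\<^esup>)" using assms(2) by (simp add: finite_imp_finite_nsets)
  have Hs: "\<H> \<subseteq> [S]\<^bsup>r\<^esup>" using c(4) unfolding disjoint_shadow_def by blast
  have finH: "finite \<H>" "finite \<N>" using finite_subset[OF Hs finr] finr by (simp_all add: \<N>_def)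
  have "\<H> \<inter> \<N> = {}" using hitJ unfolding \<N>_def by blast
  then have cU: "card (\<H> \<union> \<N>) = card \<H> + card \<N>" using finH by (simp add: card_Un_disjoint)
  have cN: "card \<N> + ((N - \<delta>) choose r) = N choose r"
  proof -
    have "{H \<in> [S]\<^bsup>r\<^esup>. H \<inter> M = {}} = \<N> \<union> {H \<in> [S]\<^bsup>r\<^esup>. H \<inter> (M \<union> J) = {}}" unfolding \<N>_def by blast
    moreover have "\<N> \<inter> {H \<in> [S]\<^bsup>r\<^esup>. H \<inter> (M \<union> J) = {}} = {}" unfolding \<N>_def by blast
    moreover have "card {H \<in> [S]\<^bsup>r\<^esup>. H \<inter> M = {}} = N choose r"
      using card_nsets_avoiding[OF assms(2) M(1), of r] M(3) by (simp add: N_def)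
    moreover have "card {H \<in> [S]\<^bsup>r\<^esup>. H \<inter> (M \<union> J) = {}} = (N - \<delta>) choose r"
    proof -
      have "M \<union> J = M \<union> (J - M)" by blast
      also have "card \<dots> = p + \<delta>" using M J(2) unfolding \<delta>_def by (subst card_Un_disjoint) auto
      finally have "card (M \<union> J) = p + \<delta>" .
      then show ?thesis using card_nsets_avoiding[OF assms(2), of "M \<union> J" r] M J by (simp add: N_def)
    qed
    ultimately show ?thesis using finH finr card_Un_disjoint[of \<N> "{H \<in> [S]\<^bsup>r\<^esup>. H \<inter> (M \<union> J)
        = {}}"] by simp
  qed
  have count: "2 * (N choose r) + (card (insert M \<M>) - 2) * F \<le> card (\<H> \<union> \<N>)
      + ((N - (p - card (J \<inter> M))) choose r)"
  proof (cases "card \<M> = 1")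
    case True
    have "p - card (J \<inter> M) = \<delta>" using JM c(5)[OF True] by simp
    then show ?thesis using c(7) c(5)[OF True] True cU cN cM by simp
  next
    case False
    have "1 \<le> p - card J" using c(6)[OF False] by simp
    from binomial_second_difference[OF this d1, of N r]
    have "((N - (p - card J)) choose r) + ((N - \<delta>) choose r) + F \<le> (N choose r)
        + ((N - (p - card J) - \<delta>) choose r)"
      using assms(5,6) by (simp add: F_def N_def)
    moreover have "N - (p - card J) - \<delta> = N - (p - card (J \<inter> M))" using JM Jp by simp
    ultimately have "((N - (p - card J)) choose r) + ((N - \<delta>) choose r) + F
        \<le> (N choose r) + ((N - (p - card (J \<inter> M))) choose r)" by (simp only:)
    moreover have "(card (insert M \<M>) - 2) * F = (card \<M> - 2) * F + F"
    proof -
      obtain z where "card \<M> = z + 2" using cM(2) False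
          by (metis add.commute le_Suc_ex le_neq_implies_less Suc_1 Suc_leI)
      then show ?thesis using cM(1) by simp
    qed
    ultimately show ?thesis using c(7) cU cN by linarith
  qed
  have shad: "\<H> \<union> \<N> \<subseteq> disjoint_shadow S r (insert M \<M>)"
    using c(4) unfolding disjoint_shadow_def \<N>_def by blast
  have sep: "F \<le> card {H \<in> [S - A]\<^bsup>r\<^esup>. H \<notin> \<H> \<union> \<N>}" if A: "A \<in> [S]\<^bsup>p\<^esup>" "A \<notin> insert M \<M>" for A
  proof -
    have fin: "finite {H \<in> [S - A]\<^bsup>r\<^esup>. H \<notin> \<H> \<union> \<N>}" using assms(2)
        by (simp add: finite_imp_finite_nsets)
    have As: "A \<subseteq> S" "finite A" "card A = p" using nsetsD[OF A(1)] by auto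
    consider "\<not> J \<inter> M \<subseteq> A" | "J \<inter> M \<subseteq> A" "\<not> J \<subseteq> A" | "J \<subseteq> A" by blast
    then show ?thesis
    proof cases
      case 1
      have "\<Inter>(insert M \<M>) = J \<inter> M" unfolding J_def by blast
      then have "(card S - p - 1) choose (r - 1) \<le> card {H \<in> [S - A]\<^bsup>r\<^esup>. H \<notin> \<H> \<union> \<N>}"
        using 1 c(1) assms(3,5) by (intro separating_chain_outside[OF assms(2) shad A(1)]) auto
      then show ?thesis using binomial_drop_le[of r N] assms(5,6) unfolding F_def N_def by linarith
    next
      case 2
      obtain w where w: "w \<in> J" "w \<notin> A" using 2 by blast
      obtain u where u: "u \<in> M" "u \<notin> A" using M As A(2) by (metis card_subset_eq insertI1 subsetI)
      have wu: "w \<noteq> u" "{w,u} \<subseteq> S - A" using w u 2 J M by auto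
      have "{H \<in> [S - A]\<^bsup>r\<^esup>. {w,u} \<subseteq> H} \<subseteq> {H \<in> [S - A]\<^bsup>r\<^esup>. H \<notin> \<H> \<union> \<N>}"
        using hitJ w u unfolding \<N>_def by blast
      then have "card {H \<in> [S - A]\<^bsup>r\<^esup>. {w,u} \<subseteq> H} \<le> card {H \<in> [S - A]\<^bsup>r\<^esup>. H \<notin> \<H> \<union> \<N>}"
        using fin by (intro card_mono)
      then show ?thesis using card_containing_outside[OF assms(2) A(1) wu(2), of r] wu(1) assms(5)
        by (simp add: F_def N_def numeral_2_eq_2)
    next
      case 3
      have "{H \<in> [S - A]\<^bsup>r\<^esup>. H \<notin> \<H> \<union> \<N>} = {H \<in> [S - A]\<^bsup>r\<^esup>. H \<notin> \<H>}"
        using 3 unfolding \<N>_def nsets_def by blast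
      then show ?thesis using c(8)[OF A(1)] A(2) by simp
    qed
  qed
  have "\<Inter>(insert M \<M>) = J \<inter> M" unfolding J_def by blast
  moreover have "card (J \<inter> M) < p" using JM d1 Jp by linarith
  moreover have "card (insert M \<M>) \<noteq> 1" using cM by simp
  ultimately show ?thesis
    using c(1-3) assms(3) shad count sep
    unfolding separating_chain_def N_def[symmetric] J_def[symmetric] F_def[symmetric] \<N>_def[symmetric] by simp
qed

lemma obtain_separating_chain:
  assumes "finite S" "\<X> \<subseteq> [S]\<^bsup>p\<^esup>" "\<X> \<noteq> {}" "card (\<Inter>\<X>) \<le> m" "m < p" "2 \<le> r" "p + 2 \<le> card S"
  obtains \<M> \<H> where "\<M> \<subseteq> \<X>" "separating_chain S p r \<M> \<H>" "card (\<Inter>\<M>) \<le> m"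
proof -
  have ex: "\<exists>\<M>' \<H>'. \<M>' \<subseteq> \<X> \<and> separating_chain S p r \<M>' \<H>' \<and> card (\<Inter>\<M>') \<le> m"
    if "separating_chain S p r \<M> \<H>" "\<M> \<subseteq> \<X>" for \<M> \<H>
    using that
  proof (induction "card (\<Inter>\<M>)" arbitrary: \<M> \<H> rule: less_induct)
    case less
    show ?case
    proof (cases "card (\<Inter>\<M>) \<le> m")
      case True
      then show ?thesis using less.prems by blast
    next
      case False
      have ne: "\<M> \<noteq> {}" "\<M> \<subseteq> [S]\<^bsup>p\<^esup>" using less.prems(1) unfolding separating_chain_def by blast+
      obtain M0 where M0: "M0 \<in> \<M>" using ne by blast
      have fin: "finite (\<Inter>\<M>)" using nsetsD(2)[OF subsetD[OF ne(2) M0]] M0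
          by (meson Inter_lower finite_subset)
      obtain X0 where X0: "X0 \<in> \<X>" using assms(3) by blast
      have finX: "finite (\<Inter>\<X>)" using nsetsD(2)[OF subsetD[OF assms(2) X0]] X0
          by (meson Inter_lower finite_subset)
      have "\<exists>M\<in>\<X>. \<not> \<Inter>\<M> \<subseteq> M"
      proof (rule ccontr)
        assume "\<not> ?thesis"
        then have "\<Inter>\<M> \<subseteq> \<Inter>\<X>" by blast
        then have "card (\<Inter>\<M>) \<le> card (\<Inter>\<X>)" using finX by (rule card_mono[rotated])
        then show False using False assms(4) by simp
      qed
      then obtain M where M: "M \<in> \<X>" "\<not> \<Inter>\<M> \<subseteq> M" by blast
      have "\<Inter>(insert M \<M>) \<subset> \<Inter>\<M>" using M(2) by auto
      then have "card (\<Inter>(insert M \<M>)) < card (\<Inter>\<M>)" using fin by (rule psubset_card_mono[rotated])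
      moreover have "separating_chain S p r (insert M \<M>) (\<H> \<union> {H \<in> [S]\<^bsup>r\<^esup>. H \<inter> M = {} \<and> H \<inter> \<Inter>\<M> \<noteq> {}})"
        using separating_chain_insert[OF less.prems(1) assms(1) subsetD[OF assms(2) M(1)] M(2) assms(6,7)] .
      ultimately show ?thesis using less.hyps less.prems(2) M(1) by blast
    qed
  qed
  obtain M where M: "M \<in> \<X>" using assms(3) by blast
  have "separating_chain S p r {M} {H \<in> [S]\<^bsup>r\<^esup>. H \<inter> M = {}}"
    using separating_chain_single[OF assms(1) subsetD[OF assms(2) M] assms(6,7)] .
  then show ?thesis using ex[of "{M}"] M that by blast
qed

section \<open>Double counting between a family and its disjoint shadow\<close>

locale chained_family =
  fixes S :: "'a set" and p r :: nat and \<X> \<M> \<H> :: "'a set set" and I :: "'a set"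
  assumes finS: "finite S" and sub: "\<X> \<subseteq> [S]\<^bsup>p\<^esup>" and I: "\<And>X. X \<in> \<X> \<Longrightarrow> I \<subseteq> X" "card I = 3" "I \<subseteq> S"
    and chain: "separating_chain S p r \<M> \<H>" and MX: "\<M> \<subseteq> \<X>"
    and size: "3 \<le> p" "2 \<le> r" "p + r < card S"
begin

definition E where "E = (card S - 3 - r) choose (p - 3)"
definition F where "F = (card S - p - 2) choose (r - 2)"
definition new where "new = disjoint_shadow S r \<X> - \<H>"
definition up where "up A = card {H \<in> new. A \<inter> H = {}}"
definition down where "down H = card {A \<in> \<X> - \<M>. A \<inter> H = {}}"

lemma finites: "finite \<X>" "finite \<M>" "finite new" "finite \<H>" "finite (disjoint_shadow S r \<X>)"
proof -
  have fr: "finite ([S]\<^bsup>r\<^esup>)" "finite ([S]\<^bsup>p\<^esup>)" using finS by (simp_all add: finite_imp_finite_nsets)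
  show "finite \<X>" using sub fr(2) by (rule finite_subset)
  then show "finite \<M>" using MX by (rule finite_subset[rotated])
  show d: "finite (disjoint_shadow S r \<X>)" unfolding disjoint_shadow_def using fr(1) by simp
  then show "finite new" unfolding new_def by simp
  have "\<H> \<subseteq> disjoint_shadow S r \<M>" using chain unfolding separating_chain_def by blast
  also have "\<dots> \<subseteq> [S]\<^bsup>r\<^esup>" unfolding disjoint_shadow_def by blast
  finally show "finite \<H>" using fr(1) by (rule finite_subset)
qed

lemma H_sub: "\<H> \<subseteq> disjoint_shadow S r \<M>" "\<H> \<subseteq> disjoint_shadow S r \<X>"
proof -
  show a: "\<H> \<subseteq> disjoint_shadow S r \<M>" using chain unfolding separating_chain_def by blast
  show "\<H> \<subseteq> disjoint_shadow S r \<X>" using a MX unfolding disjoint_shadow_def by blast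
qed

lemma card_new: "card new + card \<H> = card (disjoint_shadow S r \<X>)"
  unfolding new_def using H_sub(2) finites(4,5) by (simp add: card_Diff_subset card_mono)

lemma up_eq: "A \<in> \<X> \<Longrightarrow> up A = card {H \<in> [S - A]\<^bsup>r\<^esup>. H \<notin> \<H>}"
proof -
  assume A: "A \<in> \<X>"
  have "{H \<in> new. A \<inter> H = {}} = {H \<in> [S - A]\<^bsup>r\<^esup>. H \<notin> \<H>}"
    using A unfolding new_def disjoint_shadow_def nsets_def by blast
  then show ?thesis unfolding up_def by simp
qed

lemma up_ge: "A \<in> \<X> - \<M> \<Longrightarrow> F \<le> up A"
  using chain sub up_eq unfolding separating_chain_def F_def by (simp add: subset_iff)

lemma down_le: "H \<in> new \<Longrightarrow> down H \<le> E"
proof -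
  assume H: "H \<in> new"
  have HS: "H \<in> [S]\<^bsup>r\<^esup>" using H unfolding new_def disjoint_shadow_def by blast
  let ?B = "{A \<in> [S]\<^bsup>p\<^esup>. I \<subseteq> A \<and> A \<inter> H = {}}"
  have fB: "finite ?B" using finS by (simp add: finite_imp_finite_nsets)
  have sb: "{A \<in> \<X> - \<M>. A \<inter> H = {}} \<subseteq> ?B" using sub I(1) by blast
  show "down H \<le> E"
  proof (cases "I \<inter> H = {}")
    case True
    have "card ?B = E"
      using card_nsets_containing_avoiding[OF finS I(3) nsetsD(1)[OF HS] True] I(2) size nsetsD(3)[OF HS]
      by (simp add: E_def)
    then show ?thesis unfolding down_def using card_mono[OF fB sb] by simp
  next
    case False
    then have "{A \<in> \<X> - \<M>. A \<inter> H = {}} = {}" using I(1) by blast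
    then show ?thesis unfolding down_def by (simp only: card.empty)
  qed
qed

lemma sum_up: "(\<Sum>A\<in>\<X> - \<M>. up A) = (\<Sum>H\<in>new. down H)"
  unfolding up_def down_def by (rule double_count) (use finites in auto)

lemma sum_up_le: "(\<Sum>A\<in>\<X> - \<M>. up A) \<le> E * card new"
  unfolding sum_up using sum_mono[of new down "\<lambda>_. E"] down_le by (simp add: mult.commute)

lemma card_rest: "card (\<X> - \<M>) = card \<X> - card \<M>"
  using finites MX by (simp add: card_Diff_subset)

lemma sum_up_ge: "F * (card \<X> - card \<M>) \<le> (\<Sum>A\<in>\<X> - \<M>. up A)"
  using sum_mono[of "\<X> - \<M>" "\<lambda>_. F" up] up_ge by (simp add: card_rest mult.commute)

text \<open>Members of the chain after the second one raise the size of \<H> by \<open>F\<close>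
  each, and members outside the chain raise that of \<open>new\<close> by \<open>F / E\<close> on
  average. As \<open>1 \<le> E\<close>, all of them can be charged at the common rate
  \<open>F / E\<close>.\<close>

lemma flow_bound:
  assumes "card (\<Inter>\<M>) \<le> m" "m \<le> p"
  shows "E * (2 * ((card S - p) choose r)) + (card \<M> - 2) * F + F * (card \<X> - card \<M>)
    \<le> E * (card (disjoint_shadow S r \<X>) + ((card S - p - (p - m)) choose r))"
proof -
  have "2 * ((card S - p) choose r) + (card \<M> - 2) * F \<le> card \<H>
      + ((card S - p - (p - card (\<Inter>\<M>))) choose r)"
    using chain unfolding separating_chain_def F_def by blast
  also have "\<dots> \<le> card \<H> + ((card S - p - (p - m)) choose r)"
    using assms by (intro add_left_mono binomial_left_mono) simp
  finally have "E * (2 * ((card S - p) choose r) + (card \<M> - 2) * F)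
      \<le> E * (card \<H> + ((card S - p - (p - m)) choose r))" by (rule mult_le_mono2)
  then have "E * (2 * ((card S - p) choose r)) + E * ((card \<M> - 2) * F) + E * card new
    \<le> E * (card (disjoint_shadow S r \<X>) + ((card S - p - (p - m)) choose r))"
    unfolding card_new[symmetric] by (simp add: algebra_simps)
  moreover have "1 * ((card \<M> - 2) * F) \<le> E * ((card \<M> - 2) * F)"
  proof (rule mult_le_mono1)
    show "1 \<le> E" unfolding E_def using size by (simp add: Suc_le_eq)
  qed
  ultimately show ?thesis using sum_up_le sum_up_ge by linarith
qed

lemma card_M_le: "card \<M> \<le> card \<X>"
  using finites(1) MX by (rule card_mono)

end

text \<open>\<open>\<kappa>\<close> is the number of members that the extremal family has off its
  center. For \<open>m = p\<close> a single member is already a chain; for \<open>m < p\<close> a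
  chain with intersection of size at most \<open>m\<close> has at least two.\<close>

lemma disjoint_shadow_bound:
  assumes "finite S" "\<X> \<subseteq> [S]\<^bsup>p\<^esup>" "\<X> \<noteq> {}" "3 \<le> card (\<Inter>\<X>)" "card (\<Inter>\<X>) \<le> m" "m \<le> p"
    and size: "3 \<le> p" "2 \<le> r" "p + r < card S"
  defines "\<kappa> \<equiv> if m = p then 1 else 2"
    and E_eq: "E \<equiv> (card S - 3 - r) choose (p - 3)" and F_eq: "F \<equiv> (card S - p - 2) choose (r - 2)"
  shows "\<kappa> \<le> card \<X>"
    and "E * (2 * ((card S - p) choose r)) + F * (card \<X> - \<kappa>)
      \<le> E * (card (disjoint_shadow S r \<X>) + ((card S - p - (p - m)) choose r))"
proof -
  obtain M where M: "M \<in> \<X>" using assms(3) by blast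
  have MS: "M \<in> [S]\<^bsup>p\<^esup>" using M assms(2) by blast
  obtain I where I: "I \<subseteq> \<Inter>\<X>" "card I = 3" using assms(4) by (meson obtain_subset_with_card_n)
  have IX: "\<And>X. X \<in> \<X> \<Longrightarrow> I \<subseteq> X" and IS: "I \<subseteq> S" using I(1) M nsetsD(1)[OF MS] by auto
  have s2: "p + 2 \<le> card S" using size by simp
  have "\<kappa> \<le> card \<X> \<and> E * (2 * ((card S - p) choose r)) + F * (card \<X> - \<kappa>)
      \<le> E * (card (disjoint_shadow S r \<X>) + ((card S - p - (p - m)) choose r))"
  proof (cases "m = p")
    case True
    have ch: "separating_chain S p r {M} {H \<in> [S]\<^bsup>r\<^esup>. H \<inter> M = {}}"
      using separating_chain_single[OF assms(1) MS size(2) s2] .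
    interpret chained_family S p r \<X> "{M}" "{H \<in> [S]\<^bsup>r\<^esup>. H \<inter> M = {}}" I
      by unfold_locales (use assms(1,2) IX I(2) IS ch M size in auto)
    have "card (\<Inter>{M}) \<le> m" using True nsetsD(3)[OF MS] by simp
    then show ?thesis
      using flow_bound[of m] card_M_le True unfolding \<kappa>_def E_eq F_eq E_def F_def by simp
  next
    case False
    then have mp: "m < p" using assms(6) by simp
    obtain \<M> \<H> where ch: "\<M> \<subseteq> \<X>" "separating_chain S p r \<M> \<H>" "card (\<Inter>\<M>) \<le> m"
      using obtain_separating_chain[OF assms(1-3,5) mp size(2) s2] by blast
    interpret chained_family S p r \<X> \<M> \<H> I
      by unfold_locales (use assms(1,2) IX I(2) IS ch size in auto)
    have "\<M> \<noteq> {}" "card \<M> = 1 \<longrightarrow> card (\<Inter>\<M>) = p" using ch(2) unfolding separating_chain_def by blast+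
    then have c2: "2 \<le> card \<M>" using mp ch(3) finites(2) card_gt_0_iff[of \<M>] by (cases "card \<M>
        = 1") auto
    have "card \<X> - 2 = (card \<M> - 2) + (card \<X> - card \<M>)" using c2 card_M_le by simp
    then have "F * (card \<X> - 2) = (card \<M> - 2) * F + F * (card \<X> - card \<M>)"
      by (simp add: add_mult_distrib2 mult.commute)
    then show ?thesis
      using flow_bound[OF ch(3) less_imp_le[OF mp]] c2 card_M_le False
      unfolding \<kappa>_def E_eq F_eq E_def F_def by (simp add: add.assoc)
  qed
  then show "\<kappa> \<le> card \<X>"
    and "E * (2 * ((card S - p) choose r)) + F * (card \<X> - \<kappa>)
      \<le> E * (card (disjoint_shadow S r \<X>) + ((card S - p - (p - m)) choose r))" by blast+
qed

text \<open>Suppose \<open>w \<noteq> Min U\<close> enters the intersection and \<open>X\<close>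
  misses \<open>w\<close>. Then \<open>X\<close> moves and \<open>w \<in> U\<close>, so
  \<open>U\<close> has at least two elements and the exchange of \<open>Min V\<close> for
  \<open>Min U\<close> is already trivial. It puts into \<F> a variant of \<open>X\<close> that
  contains \<open>Min U\<close>, hence does not move, and still misses \<open>w\<close>.\<close>

lemma Inter_compress:
  assumes UV: "exchange_pair S U V" and "\<F> \<subseteq> [S]\<^bsup>k\<^esup>"
    and st: "\<And>U' V'. exchange_pair S U' V' \<Longrightarrow> card U' < card U \<Longrightarrow> compressed U' V' \<F>"
  shows "\<Inter>(compress U V \<F>) \<subseteq> insert (Min U) (\<Inter>\<F>)"
proof
  fix w assume w: "w \<in> \<Inter>(compress U V \<F>)"
  have U: "finite U" "finite V" "U \<noteq> {}" "V \<noteq> {}" "card U = card V" "U \<subseteq> S" "V \<subseteq> S" "Min U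
      < Min V" "U \<inter> V = {}"
    using UV by (auto simp: exchange_pair_def)
  show "w \<in> insert (Min U) (\<Inter>\<F>)"
  proof (rule ccontr)
    assume "w \<notin> insert (Min U) (\<Inter>\<F>)"
    then obtain X where X: "X \<in> \<F>" "w \<notin> X" and wU: "w \<noteq> Min U" by blast
    have fixed: "w \<in> Y" if "Y \<in> \<F>" "exchange U V \<F> Y = Y" for Y
    proof -
      have "Y \<in> compress U V \<F>" using that by (metis image_eqI)
      then show ?thesis using w by blast
    qed
    have "exchange U V \<F> X \<noteq> X" using fixed[OF X(1)] X(2) by blast
    then have mv: "V \<subseteq> X" "U \<inter> X = {}" "exchange U V \<F> X = (X - V) \<union> U"
      unfolding exchange_def by (auto split: if_splits)
    have "(X - V) \<union> U \<in> compress U V \<F>" using X(1) mv(3) by (metis image_eqI)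
    then have "w \<in> (X - V) \<union> U" using w by blast
    then have "w \<in> U" using X(2) by blast
    have mU: "Min U \<in> U" "Min V \<in> V" using U by auto
    have "card {Min U, w} \<le> card U" using mU \<open>w \<in> U\<close> U(1) by (intro card_mono) auto
    then have "1 < card U" using wU by simp
    have "Min U \<in> S" "Min V \<in> S" "Min U \<noteq> Min V" using U(6-8) mU by auto
    then have "exchange_pair S {Min U} {Min V}" using U(8) unfolding exchange_pair_def by simp
    then have "compressed {Min U} {Min V} \<F>" using \<open>1 < card U\<close> by (intro st) auto
    moreover have "{Min V} \<subseteq> X" "{Min U} \<inter> X = {}" using mv mU by auto
    ultimately have X2: "(X - {Min V}) \<union> {Min U} \<in> \<F>" using X(1) unfolding compressed_def by blast
    have "exchange U V \<F> ((X - {Min V}) \<union> {Min U}) = (X - {Min V}) \<union> {Min U}"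
      using mU by (auto simp: exchange_def)
    from fixed[OF X2 this] show False using X(2) wU by blast
  qed
qed

text \<open>\<open>disjoint_shadow_bound\<close> needs three common elements but at most
  \<open>m\<close>. While fewer than three are common, a compression leaves at most three, hence at
  most \<open>m\<close>. Once there are three, the bound is applied directly and no further
  compression is made. At a fully compressed family the size condition on \<X> guarantees
  three.\<close>

lemma shadow_bound:
  fixes \<X> \<Y> :: "nat set set"
  assumes "finite S" "\<X> \<subseteq> [S]\<^bsup>p\<^esup>" "\<Y> \<subseteq> [S]\<^bsup>r\<^esup>" "cross_intersecting \<X> \<Y>"
    and ne: "\<X> \<noteq> {}" and Inter: "card (\<Inter>\<X>) \<le> m" and m: "3 \<le> m" "m \<le> p"
    and small: "card \<X> \<le> (card S - 3) choose (p - 3)"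
    and size: "3 \<le> p" "2 \<le> r" "p + r < card S"
  defines "\<kappa> \<equiv> if m = p then 1 else 2"
    and "E \<equiv> (card S - 3 - r) choose (p - 3)" and "F \<equiv> (card S - p - 2) choose (r - 2)"
  shows "\<kappa> \<le> card \<X> \<and>
    E * (card \<Y> + 2 * ((card S - p) choose r)) + F * (card \<X> - \<kappa>)
      \<le> E * ((card S choose r) + ((card S - p - (p - m)) choose r))"
proof -
  let ?goal = "\<lambda>\<X> \<Y>. \<kappa> \<le> card \<X> \<and>
    E * (card \<Y> + 2 * ((card S - p) choose r)) + F * (card \<X> - \<kappa>)
      \<le> E * ((card S choose r) + ((card S - p - (p - m)) choose r))"
  have direct: "?goal \<X> \<Y>"
    if X: "\<X> \<subseteq> [S]\<^bsup>p\<^esup>" "\<Y> \<subseteq> [S]\<^bsup>r\<^esup>" "cross_intersecting \<X> \<Y>" "\<X> \<noteq> {}" "3 \<le> card (\<Inter>\<X>)" "card (\<Inter>\<X>) \<le> m"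
    for \<X> \<Y> :: "nat set set"
  proof -
    note b = disjoint_shadow_bound[OF assms(1) X(1,4,5,6) m(2) size, folded \<kappa>_def E_def F_def]
    have fin: "finite ([S]\<^bsup>r\<^esup>)" using assms(1) by (simp add: finite_imp_finite_nsets)
    have ds: "disjoint_shadow S r \<X> \<subseteq> [S]\<^bsup>r\<^esup>" unfolding disjoint_shadow_def by blast
    have "\<Y> \<inter> disjoint_shadow S r \<X> = {}" using X(3)
        unfolding cross_intersecting_def disjoint_shadow_def by blast
    then have "card \<Y> + card (disjoint_shadow S r \<X>) = card (\<Y> \<union> disjoint_shadow S r \<X>)"
      using finite_subset[OF X(2) fin] finite_subset[OF ds fin] by (simp add: card_Un_disjoint)
    also have "\<dots> \<le> card ([S]\<^bsup>r\<^esup>)" using X(2) ds fin by (intro card_mono) auto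
    finally have "card \<Y> + card (disjoint_shadow S r \<X>) \<le> card S choose r" by simp
    then have "E * (card \<Y> + card (disjoint_shadow S r \<X>)) \<le> E * (card S choose r)"
        by (rule mult_le_mono2)
    then show ?thesis using b unfolding add_mult_distrib2 by linarith
  qed
  have "\<X> \<noteq> {} \<longrightarrow> card (\<Inter>\<X>) \<le> m \<longrightarrow> card \<X> \<le> (card S - 3) choose (p - 3) \<longrightarrow> ?goal \<X> \<Y>"
    using assms(1-4)
  proof (induction rule: compression_induct)
    case (compressed \<X> \<Y>)
    show ?case
    proof (intro impI)
      assume h: "\<X> \<noteq> {}" "card (\<Inter>\<X>) \<le> m" "card \<X> \<le> (card S - 3) choose (p - 3)"
      obtain I where I: "I \<subseteq> S" "card I = 3" "\<And>i j. i \<in> I \<Longrightarrow> j \<in> S - I \<Longrightarrow> i < j"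
        using obtain_initial_segment[OF assms(1), of 3] size by auto
      have st: "\<And>U V. exchange_pair S U V \<Longrightarrow> compressed U V \<X>" using compressed(4) by blast
      have "card I \<le> p" "card \<X> \<le> (card S - card I) choose (p - card I)" using I(2) size h(3)
          by simp_all
      then have "I \<subseteq> \<Inter>\<X>" using compressed_containing[OF assms(1) compressed(1) st I(1,3)] by blast
      moreover obtain X where X: "X \<in> \<X>" using h(1) by blast
      then have "finite (\<Inter>\<X>)" using nsetsD(2)[OF subsetD[OF compressed(1) X]]
          by (meson Inter_lower finite_subset)
      ultimately have "3 \<le> card (\<Inter>\<X>)" using card_mono I(2) by metis
      then show "?goal \<X> \<Y>" using direct[OF compressed(1-3) h(1) _ h(2)] by blast
    qed
  next
    case (step \<X> \<Y> U V)
    show ?case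
    proof (intro impI)
      assume h: "\<X> \<noteq> {}" "card (\<Inter>\<X>) \<le> m" "card \<X> \<le> (card S - 3) choose (p - 3)"
      show "?goal \<X> \<Y>"
      proof (cases "3 \<le> card (\<Inter>\<X>)")
        case True
        then show ?thesis using direct[OF step(1-3) h(1) _ h(2)] by blast
      next
        case False
        obtain X where X: "X \<in> \<X>" using h(1) by blast
        then have fin: "finite (\<Inter>\<X>)" using nsetsD(2)[OF subsetD[OF step(1) X]]
            by (meson Inter_lower finite_subset)
        have st: "\<And>U' V'. exchange_pair S U' V' \<Longrightarrow> card U' < card U \<Longrightarrow> compressed U' V' \<X>"
          using step(5) by blast
        have "card (\<Inter>(compress U V \<X>)) \<le> card (insert (Min U) (\<Inter>\<X>))"
          using fin by (intro card_mono Inter_compress[OF step(4,1) st]) auto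
        also have "\<dots> \<le> Suc (card (\<Inter>\<X>))" by (rule card_insert_le_m1[of "Suc (card (\<Inter>\<X>))"]) auto
        finally have "card (\<Inter>(compress U V \<X>)) \<le> m" using False m by simp
        moreover have "compress U V \<X> \<noteq> {}" using h(1) by blast
        ultimately have "?goal (compress U V \<X>) (compress U V \<Y>)"
          using step(9) h(3) unfolding card_compress by blast
        then show ?thesis unfolding card_compress .
      qed
    qed
  qed
  then show ?thesis using ne Inter small by blast
qed

section \<open>Comparison with the extremal families\<close>

text \<open>Inclusion-exclusion for the sets through 1 that miss \<open>Q\<^sub>1\<close> or
  \<open>Q\<^sub>2\<close>. The term \<open>card {P\<^sub>1, P\<^sub>2}\<close> stays symbolic
  because the two sets may coincide.\<close>

lemma card_star_family:
  assumes P: "P\<^sub>1 \<in> [{2..n}]\<^bsup>k\<^esup>" "P\<^sub>2 \<in> [{2..n}]\<^bsup>k\<^esup>" and Q: "Q\<^sub>1 \<in> [{2..n}]\<^bsup>l\<^esup>" "Q\<^sub>2 \<in> [{2..n}]\<^bsup>l\<^esup>"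
    and t: "card (Q\<^sub>1 \<inter> Q\<^sub>2) = t" and "1 \<le> k" "1 \<le> n"
  shows "card (star_family n k P\<^sub>1 P\<^sub>2 Q\<^sub>1 Q\<^sub>2) + 2 * ((n - 1 - l) choose (k - 1))
    = ((n - 1) choose (k - 1)) + ((n - 1 - l - (l - t)) choose (k - 1)) + card {P\<^sub>1, P\<^sub>2}"
proof -
  let ?G = "{1..n}"
  note Q1 = nsetsD[OF Q(1)] and Q2 = nsetsD[OF Q(2)]
  define S0 where "S0 = {H \<in> [?G]\<^bsup>k\<^esup>. {1} \<subseteq> H \<and> H \<inter> {} = {}}"
  define N where "N Q = {H \<in> [?G]\<^bsup>k\<^esup>. {1} \<subseteq> H \<and> H \<inter> Q = {}}" for Q
  have fin: "finite ([?G]\<^bsup>k\<^esup>)" by (simp add: finite_imp_finite_nsets)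
  have cN: "card (N Q) = (n - 1 - card Q) choose (k - 1)" if "Q \<subseteq> {2..n}" for Q
  proof -
    have "{1} \<inter> Q = {}" "Q \<subseteq> ?G" using that by auto
    then show ?thesis
      using card_nsets_containing_avoiding[of ?G "{1}" Q k] assms(6,7) unfolding N_def by simp
  qed
  have star: "star_family n k P\<^sub>1 P\<^sub>2 Q\<^sub>1 Q\<^sub>2 = (N {} - (N Q\<^sub>1 \<union> N Q\<^sub>2)) \<union> {P\<^sub>1, P\<^sub>2}"
    unfolding star_family_def N_def by blast
  have "1 \<notin> P\<^sub>1" "1 \<notin> P\<^sub>2" using nsetsD(1)[OF P(1)] nsetsD(1)[OF P(2)] by auto
  then have "(N {} - (N Q\<^sub>1 \<union> N Q\<^sub>2)) \<inter> {P\<^sub>1, P\<^sub>2} = {}" unfolding N_def by blast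
  moreover have fN: "finite (N Q)" for Q unfolding N_def using fin by simp
  ultimately have c1: "card (star_family n k P\<^sub>1 P\<^sub>2 Q\<^sub>1 Q\<^sub>2) = card (N {} - (N Q\<^sub>1 \<union> N Q\<^sub>2))
      + card {P\<^sub>1, P\<^sub>2}"
    unfolding star by (intro card_Un_disjoint) auto
  have "N Q\<^sub>1 \<union> N Q\<^sub>2 \<subseteq> N {}" unfolding N_def by blast
  then have c2: "card (N {} - (N Q\<^sub>1 \<union> N Q\<^sub>2)) + card (N Q\<^sub>1 \<union> N Q\<^sub>2) = card (N {})"
    using fN by (metis card_Diff_subset card_mono finite_Un le_add_diff_inverse2)
  have c3: "card (N Q\<^sub>1) + card (N Q\<^sub>2) = card (N Q\<^sub>1 \<union> N Q\<^sub>2) + card (N Q\<^sub>1 \<inter> N Q\<^sub>2)"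
    using fN fN by (rule card_Un_Int)
  have "N Q\<^sub>1 \<inter> N Q\<^sub>2 = N (Q\<^sub>1 \<union> Q\<^sub>2)" unfolding N_def by blast
  moreover have "card (Q\<^sub>1 \<union> Q\<^sub>2) = l + (l - t)"
  proof -
    have "card Q\<^sub>1 + card Q\<^sub>2 = card (Q\<^sub>1 \<union> Q\<^sub>2) + card (Q\<^sub>1 \<inter> Q\<^sub>2)" using Q1(2) Q2(2)
        by (rule card_Un_Int)
    moreover have "card (Q\<^sub>1 \<inter> Q\<^sub>2) \<le> card Q\<^sub>1" using Q1(2) by (intro card_mono) auto
    ultimately show ?thesis using Q1 Q2 t by simp
  qed
  moreover have "Q\<^sub>1 \<union> Q\<^sub>2 \<subseteq> {2..n}" using Q1 Q2 by auto
  ultimately have c4: "card (N Q\<^sub>1 \<inter> N Q\<^sub>2) = (n - 1 - (l + (l - t))) choose (k - 1)" using cN by simp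
  show ?thesis using c1 c2 c3 c4 cN[OF Q1(1)] cN[OF Q2(1)] cN[of "{}"] Q1(3) Q2(3) by simp
qed

lemma card_pair_nsets:
  assumes "A \<in> [S]\<^bsup>k\<^esup>" "B \<in> [S]\<^bsup>k\<^esup>" "card (A \<inter> B) = m"
  shows "card {A, B} = (if m = k then 1 else 2)"
proof (cases "A = B")
  case False
  note A = nsetsD[OF assms(1)] and B = nsetsD[OF assms(2)]
  have "m \<noteq> k"
  proof
    assume "m = k"
    have "A \<inter> B = A" by (rule card_subset_eq[OF A(2)]) (use A(3) \<open>m = k\<close> assms(3) in auto)
    moreover have "A \<inter> B = B" by (rule card_subset_eq[OF B(2)]) (use B(3) \<open>m = k\<close> assms(3) in auto)
    ultimately show False using False by blast
  qed
  then show ?thesis using False by simp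
qed (use assms nsetsD(3)[OF assms(1)] in simp)

text \<open>\<open>s\<close> stands for the size of the extremal family in place of \<B>. The
  binomials of \<open>star\<close> are those of \<open>shadow_bound\<close> on the
  \<open>n - 1\<close> elements other than \<open>z\<close>, so they cancel and only the excesses
  remain.\<close>

lemma star_deficiency:
  assumes A: "\<A> \<subseteq> [{1..n}]\<^bsup>a\<^esup>" and B: "\<B> \<subseteq> [{1..n}]\<^bsup>b\<^esup>" and cross: "cross_intersecting \<A> \<B>"
    and z: "z \<in> {1..n}" and Inter: "card (family_Inter {1..n} (diversity_part \<A> z)) \<le> m"
    and size: "3 \<le> m" "m \<le> a" "3 \<le> b" "a + b < n" and small: "avoid_count \<A> z
        \<le> (n - 4) choose (a - 3)"
    and star: "s + 2 * ((n - 1 - a) choose (b - 1))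
      = ((n - 1) choose (b - 1)) + ((n - 1 - a - (a - m)) choose (b - 1)) + \<kappa>'"
  defines "\<kappa> \<equiv> if m = a then 1 else 2"
    and "E \<equiv> (n - 3 - b) choose (a - 3)" and "F \<equiv> (n - 3 - a) choose (b - 3)"
  shows "\<kappa> \<le> avoid_count \<A> z" and "E * (card \<B> + \<kappa>') + F * (avoid_count \<A> z - \<kappa>) \<le> E * (s
      + avoid_count \<B> z)"
proof -
  let ?S = "{1..n} - {z}" and ?X = "{H \<in> \<A>. z \<notin> H}" and ?Y = "(\<lambda>H. H - {z}) ` {H \<in> \<B>. z \<in> H}"
  have fS: "finite ?S" and cS: "card ?S = n - 1" using z by simp_all
  have finB: "finite \<B>" using finite_subset[OF B] by (simp add: finite_imp_finite_nsets)
  have X: "?X \<subseteq> [?S]\<^bsup>a\<^esup>" using A unfolding nsets_def by blast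
  have Bz: "{H \<in> \<B>. z \<in> H} \<subseteq> [{1..n}]\<^bsup>b\<^esup>" using B by blast
  have Bz': "{z} \<subseteq> H \<and> H - {z} \<subseteq> ?S" if "H \<in> {H \<in> \<B>. z \<in> H}" for H
    using that nsetsD(1)[OF subsetD[OF Bz that]] by blast
  note im = Diff_image_in_nsets[OF Bz finite.insertI[OF finite.emptyI] Bz']
  have Y: "?Y \<subseteq> [?S]\<^bsup>(b - 1)\<^esup>" using im(1) by simp
  have cY: "card ?Y + avoid_count \<B> z = card \<B>" using im(2) card_split[OF finB, of "\<lambda>H. z \<in> H"]
      by simp
  have cr: "cross_intersecting ?X ?Y"
    unfolding cross_intersecting_def
  proof (intro ballI)
    fix F H assume "F \<in> ?X" "H \<in> ?Y"
    then obtain G where G: "F \<in> \<A>" "z \<notin> F" "G \<in> \<B>" "H = G - {z}" by blast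
    then have "F \<inter> G \<noteq> {}" using cross unfolding cross_intersecting_def by blast
    then show "F \<inter> H \<noteq> {}" using G by blast
  qed
  \<comment> \<open>If no member avoided \<open>z\<close>, the intersection would by convention be
    \<open>{1..n}\<close>, which has more than \<open>m\<close> elements.\<close>
  have ne: "?X \<noteq> {}"
  proof
    assume "?X = {}"
    then have "family_Inter {1..n} (diversity_part \<A> z) = {1..n}"
      unfolding family_Inter_def diversity_part_def by (simp only: Inter_empty Int_UNIV_right)
    then show False using Inter size by simp
  qed
  have "\<Inter>?X \<subseteq> {1..n}"
  proof -
    obtain X0 where "X0 \<in> ?X" using ne by blast
    then show ?thesis using nsetsD(1)[OF subsetD[OF X]] by blast
  qed
  then have "family_Inter {1..n} (diversity_part \<A> z) = \<Inter>?X"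
    unfolding family_Inter_def diversity_part_def by blast
  then have Int: "card (\<Inter>?X) \<le> m" using Inter by simp
  have eqs: "n - 1 - 3 = n - 4" "n - 4 - (b - 1) = n - 3 - b" "n - 1 - a - 2 = n - 3 - a"
      "b - 1 - 2 = b - 3"
    using size by auto
  have sz: "3 \<le> a" "2 \<le> b - 1" "a + (b - 1) < n - 1" using size by auto
  have sb: "\<kappa> \<le> card ?X \<and> E * (card ?Y + 2 * ((n - 1 - a) choose (b - 1))) + F * (card ?X - \<kappa>)
      \<le> E * (((n - 1) choose (b - 1)) + ((n - 1 - a - (a - m)) choose (b - 1)))"
    using shadow_bound[OF fS X Y cr ne Int size(1,2), unfolded cS eqs, OF small sz]
    unfolding \<kappa>_def E_def F_def .
  show "\<kappa> \<le> avoid_count \<A> z" using sb by blast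
  have "E * (card ?Y + 2 * ((n - 1 - a) choose (b - 1))) + F * (card ?X - \<kappa>)
      + E * (avoid_count \<B> z + \<kappa>')
      \<le> E * (((n - 1) choose (b - 1)) + ((n - 1 - a - (a - m)) choose (b - 1)))
          + E * (avoid_count \<B> z + \<kappa>')"
    using sb by simp
  also have "\<dots> = E * (s + 2 * ((n - 1 - a) choose (b - 1)) + avoid_count \<B> z)"
    unfolding star by (simp add: algebra_simps)
  finally show "E * (card \<B> + \<kappa>') + F * (avoid_count \<A> z - \<kappa>) \<le> E * (s + avoid_count \<B> z)"
    unfolding cY[symmetric] by (simp add: algebra_simps)
qed

theorem corollary1p7:
  fixes a b n m t x y :: nat
    and A\<^sub>1 A\<^sub>2 B\<^sub>1 B\<^sub>2 :: "nat set"
    and \<A> \<B> :: "nat set set"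
  assumes "a \<ge> b" and "b \<ge> 5" and "n > a + b"
    and "m \<in> {1..a}" and "t \<in> {1..b}"
    and "m \<ge> a - b + 3" and "t \<ge> 3"
    and "A\<^sub>1 \<in> [{2..n}]\<^bsup>a\<^esup>" and "A\<^sub>2 \<in> [{2..n}]\<^bsup>a\<^esup>" and "A\<^sub>1 \<inter> A\<^sub>2 = {2..m+1}"
    and "B\<^sub>1 \<in> [{2..n}]\<^bsup>b\<^esup>" and "B\<^sub>2 \<in> [{2..n}]\<^bsup>b\<^esup>" and "B\<^sub>1 \<inter> B\<^sub>2 = {2..t+1}"
    and "\<A> \<subseteq> [{1..n}]\<^bsup>a\<^esup>" and "\<B> \<subseteq> [{1..n}]\<^bsup>b\<^esup>"
    and "cross_intersecting \<A> \<B>"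
    and "max_degree_element {1..n} \<A> x" and "max_degree_element {1..n} \<B> y"
    and "card (family_Inter {1..n} (diversity_part \<A> x)) \<le> m"
    and "card (family_Inter {1..n} (diversity_part \<B> y)) \<le> t"
    and "card \<A> \<ge> card (star_family n a A\<^sub>1 A\<^sub>2 B\<^sub>1 B\<^sub>2)"
    and "card \<B> \<ge> card (star_family n b B\<^sub>1 B\<^sub>2 A\<^sub>1 A\<^sub>2)"
  shows "card \<A> = card (star_family n a A\<^sub>1 A\<^sub>2 B\<^sub>1 B\<^sub>2) \<and>
         card \<B> = card (star_family n b B\<^sub>1 B\<^sub>2 A\<^sub>1 A\<^sub>2)"
proof -
  note ab = assms(1-3)
  have mt: "3 \<le> m" "m \<le> a" "3 \<le> t" "t \<le> b" "a - m \<le> b - 3" "b - t \<le> b - 3" using assms(1,4-7) by auto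
  have cA: "card (A\<^sub>1 \<inter> A\<^sub>2) = m" and cB: "card (B\<^sub>1 \<inter> B\<^sub>2) = t" using assms(10,13) by simp_all
  define sA sB where "sA = card (star_family n a A\<^sub>1 A\<^sub>2 B\<^sub>1 B\<^sub>2)" and "sB
      = card (star_family n b B\<^sub>1 B\<^sub>2 A\<^sub>1 A\<^sub>2)"
  define \<kappa>A \<kappa>B :: nat where "\<kappa>A = (if m = a then 1 else 2)" and "\<kappa>B = (if t = b then 1 else 2)"
  have starA: "sA + 2 * ((n - 1 - b) choose (a - 1))
      = ((n - 1) choose (a - 1)) + ((n - 1 - b - (b - t)) choose (a - 1)) + \<kappa>A"
    using card_star_family[OF assms(8,9,11,12) cB] card_pair_nsets[OF assms(8,9) cA] ab
        unfolding sA_def \<kappa>A_def by simp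
  have starB: "sB + 2 * ((n - 1 - a) choose (b - 1))
      = ((n - 1) choose (b - 1)) + ((n - 1 - a - (a - m)) choose (b - 1)) + \<kappa>B"
    using card_star_family[OF assms(11,12,8,9) cA] card_pair_nsets[OF assms(11,12) cB] ab
        unfolding sB_def \<kappa>B_def by simp
  define dB dA :: real
    where "dB = 2 * real ((n - 1 - b) choose (a - 1)) - real ((n - 1 - b - (b - t)) choose (a - 1))"
      and "dA = 2 * real ((n - 1 - a) choose (b - 1)) - real ((n - 1 - a - (a - m)) choose (b - 1))"
  \<comment> \<open>Chosen so that the thresholds in \<open>large\<close> become exactly
    \<open>sA\<close> and \<open>sB\<close>.\<close>
  define p q where "p = real ((n - 4) choose (a - 1)) - real ((n - 4) choose (a - 3)) - dB + real \<kappa>A"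
    and "q = real ((n - 4) choose (b - 1)) - real ((n - 4) choose (b - 3)) - dA + real \<kappa>B"
  \<comment> \<open>This yields \<open>\<kappa>A < dB\<close> and \<open>\<kappa>B < dA\<close>, and
    thereby the strict upper bounds on \<open>p\<close> and \<open>q\<close> in
    \<open>weights\<close>.\<close>
  have deficit: "2 < 2 * real (N choose r) - real ((N - d) choose r)" if "3 \<le> r" "r
      < N" for N r d :: nat
  proof -
    have "Suc r choose r \<le> N choose r" using that by (intro binomial_left_mono) simp
    moreover have "(N - d) choose r \<le> N choose r" by (intro binomial_left_mono) simp
    moreover have "2 < Suc r choose r" using that by simp
    ultimately show ?thesis by linarith
  qed
  have W: "weights (real ((n - 4) choose (a - 1))) (real ((n - 4) choose (a - 2)))
      (real ((n - 4) choose (a - 3))) (real ((n - 4) choose (b - 1))) (real ((n - 4) choose (b - 2)))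
      (real ((n - 4) choose (b - 3))) p q"
    unfolding p_def q_def
  proof (rule weights_binomial[OF ab])
    show "dB \<le> 2 * real ((n - 1 - b) choose (a - 1)) - real ((n - 1 - b - (b - 3)) choose (a - 1))"
      unfolding dB_def using mt by (simp add: binomial_left_mono)
    show "dA \<le> 2 * real ((n - 1 - a) choose (b - 1)) - real ((n - 1 - a - (b - 3)) choose (b - 1))"
      unfolding dA_def using mt by (simp add: binomial_left_mono)
    have "2 < dB" unfolding dB_def using ab by (intro deficit) auto
    then show "real \<kappa>A < dB" unfolding \<kappa>A_def by simp
    have "2 < dA" unfolding dA_def using ab by (intro deficit) auto
    then show "real \<kappa>B < dA" unfolding \<kappa>B_def by simp
  qed (simp_all add: \<kappa>A_def \<kappa>B_def)
  have "large_pair a b n p q" unfolding large_pair_def using ab W by simp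
  then interpret large_pair a b n p q .
  interpret sw: large_pair b a n q p by (rule large_pair_swap)
  have "3 * c 2 + 4 * c 3 + c 4 + p = real sA"
  proof -
    have "real sA + 2 * real ((n - 1 - b) choose (a - 1))
      = real ((n - 1) choose (a - 1)) + real ((n - 1 - b - (b - t)) choose (a - 1)) + real \<kappa>A"
      using arg_cong[OF starA, of real] by simp
    then show ?thesis unfolding p_def dB_def pascal_a by simp
  qed
  moreover have "3 * e 2 + 4 * e 3 + e 4 + q = real sB"
  proof -
    have "real sB + 2 * real ((n - 1 - a) choose (b - 1))
      = real ((n - 1) choose (b - 1)) + real ((n - 1 - a - (a - m)) choose (b - 1)) + real \<kappa>B"
      using arg_cong[OF starB, of real] by simp
    then show ?thesis unfolding q_def dA_def pascal_b by simp
  qed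
  ultimately have L: "large \<A> \<B>"
    using assms(14-16,21,22) unfolding large_def sA_def[symmetric] sB_def[symmetric] by simp
  obtain z where z: "good_center \<A> \<B> z" using exists_good_center[OF L] by blast
  have z': "sw.good_center \<B> \<A> z" using z unfolding good_center_def sw.good_center_def by blast
  have xz: "x = z" by (rule max_degree_element_unique[OF L z assms(17)])
  have yz: "y = z" by (rule sw.max_degree_element_unique[OF large_swap[OF L] z' assms(18)])
  have zn: "z \<in> {1..n}" using z unfolding good_center_def by blast
  define k l where "k = avoid_count \<A> z" and "l = avoid_count \<B> z"
  have kl: "k \<le> (n - 4) choose (a - 3)" "l \<le> (n - 4) choose (b - 3)"
    using good_center_small(1,2)[OF L z] unfolding k_def l_def of_nat_le_iff by blast+
  define E F where "E = (n - 3 - b) choose (a - 3)" and "F = (n - 3 - a) choose (b - 3)"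
  have crBA: "cross_intersecting \<B> \<A>" using assms(16) cross_intersecting_commute by blast
  have b3: "3 \<le> b" "a + b < n" "3 \<le> a" "b + a < n" using ab by auto
  note hA = star_deficiency[OF assms(14,15,16) zn assms(19)[unfolded xz] mt(1,2) b3(1,2)
      kl(1)[unfolded k_def] starB, folded \<kappa>A_def E_def F_def k_def l_def]
  note hB = star_deficiency[OF assms(15,14) crBA zn assms(20)[unfolded yz] mt(3,4) b3(3,4)
      kl(2)[unfolded l_def] starA, folded \<kappa>B_def E_def F_def k_def l_def]
  obtain k' l' where kl': "k = \<kappa>A + k'" "l = \<kappa>B + l'" using hA(1) hB(1) le_Suc_ex by metis
  obtain \<alpha> \<beta> where \<alpha>\<beta>: "card \<A> = sA + \<alpha>" "card \<B> = sB + \<beta>"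
    using assms(21,22) unfolding sA_def sB_def by (metis le_Suc_ex)
  have "E * \<beta> + F * k' \<le> E * l'" using hA(2) unfolding \<alpha>\<beta> kl' by (simp add: algebra_simps)
  moreover have "F * \<alpha> + E * l' \<le> F * k'" using hB(2) unfolding \<alpha>\<beta> kl' by (simp add: algebra_simps)
  ultimately have "E * \<beta> = 0" "F * \<alpha> = 0" by linarith+
  moreover have "0 < E" "0 < F" unfolding E_def F_def using ab by auto
  ultimately show ?thesis using \<alpha>\<beta> unfolding sA_def sB_def by simp
qed

end
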